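(* Let $\alpha>2$ and $\tau>1$ be such that $\gamma:=\alpha(\tau-1)>2$, and for each $N$ let $G_N$ be the scale-free percolation random graph on the torus $\mathbb{T}_N$ with parameters $\alpha,\tau$. There exist constants $c_1,c_2>0$ such that, $\mathbb{P}$-almost surely, for $N$ large enough, $$c_1N^2\le t_{\rm mix}(G_N)\le N^2(\log N)^{c_2}.$$
   Context: Scale-free percolation (SFP) on the torus. Fix $\tau>1$ and $\alpha>0$ and write $\gamma:=\alpha(\tau-1)$. The vertex set of $G_N$ is $\mathbb{T}_N=\{1,\dots,N\}\cong\mathbb{Z}/N\mathbb{Z}$, with torus distance $\|x-y\|:=|x-y|\wedge(N-|x-y|)$. Under the probability measure $\mathbb{P}$, one associates to the vertices i.i.d. random weights $(W_x)_{x\in\mathbb{T}_N}$ with Pareto law $\mathbb{P}(W_1\ge t)=t^{-(\tau-1)}$ for $t\ge1$ and $\mathbb{P}(W_1\ge t)=1$ for $t<1$. Given the weights, pairs of distinct vertices $x,y$ are joined by an (undirected) edge independently with probability $1-\exp(-W_xW_y/\|x-y\|^{\alpha})$, except that $x$ and $x+1$ are always joined by an edge, for all $x\in\mathbb{T}_N$ (with $N+1$ identified with $1$). Mixing time. For a finite connected graph $G=(V,E)$ with degrees $D_x$, the lazy simple random walk on $G$ has transition matrix $P(x,x)=1/2$ and $P(x,y)=\frac{1}{2D_x}$ if $x,y$ are joined by an edge ($P(x,y)=0$ for other $y\ne x$); its reversible measure is $\pi(x)=D_x/\sum_{z\in V}D_z$. With $\|\mu-\nu\|_{\rm TV}=\frac12\sum_{x\in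 V}|\mu(x)-\nu(x)|$ and $d(n)=\sup_{x\in V}\|P^n(x,\cdot)-\pi\|_{\rm TV}$, set $t_{\rm mix}(G):=\inf\{n\in\mathbb{N}: d(n)<1/4\}$. *)

theory Defs
  imports "HOL-Probability.Probability"
begin

section \<open>Mixing time of the lazy simple random walk on a finite graph\<close>

text \<open>A simple graph is given by its vertex set \<open>V\<close> and its set \<open>E\<close> of edges, which are
  two-element subsets of \<open>V\<close>.\<close>

definition degree :: "'v set \<Rightarrow> 'v set set \<Rightarrow> 'v \<Rightarrow> nat" where
  "degree V E x = card {y \<in> V. {x, y} \<in> E}"

definition lazy_walk :: "'v set \<Rightarrow> 'v set set \<Rightarrow> 'v \<Rightarrow> 'v \<Rightarrow> real" where
  "lazy_walk V E x y =
     (if x = y then 1 / 2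
      else if {x, y} \<in> E then 1 / (2 * real (degree V E x))
      else 0)"

primrec kernel_power :: "'v set \<Rightarrow> ('v \<Rightarrow> 'v \<Rightarrow> real) \<Rightarrow> nat \<Rightarrow> 'v \<Rightarrow> 'v \<Rightarrow> real" where
  "kernel_power V P 0 = (\<lambda>x y. if x = y then 1 else 0)"
| "kernel_power V P (Suc n) = (\<lambda>x y. \<Sum>z\<in>V. P x z * kernel_power V P n z y)"

definition reversible_measure :: "'v set \<Rightarrow> 'v set set \<Rightarrow> 'v \<Rightarrow> real" where
  "reversible_measure V E x = real (degree V E x) / (\<Sum>z\<in>V. real (degree V E z))"

definition tv_dist :: "'v set \<Rightarrow> ('v \<Rightarrow> real) \<Rightarrow> ('v \<Rightarrow> real) \<Rightarrow> real" where
  "tv_dist V \<mu> \<nu> = 1 / 2 * (\<Sum>x\<in>V. \<bar>\<mu> x - \<nu> x\<bar>)"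

definition mixing_dist :: "'v set \<Rightarrow> 'v set set \<Rightarrow> nat \<Rightarrow> real" where
  "mixing_dist V E n =
     (SUP x\<in>V. tv_dist V (kernel_power V (lazy_walk V E) n x) (reversible_measure V E))"

text \<open>The infimum is taken over a nonempty set when the graph is finite, connected and has at
  least two vertices; on an empty set, \<open>Inf\<close> on \<^typ>\<open>nat\<close> returns \<open>0\<close>.\<close>

definition mixing_time :: "'v set \<Rightarrow> 'v set set \<Rightarrow> nat" where
  "mixing_time V E = Inf {n. mixing_dist V E n < 1 / 4}"


section \<open>Scale-free percolation on the torus\<close>

definition torus :: "nat \<Rightarrow> nat set" where
  "torus N = {1..N}"

definition torus_dist :: "nat \<Rightarrow> nat \<Rightarrow> nat \<Rightarrow> real" where
  "torus_dist N x y = min \<bar>real x - real y\<bar> (real N - \<bar>real x - real y\<bar>)"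

text \<open>On \<^term>\<open>torus N\<close> the successor of \<open>x\<close> is \<open>x mod N + 1\<close>, so that the successor of \<open>N\<close> is \<open>1\<close>.\<close>

definition consecutive :: "nat \<Rightarrow> nat \<Rightarrow> nat \<Rightarrow> bool" where
  "consecutive N x y \<longleftrightarrow> y = x mod N + 1 \<or> x = y mod N + 1"

definition torus_edges :: "nat \<Rightarrow> nat set set" where
  "torus_edges N = {{x, y} | x y. x \<in> torus N \<and> y \<in> torus N \<and> x \<noteq> y}"

definition random_pairs :: "nat \<Rightarrow> (nat \<times> nat) set" where
  "random_pairs N = {(x, y). x \<in> torus N \<and> y \<in> torus N \<and> x < y \<and> \<not> consecutive N x y}"

text \<open>The sigma-algebra generated by the weights of the vertices of the torus of size \<open>N\<close>.\<close>

definition weight_algebra :: "'a measure \<Rightarrow> (nat \<Rightarrow> 'a \<Rightarrow> real) \<Rightarrow> nat \<Rightarrow> 'a measure" where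
  "weight_algebra M W N =
     vimage_algebra (space M) (\<lambda>\<omega>. \<lambda>x\<in>torus N. W x \<omega>) (\<Pi>\<^sub>M x\<in>torus N. borel)"

text \<open>The vertices carry one sequence of weights \<open>W 1, W 2, ...\<close>, of which the graph of size \<open>N\<close>
  uses the first \<open>N\<close>; \<open>G N \<omega>\<close> is its set of edges. Conditional independence of the edges is
  stated as in \<^const>\<open>prob_space.indep_events\<close>, for the conditional probability given the weights:
  for every set \<open>F\<close> of pairs, the conditional probability that all pairs in \<open>F\<close> are edges is the
  product of the connection probabilities. Nothing is assumed about the joint law of the edges of
  graphs of different sizes.\<close>

locale scale_free_percolation = prob_space M
  for M :: "'a measure" +
  fixes \<alpha> \<tau> :: real
    and W :: "nat \<Rightarrow> 'a \<Rightarrow> real"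
    and G :: "nat \<Rightarrow> 'a \<Rightarrow> nat set set"
  assumes alpha_pos: "\<alpha> > 0"
    and tau_gt_1: "\<tau> > 1"
    and weights_indep: "indep_vars (\<lambda>_. borel) W {1..}"
    and weights_pareto:
      "\<And>x t. x \<ge> 1 \<Longrightarrow>
         prob {\<omega> \<in> space M. W x \<omega> \<ge> t} = (if t \<ge> 1 then t powr (- (\<tau> - 1)) else 1)"
    and graph_measurable: "\<And>N. G N \<in> measurable M (count_space (Pow (torus_edges N)))"
    and consecutive_edges:
      "\<And>N x y \<omega>. \<lbrakk>\<omega> \<in> space M; x \<in> torus N; y \<in> torus N; x \<noteq> y; consecutive N x y\<rbrakk>
         \<Longrightarrow> {x, y} \<in> G N \<omega>"
    and random_edges:
      "\<And>N F. F \<subseteq> random_pairs N \<Longrightarrow>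
         AE \<omega> in M.
           real_cond_exp M (weight_algebra M W N)
             (indicator {\<omega> \<in> space M. \<forall>(x, y)\<in>F. {x, y} \<in> G N \<omega>}) \<omega>
           = (\<Prod>(x, y)\<in>F. 1 - exp (- (W x \<omega> * W y \<omega> / torus_dist N x y powr \<alpha>)))"

end

theory Submission
  imports Defs "HOL-Real_Asymp.Real_Asymp"
begin

text \<open>Write \<open>\<theta>\<close> for a number strictly between \<open>2 / \<alpha>\<close> and \<open>min 1 (\<tau> - 1)\<close>; it exists because \<open>\<alpha> > 2\<close> and
  \<open>\<alpha> (\<tau> - 1) > 2\<close>. Then \<open>\<beta> = \<alpha> \<theta> > 2\<close>, while \<open>V\<^sub>x = W\<^sub>x\<^sup>\<theta>\<close> has a finite mean. The only fact about the
  weights that matters is that almost surely \<open>V\<^sub>1 + ... + V\<^sub>N \<le> C N\<close> for all large \<open>N\<close>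
  (\<open>AE_eventually_weight_power_sum_le\<close>). Everything else is a statement about independent edges
  with fixed connection probabilities \<open>1 - exp (- \<lambda>)\<close>, which are bounded by \<open>\<lambda>\<^sup>s\<close> for
  every \<open>s\<close> in \<open>(0, 1]\<close>. Exponential moments of weighted counts of edges are products, and as the
  graphs of different sizes may depend on each other in any way, every exceptional event is shown to
  have summable probability.

  Upper bound. The graph contains the cycle, and the Poincare inequality along the cycle bounds the
  relaxation time by four times the product of \<open>N\<close> and the sum of the degrees. With \<open>s = \<theta> / 2\<close>
  the product of two weights turns into a sum, and since \<open>\<beta> / 2 > 1\<close> the expected number of edges
  is at most a multiple of \<open>V\<^sub>1 + ... + V\<^sub>N\<close>. So the sum of the degrees is \<open>O(N)\<close>, and
  the mixing time is \<open>O(N\<^sup>2 log N)\<close>.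

  Lower bound. If the mixing distance at time \<open>n\<close> is below \<open>1 / 4\<close>, then the variance of any
  function is at most \<open>2 n\<close> times its energy (\<open>mixing_lower_bound\<close>). A smooth test function would
  fail when \<open>\<alpha>\<close> or \<open>\<alpha> (\<tau> - 1)\<close> is below three, because the long edges then dominate its energy. The test function used here is a tent
  that moves only at points which no long edge crosses, so that only edges of the cycle contribute to
  the energy, at most \<open>N / 2\<close>; when there are linearly many such points in some block, the variance is
  at least of order \<open>N\<^sup>3\<close>. To find such a block, edges are sorted by length. The number of edges
  longer than \<open>\<delta> N\<close> is bounded (\<open>AE_long_edges_lt\<close>), so that some block contains no end point of
  them. Edges of medium length cover in total only a small fraction of the torus when \<open>\<delta>\<close> is small
  (\<open>AE_medium_edges_le\<close>). A positive fraction of each block is crossed by no edge shorter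
  than a power of \<open>N\<close> with exponent below one (\<open>AE_short_uncrossed_ge\<close>): for most \<open>z\<close> the sum of the
  rates of all pairs crossing \<open>z\<close> is bounded, again because \<open>\<beta> > 2\<close>.\<close>

section \<open>The lazy walk and its Dirichlet form\<close>

text \<open>Functions are paired with the unnormalised weights \<open>D x\<close>, under which the walk is self-adjoint. This
  avoids dividing by the sum of the degrees until the very end.\<close>

locale finite_graph =
  fixes V :: "'v set" and E :: "'v set set"
  assumes finite_V: "finite V"
    and V_nonempty: "V \<noteq> {}"
    and loopfree: "\<And>x. {x} \<notin> E"
    and degree_pos: "\<And>x. x \<in> V \<Longrightarrow> degree V E x > 0"
begin

abbreviation D :: "'v \<Rightarrow> real" where "D x \<equiv> real (degree V E x)"

definition adj :: "'v \<Rightarrow> 'v \<Rightarrow> real" where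
  "adj x y = (if {x, y} \<in> E then 1 else 0)"

definition total_degree :: real where
  "total_degree = (\<Sum>x\<in>V. D x)"

definition inner_deg :: "('v \<Rightarrow> real) \<Rightarrow> ('v \<Rightarrow> real) \<Rightarrow> real" where
  "inner_deg f g = (\<Sum>x\<in>V. D x * (f x * g x))"

definition walk_op :: "('v \<Rightarrow> real) \<Rightarrow> 'v \<Rightarrow> real" where
  "walk_op f x = (\<Sum>y\<in>V. lazy_walk V E x y * f y)"

definition energy :: "('v \<Rightarrow> real) \<Rightarrow> real" where
  "energy f = (\<Sum>x\<in>V. \<Sum>y\<in>V. adj x y * (f x - f y)\<^sup>2) / 4"

definition adj_form :: "('v \<Rightarrow> real) \<Rightarrow> ('v \<Rightarrow> real) \<Rightarrow> real" where
  "adj_form f g = (\<Sum>x\<in>V. \<Sum>y\<in>V. adj x y * (f x * g y))"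

lemma adj_sym: "adj x y = adj y x"
  by (simp add: adj_def insert_commute)

lemma adj_nonneg [simp]: "adj x y \<ge> 0"
  by (simp add: adj_def)

lemma adj_idem: "adj x y * adj x y = adj x y"
  by (simp add: adj_def)

lemma D_eq_sum_adj: "D x = (\<Sum>y\<in>V. adj x y)"
proof -
  have "(\<Sum>y\<in>V. adj x y) = (\<Sum>y\<in>{y\<in>V. {x, y} \<in> E}. 1)"
    unfolding adj_def by (rule sum.inter_filter[symmetric]) (rule finite_V)
  then show ?thesis by (simp add: degree_def)
qed

lemma D_ge_1: "x \<in> V \<Longrightarrow> D x \<ge> 1"
  using degree_pos[of x] by simp

lemma total_degree_ge_1: "total_degree \<ge> 1"
proof -
  obtain x where x: "x \<in> V" using V_nonempty by blast
  have "1 \<le> D x" using D_ge_1 x by simp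
  also have "\<dots> \<le> total_degree" unfolding total_degree_def
    by (rule member_le_sum) (use x finite_V in auto)
  finally show ?thesis .
qed

lemma D_walk_op:
  assumes "x \<in> V"
  shows "D x * walk_op f x = (D x * f x + (\<Sum>y\<in>V. adj x y * f y)) / 2"
proof -
  have D: "D x > 0" using degree_pos assms by simp
  have "lazy_walk V E x y * f y = (if x = y then f y / 2 else 0) + adj x y * f y / (2 * D x)" for y
    using loopfree by (auto simp: lazy_walk_def adj_def)
  then have "walk_op f x = (\<Sum>y\<in>V. (if x = y then f y / 2 else 0) + adj x y * f y / (2 * D x))"
    by (simp add: walk_op_def)
  also have "\<dots> = f x / 2 + (\<Sum>y\<in>V. adj x y * f y) / (2 * D x)"
    using assms finite_V by (simp add: sum.distrib sum_divide_distrib)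
  finally show ?thesis using D by (simp add: field_simps)
qed

lemma adj_form_sym: "adj_form f g = adj_form g f"
proof -
  have "adj_form f g = (\<Sum>y\<in>V. \<Sum>x\<in>V. adj x y * (f x * g y))"
    unfolding adj_form_def by (rule sum.swap)
  also have "\<dots> = adj_form g f"
    unfolding adj_form_def
  proof (intro sum.cong refl)
    fix x y show "adj y x * (f y * g x) = adj x y * (g x * f y)"
      using adj_sym[of x y] by simp
  qed
  finally show ?thesis .
qed

lemma inner_deg_sym: "inner_deg f g = inner_deg g f"
  by (simp add: inner_deg_def mult.commute)

lemma inner_deg_walk_op: "inner_deg (walk_op f) g = (inner_deg f g + adj_form f g) / 2"
proof -
  have "inner_deg (walk_op f) g = (\<Sum>x\<in>V. (D x * walk_op f x) * g x)"
    by (simp add: inner_deg_def mult_ac)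
  also have "\<dots> = (\<Sum>x\<in>V. (D x * f x + (\<Sum>y\<in>V. adj x y * f y)) / 2 * g x)"
    by (rule sum.cong) (auto simp: D_walk_op)
  also have "\<dots> = (inner_deg f g + adj_form g f) / 2"
    by (simp add: inner_deg_def adj_form_def sum.distrib sum_divide_distrib sum_distrib_left
        sum_distrib_right algebra_simps add_divide_distrib)
  finally show ?thesis by (simp add: adj_form_sym)
qed

lemma walk_op_self_adjoint: "inner_deg (walk_op f) g = inner_deg f (walk_op g)"
  by (simp add: inner_deg_walk_op inner_deg_sym[of f "walk_op g"] inner_deg_sym[of f g]
      adj_form_sym[of f g])

lemma sum_adj_sq: "(\<Sum>x\<in>V. \<Sum>y\<in>V. adj x y * (f x)\<^sup>2) = inner_deg f f"
  "(\<Sum>x\<in>V. \<Sum>y\<in>V. adj x y * (f y)\<^sup>2) = inner_deg f f"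
proof -
  show 1: "(\<Sum>x\<in>V. \<Sum>y\<in>V. adj x y * (f x)\<^sup>2) = inner_deg f f"
    by (simp add: inner_deg_def D_eq_sum_adj sum_distrib_right power2_eq_square)
  have "(\<Sum>x\<in>V. \<Sum>y\<in>V. adj x y * (f y)\<^sup>2) = (\<Sum>y\<in>V. \<Sum>x\<in>V. adj y x * (f y)\<^sup>2)"
    by (subst sum.swap, intro sum.cong refl) (metis adj_sym)
  with 1 show "(\<Sum>x\<in>V. \<Sum>y\<in>V. adj x y * (f y)\<^sup>2) = inner_deg f f" by simp
qed

lemma inner_deg_walk_op_self: "inner_deg (walk_op f) f = inner_deg f f - energy f"
proof -
  have "energy f = (\<Sum>x\<in>V. \<Sum>y\<in>V. adj x y * (f x)\<^sup>2 + adj x y * (f y)\<^sup>2 - 2 * (adj x y * (f x * f y))) / 4"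
    by (simp add: energy_def power2_diff algebra_simps)
  also have "\<dots> = (inner_deg f f + inner_deg f f - 2 * adj_form f f) / 4"
    by (simp only: sum.distrib sum_subtractf sum_adj_sq adj_form_def sum_distrib_left[symmetric])
  finally show ?thesis by (simp add: inner_deg_walk_op)
qed

text \<open>Laziness enters here: the walk operator is the average \<open>P\<close> of the identity and of the operator of the
  simple walk, which is a contraction. Hence the squared norm of \<open>P f\<close> is at most the inner product
  of \<open>P f\<close> and \<open>f\<close>, which is the norm minus the energy.\<close>

lemma walk_op_contraction: "inner_deg (walk_op f) (walk_op f) \<le> inner_deg f f - energy f"
proof -
  have "D x * (walk_op f x * walk_op f x)
      \<le> (D x * (f x)\<^sup>2 + 2 * (\<Sum>y\<in>V. adj x y * (f x * f y)) + (\<Sum>y\<in>V. adj x y * (f y)\<^sup>2)) / 4"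
    if x: "x \<in> V" for x
  proof -
    define q where "q = (\<Sum>y\<in>V. adj x y * f y)"
    have Dp: "D x > 0" using degree_pos x by simp
    have "q\<^sup>2 = (\<Sum>y\<in>V. adj x y * (adj x y * f y))\<^sup>2"
      unfolding q_def by (simp add: mult.assoc[symmetric] adj_idem)
    also have "\<dots> \<le> (\<Sum>y\<in>V. (adj x y)\<^sup>2) * (\<Sum>y\<in>V. (adj x y * f y)\<^sup>2)"
      by (rule Cauchy_Schwarz_ineq_sum)
    also have "\<dots> = D x * (\<Sum>y\<in>V. adj x y * (f y)\<^sup>2)"
      unfolding D_eq_sum_adj power_mult_distrib power2_eq_square[of "adj _ _"] adj_idem ..
    finally have q: "q\<^sup>2 \<le> D x * (\<Sum>y\<in>V. adj x y * (f y)\<^sup>2)" .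
    have "D x * (D x * (walk_op f x * walk_op f x)) = (D x * walk_op f x)\<^sup>2"
      by (simp add: power2_eq_square)
    also have "\<dots> = ((D x * f x + q) / 2)\<^sup>2" by (simp add: D_walk_op[OF x] q_def)
    also have "\<dots> = (D x * (D x * (f x)\<^sup>2) + 2 * D x * (f x * q) + q\<^sup>2) / 4"
      by (simp add: power2_eq_square field_simps)
    also have "\<dots> \<le> D x * ((D x * (f x)\<^sup>2 + 2 * (f x * q) + (\<Sum>y\<in>V. adj x y * (f y)\<^sup>2)) / 4)"
      using q by (simp add: algebra_simps)
    finally have "D x * (walk_op f x * walk_op f x)
        \<le> (D x * (f x)\<^sup>2 + 2 * (f x * q) + (\<Sum>y\<in>V. adj x y * (f y)\<^sup>2)) / 4"
      using Dp by (rule mult_left_le_imp_le)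
    then show ?thesis by (simp add: q_def sum_distrib_left mult_ac)
  qed
  then have "inner_deg (walk_op f) (walk_op f) \<le> (\<Sum>x\<in>V.
       (D x * (f x)\<^sup>2 + 2 * (\<Sum>y\<in>V. adj x y * (f x * f y)) + (\<Sum>y\<in>V. adj x y * (f y)\<^sup>2)) / 4)"
    unfolding inner_deg_def by (rule sum_mono)
  also have "\<dots> = (inner_deg f f + 2 * adj_form f f + inner_deg f f) / 4"
    by (simp add: sum_divide_distrib[symmetric] sum.distrib sum_distrib_left[symmetric] sum_adj_sq
        adj_form_def) (simp add: inner_deg_def power2_eq_square)
  also have "\<dots> = inner_deg (walk_op f) f" by (simp add: inner_deg_walk_op)
  finally show ?thesis by (simp add: inner_deg_walk_op_self)
qed

lemma mean_walk_op: "(\<Sum>x\<in>V. D x * walk_op f x) = (\<Sum>x\<in>V. D x * f x)"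
proof -
  have "(\<Sum>x\<in>V. \<Sum>y\<in>V. adj x y * f y) = (\<Sum>x\<in>V. D x * f x)"
    unfolding D_eq_sum_adj sum_distrib_right
    by (subst sum.swap, intro sum.cong refl) (metis adj_sym)
  then show ?thesis by (simp add: D_walk_op sum_divide_distrib[symmetric] sum.distrib)
qed

lemma mean_walk_op_power: "(\<Sum>x\<in>V. D x * (walk_op ^^ n) f x) = (\<Sum>x\<in>V. D x * f x)"
  by (induction n) (simp_all add: mean_walk_op)

lemma walk_op_power_eq_kernel:
  "x \<in> V \<Longrightarrow> (walk_op ^^ n) f x = (\<Sum>y\<in>V. kernel_power V (lazy_walk V E) n x y * f y)"
proof (induction n arbitrary: x)
  case 0
  then show ?case using finite_V by (simp add: if_distrib[of "\<lambda>c. c * _"] cong: if_cong)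
next
  case (Suc n)
  have "(walk_op ^^ Suc n) f x = (\<Sum>z\<in>V. lazy_walk V E x z * (walk_op ^^ n) f z)"
    by (simp add: walk_op_def)
  also have "\<dots> = (\<Sum>z\<in>V. lazy_walk V E x z * (\<Sum>y\<in>V. kernel_power V (lazy_walk V E) n z y * f y))"
    by (rule sum.cong) (auto simp: Suc.IH)
  also have "\<dots> = (\<Sum>y\<in>V. (\<Sum>z\<in>V. lazy_walk V E x z * kernel_power V (lazy_walk V E) n z y) * f y)"
    by (simp add: sum_distrib_left sum_distrib_right mult.assoc) (rule sum.swap)
  finally show ?case by simp
qed

lemma inner_deg_cauchy_schwarz: "(inner_deg f g)\<^sup>2 \<le> inner_deg f f * inner_deg g g"
proof -
  have "(\<Sum>x\<in>V. (sqrt (D x) * f x) * (sqrt (D x) * g x))\<^sup>2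
      \<le> (\<Sum>x\<in>V. (sqrt (D x) * f x)\<^sup>2) * (\<Sum>x\<in>V. (sqrt (D x) * g x)\<^sup>2)"
    by (rule Cauchy_Schwarz_ineq_sum)
  moreover have "(sqrt (D x) * u) * (sqrt (D x) * v) = D x * (u * v)" for x u v
    using real_sqrt_mult_self[of "D x"] by (simp add: mult_ac del: real_sqrt_mult_self)
  ultimately show ?thesis by (simp add: inner_deg_def power2_eq_square)
qed

lemma energy_nonneg: "energy f \<ge> 0"
  unfolding energy_def by (intro divide_nonneg_nonneg sum_nonneg) auto

lemma tv_le_mixing_dist:
  assumes "x \<in> V"
  shows "tv_dist V (kernel_power V (lazy_walk V E) n x) (reversible_measure V E) \<le> mixing_dist V E n"
  unfolding mixing_dist_def using assms finite_V by (intro cSUP_upper) auto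

lemma kernel_minus_stationary:
  assumes "x \<in> V" and "(\<Sum>y\<in>V. D y * h y) = 0"
  shows "(walk_op ^^ n) h x
    = (\<Sum>y\<in>V. (kernel_power V (lazy_walk V E) n x y - reversible_measure V E y) * h y)"
proof -
  have "(\<Sum>y\<in>V. reversible_measure V E y * h y) = (\<Sum>y\<in>V. D y * h y) / (\<Sum>y\<in>V. D y)"
    by (simp add: reversible_measure_def sum_divide_distrib)
  then show ?thesis using assms
    by (simp add: walk_op_power_eq_kernel left_diff_distrib sum_subtractf)
qed

lemma walk_op_power_sup_bound:
  assumes mean: "(\<Sum>y\<in>V. D y * h y) = 0" and bound: "\<And>y. y \<in> V \<Longrightarrow> \<bar>h y\<bar> \<le> B"
    and x: "x \<in> V"
  shows "\<bar>(walk_op ^^ n) h x\<bar> \<le> 2 * mixing_dist V E n * B"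
proof -
  let ?d = "\<lambda>y. kernel_power V (lazy_walk V E) n x y - reversible_measure V E y"
  have B: "B \<ge> 0" using bound[OF x] by linarith
  have "\<bar>(walk_op ^^ n) h x\<bar> = \<bar>\<Sum>y\<in>V. ?d y * h y\<bar>"
    using kernel_minus_stationary[OF x mean] by simp
  also have "\<dots> \<le> (\<Sum>y\<in>V. \<bar>?d y\<bar> * B)"
    by (rule order_trans[OF sum_abs]) (auto simp: abs_mult intro!: sum_mono mult_left_mono bound)
  also have "\<dots> = 2 * tv_dist V (kernel_power V (lazy_walk V E) n x) (reversible_measure V E) * B"
    by (simp add: tv_dist_def sum_distrib_right)
  also have "\<dots> \<le> 2 * mixing_dist V E n * B"
    using tv_le_mixing_dist[OF x, of n] B by (intro mult_right_mono) auto
  finally show ?thesis .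
qed

text \<open>The squared norms of the iterates are the moments of the spectral measure of \<open>h\<close> of even order, so
  they are log-convex; Cauchy-Schwarz and self-adjointness give this without a spectral theorem.\<close>

lemma norm_power_log_convex:
  defines "b \<equiv> \<lambda>h m. inner_deg ((walk_op ^^ m) h) ((walk_op ^^ m) h)"
  shows "(b h (Suc m))\<^sup>2 \<le> b h m * b h (Suc (Suc m))"
proof -
  have "b h (Suc m) = inner_deg ((walk_op ^^ m) h) ((walk_op ^^ Suc (Suc m)) h)"
    by (simp add: b_def walk_op_self_adjoint)
  then show ?thesis using inner_deg_cauchy_schwarz by (simp add: b_def)
qed

text \<open>If the distance at time \<open>n\<close> is below \<open>1 / 4\<close>, then every \<open>n\<close> steps halve the supremum norm of a function of mean zero. On the other hand the squared
  norms of its iterates decay at most geometrically with ratio \<open>r\<^sup>2\<close>, where \<open>r\<close> is one minus the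
  quotient of energy and variance, because they are log-convex. Comparing the two over \<open>j n\<close> steps and
  letting \<open>j\<close> grow removes all constants and leaves \<open>r\<^sup>n \<le> 1 / 2\<close>; Bernoulli's inequality then
  bounds \<open>n\<close> from below.\<close>

lemma mixing_lower_bound_centered:
  assumes mix: "mixing_dist V E n < 1 / 4" and mean: "(\<Sum>x\<in>V. D x * h x) = 0"
  shows "inner_deg h h \<le> 2 * real n * energy h"
proof (cases "inner_deg h h \<le> 0")
  case True
  then show ?thesis using energy_nonneg[of h] by (intro order_trans[OF True]) auto
next
  case False
  define b where "b m = inner_deg ((walk_op ^^ m) h) ((walk_op ^^ m) h)" for m
  define B where "B = Max ((\<lambda>x. \<bar>h x\<bar>) ` V)"
  have b0: "b 0 > 0" using False by (simp add: b_def)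
  have hB: "\<bar>h y\<bar> \<le> B" if "y \<in> V" for y
    unfolding B_def using that finite_V by auto
  have B0: "B \<ge> 0" using V_nonempty hB by force
  have decay: "\<bar>(walk_op ^^ (j * n)) h x\<bar> \<le> B / 2 ^ j" if "x \<in> V" for j x
    using that
  proof (induction j arbitrary: x)
    case 0
    then show ?case using hB by simp
  next
    case (Suc j)
    have "\<bar>(walk_op ^^ n) ((walk_op ^^ (j * n)) h) x\<bar> \<le> 2 * mixing_dist V E n * (B / 2 ^ j)"
      by (rule walk_op_power_sup_bound) (use Suc mean in \<open>auto simp: mean_walk_op_power\<close>)
    also have "\<dots> \<le> (1 / 2) * (B / 2 ^ j)"
      using mix B0 by (intro mult_right_mono) auto
    finally show ?case by (simp add: funpow_add)
  qed
  have b_upper: "b (j * n) \<le> total_degree * B\<^sup>2 * (1 / 4) ^ j" for j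
  proof -
    have "D x * ((walk_op ^^ (j * n)) h x * (walk_op ^^ (j * n)) h x) \<le> D x * (B / 2 ^ j)\<^sup>2"
      if "x \<in> V" for x
      using decay[OF that, of j] abs_le_square_iff[of "(walk_op ^^ (j * n)) h x" "B / 2 ^ j"] B0
      by (intro mult_left_mono) (auto simp: power2_eq_square)
    then have "b (j * n) \<le> (\<Sum>x\<in>V. D x * (B / 2 ^ j)\<^sup>2)"
      unfolding b_def inner_deg_def by (rule sum_mono)
    also have "\<dots> = total_degree * B\<^sup>2 * (1 / 4) ^ j"
    proof -
      have "(2 ^ j :: real)\<^sup>2 = 4 ^ j" by (simp add: power2_eq_square flip: power_mult_distrib)
      then show ?thesis by (simp add: total_degree_def sum_distrib_right sum_divide_distrib power_divide)
    qed
    finally show ?thesis .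
  qed
  define r where "r = 1 - energy h / b 0"
  show ?thesis
  proof (cases "r \<le> 0")
    \<comment> \<open>the claim is then trivial, except that \<open>n = 0\<close> must be excluded: it would force \<open>h\<close> to vanish\<close>
    case True
    then have e: "b 0 \<le> energy h" using b0 by (simp add: r_def field_simps)
    have "n \<noteq> 0"
    proof
      assume "n = 0"
      then have "b 0 \<le> total_degree * B\<^sup>2 * (1 / 4) ^ j" for j using b_upper[of j] by simp
      moreover have "(\<lambda>j. total_degree * B\<^sup>2 * (1 / 4) ^ j) \<longlonglongrightarrow> total_degree * B\<^sup>2 * 0"
        by (intro tendsto_intros LIMSEQ_realpow_zero) auto
      ultimately have "b 0 \<le> 0" by (auto intro: LIMSEQ_le_const)
      then show False using b0 by simp
    qed
    then have "1 * energy h \<le> 2 * real n * energy h"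
      using energy_nonneg by (intro mult_right_mono) auto
    then show ?thesis using e by (simp add: b_def)
  next
    case False
    then have r: "r > 0" by simp
    have step: "b (Suc m) \<ge> r\<^sup>2 * b m \<and> b m > 0" for m
    proof (induction m)
      case 0
      have "inner_deg (walk_op h) h = r * b 0"
        using b0 by (simp add: inner_deg_walk_op_self r_def b_def field_simps)
      then have "(r * b 0)\<^sup>2 \<le> b 1 * b 0"
        using inner_deg_cauchy_schwarz[of "walk_op h" h] by (simp add: b_def)
      then have "b 0 * (r\<^sup>2 * b 0) \<le> b 0 * b 1" by (simp add: power2_eq_square mult_ac)
      then show ?case using b0 by simp
    next
      case (Suc m)
      then have pos: "b (Suc m) > 0" using r by (smt (verit) zero_less_mult_iff zero_less_power)
      have "b m * (r\<^sup>2 * b (Suc m)) = r\<^sup>2 * b m * b (Suc m)" by (simp only: mult_ac)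
      also have "\<dots> \<le> b (Suc m) * b (Suc m)"
        using Suc pos by (intro mult_right_mono) auto
      also have "\<dots> = (b (Suc m))\<^sup>2" by (simp only: power2_eq_square)
      also have "\<dots> \<le> b m * b (Suc (Suc m))"
        unfolding b_def by (rule norm_power_log_convex)
      finally show ?case using Suc pos by simp
    qed
    have b_lower: "b m \<ge> (r\<^sup>2) ^ m * b 0" for m
    proof (induction m)
      case (Suc m)
      have "(r\<^sup>2) ^ Suc m * b 0 \<le> r\<^sup>2 * b m"
        using Suc by (simp add: mult.assoc mult_left_mono)
      then show ?case using step[of m] by linarith
    qed simp
    have half: "r ^ n \<le> 1 / 2"
    proof (rule ccontr)
      assume "\<not> r ^ n \<le> 1 / 2"
      then have "(r ^ n)\<^sup>2 > (1 / 2)\<^sup>2" by (intro power_strict_mono) auto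
      then have c: "4 * (r\<^sup>2) ^ n > 1" by (simp add: power2_eq_square power_mult_distrib)
      have "(4 * (r\<^sup>2) ^ n) ^ j * b 0 \<le> total_degree * B\<^sup>2" for j
      proof -
        have "(r\<^sup>2) ^ (j * n) * b 0 \<le> total_degree * B\<^sup>2 * (1 / 4) ^ j"
          using b_lower[of "j * n"] b_upper[of j] by linarith
        then have "4 ^ j * ((r\<^sup>2) ^ (j * n) * b 0) \<le> 4 ^ j * (total_degree * B\<^sup>2 * (1 / 4) ^ j)"
          by (rule mult_left_mono) simp
        then show ?thesis
          by (simp add: power_mult_distrib power_mult[symmetric] power_divide mult_ac)
      qed
      moreover obtain j where "total_degree * B\<^sup>2 / b 0 < (4 * (r\<^sup>2) ^ n) ^ j"
        using real_arch_pow[OF c] by blast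
      ultimately show False using b0 by (simp add: field_simps) (smt (verit))
    qed
    have "1 + real n * (- (energy h / b 0)) \<le> (1 + (- (energy h / b 0))) ^ n"
      by (rule Bernoulli_inequality) (use r in \<open>simp add: r_def\<close>)
    then have "1 - real n * (energy h / b 0) \<le> 1 / 2" using half by (simp add: r_def)
    then show ?thesis using b0 by (simp add: b_def field_simps)
  qed
qed

text \<open>The variance is bounded through all centerings \<open>c\<close> at once, so that a user need not compute the mean
  of the test function.\<close>

theorem mixing_lower_bound:
  assumes mix: "mixing_dist V E n < 1 / 4"
    and var: "\<And>c. v \<le> (\<Sum>x\<in>V. D x * (f x - c)\<^sup>2)"
  shows "v \<le> 2 * real n * energy f"
proof -
  define c where "c = (\<Sum>x\<in>V. D x * f x) / total_degree"
  define h where "h x = f x - c" for x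
  have "(\<Sum>x\<in>V. D x * h x) = (\<Sum>x\<in>V. D x * f x) - total_degree * c"
    by (simp add: h_def right_diff_distrib sum_subtractf total_degree_def sum_distrib_right)
  also have "\<dots> = 0" using total_degree_ge_1 by (simp add: c_def)
  finally have "inner_deg h h \<le> 2 * real n * energy h"
    using mixing_lower_bound_centered mix by blast
  moreover have "energy h = energy f" by (simp add: energy_def h_def)
  moreover have "inner_deg h h = (\<Sum>x\<in>V. D x * (f x - c)\<^sup>2)"
    by (simp add: inner_deg_def h_def power2_eq_square)
  ultimately show ?thesis using var[of c] by simp
qed

text \<open>A spectral gap makes the norm of centred functions decay geometrically. The value at \<open>x\<close> is
  controlled by the norm since \<open>D x \<ge> 1\<close>, and applied to the sign of the difference between the law at
  time \<open>n\<close> and the stationary law the iterate at \<open>x\<close> is twice their distance.\<close>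

theorem mixing_dist_upper_bound:
  assumes gap: "\<And>f. (\<Sum>x\<in>V. D x * f x) = 0 \<Longrightarrow> g * inner_deg f f \<le> energy f"
    and g: "0 \<le> g" "g \<le> 1"
    and n: "total_degree * (1 - g) ^ n < 1 / 4"
  shows "mixing_dist V E n < 1 / 4"
proof -
  have decay: "inner_deg ((walk_op ^^ m) h) ((walk_op ^^ m) h) \<le> (1 - g) ^ m * inner_deg h h"
    if "(\<Sum>x\<in>V. D x * h x) = 0" for h m
  proof (induction m)
    case (Suc m)
    let ?u = "(walk_op ^^ m) h"
    have "inner_deg (walk_op ?u) (walk_op ?u) \<le> inner_deg ?u ?u - energy ?u"
      by (rule walk_op_contraction)
    also have "\<dots> \<le> (1 - g) * inner_deg ?u ?u"
      using gap[of ?u] that by (simp add: mean_walk_op_power left_diff_distrib)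
    also have "\<dots> \<le> (1 - g) * ((1 - g) ^ m * inner_deg h h)"
      using Suc g by (intro mult_left_mono) auto
    finally show ?case by (simp add: mult.assoc)
  qed simp
  have "tv_dist V (kernel_power V (lazy_walk V E) n x) (reversible_measure V E)
      \<le> 1 / 2 * sqrt (total_degree * (1 - g) ^ n)" if x: "x \<in> V" for x
  proof -
    define d where "d y = kernel_power V (lazy_walk V E) n x y - reversible_measure V E y" for y
    define u where "u y = sgn (d y)" for y
    define c where "c = (\<Sum>y\<in>V. D y * u y) / total_degree"
    define h where "h y = u y - c" for y
    have cm: "(\<Sum>y\<in>V. D y * u y) = total_degree * c" using total_degree_ge_1 by (simp add: c_def)
    have mean: "(\<Sum>y\<in>V. D y * h y) = 0"
      using cm by (simp add: h_def right_diff_distrib sum_subtractf total_degree_def sum_distrib_right)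
    have d0: "(\<Sum>y\<in>V. d y) = 0"
    proof -
      have one: "walk_op (\<lambda>_. 1) z = 1" if "z \<in> V" for z
        using D_walk_op[OF that, of "\<lambda>_. 1"] degree_pos[OF that] by (simp flip: D_eq_sum_adj)
      have "(walk_op ^^ n) (\<lambda>_. 1) z = 1" if "z \<in> V" for z
        using that
      proof (induction n arbitrary: z)
        case (Suc n)
        have "walk_op ((walk_op ^^ n) (\<lambda>_. 1)) z = walk_op (\<lambda>_. 1) z"
          unfolding walk_op_def by (rule sum.cong) (auto simp: Suc.IH[unfolded walk_op_def])
        then show ?case using one Suc.prems by simp
      qed simp
      from this[OF x] have "(\<Sum>y\<in>V. kernel_power V (lazy_walk V E) n x y) = 1"
        using walk_op_power_eq_kernel[OF x, of n "\<lambda>_. 1"] by simp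
      moreover have "(\<Sum>y\<in>V. reversible_measure V E y) = 1"
        using total_degree_ge_1 by (simp add: reversible_measure_def total_degree_def flip: sum_divide_distrib)
      ultimately show ?thesis by (simp add: d_def sum_subtractf)
    qed
    have "2 * tv_dist V (kernel_power V (lazy_walk V E) n x) (reversible_measure V E)
        = (\<Sum>y\<in>V. d y * u y)"
      by (simp add: tv_dist_def d_def u_def abs_sgn)
    also have "\<dots> = (\<Sum>y\<in>V. d y * h y)"
      using d0 by (simp add: h_def right_diff_distrib sum_subtractf flip: sum_distrib_right)
    also have "\<dots> = (walk_op ^^ n) h x"
      using kernel_minus_stationary[OF x mean] by (simp add: d_def)
    finally have tv: "2 * tv_dist V (kernel_power V (lazy_walk V E) n x) (reversible_measure V E)
        = (walk_op ^^ n) h x" .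
    have "((walk_op ^^ n) h x)\<^sup>2 \<le> D x * ((walk_op ^^ n) h x * (walk_op ^^ n) h x)"
      using mult_right_mono[OF D_ge_1[OF x], of "((walk_op ^^ n) h x)\<^sup>2"]
      by (simp add: power2_eq_square)
    also have "\<dots> \<le> inner_deg ((walk_op ^^ n) h) ((walk_op ^^ n) h)"
      unfolding inner_deg_def using finite_V x by (intro member_le_sum) auto
    also have "\<dots> \<le> (1 - g) ^ n * inner_deg h h" by (rule decay[OF mean])
    also have "\<dots> \<le> (1 - g) ^ n * total_degree"
    proof (intro mult_left_mono)
      have "inner_deg h h = (\<Sum>y\<in>V. D y * (u y)\<^sup>2) - total_degree * c\<^sup>2"
      proof -
        have "inner_deg h h = (\<Sum>y\<in>V. D y * (u y)\<^sup>2 - 2 * c * (D y * u y) + D y * c\<^sup>2)"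
          unfolding inner_deg_def h_def
          by (rule sum.cong) (auto simp: power2_eq_square algebra_simps)
        also have "\<dots> = (\<Sum>y\<in>V. D y * (u y)\<^sup>2) - 2 * c * (total_degree * c) + total_degree * c\<^sup>2"
          by (simp only: sum.distrib sum_subtractf sum_distrib_left[symmetric] cm
              sum_distrib_right[symmetric] total_degree_def)
        finally show ?thesis by (simp add: power2_eq_square)
      qed
      also have "\<dots> \<le> (\<Sum>y\<in>V. D y * (u y)\<^sup>2)"
        using total_degree_ge_1 by simp
      also have "\<dots> \<le> (\<Sum>y\<in>V. D y * 1)"
        by (intro sum_mono mult_left_mono) (auto simp: u_def sgn_if)
      finally show "inner_deg h h \<le> total_degree" by (simp add: total_degree_def)
    qed (use g in auto)
    finally have "(walk_op ^^ n) h x \<le> sqrt (total_degree * (1 - g) ^ n)"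
      by (intro real_le_rsqrt) (simp add: mult.commute)
    then show ?thesis using tv by simp
  qed
  then have "mixing_dist V E n \<le> 1 / 2 * sqrt (total_degree * (1 - g) ^ n)"
    unfolding mixing_dist_def using V_nonempty by (intro cSUP_least) auto
  also have "sqrt (total_degree * (1 - g) ^ n) < sqrt (1 / 4)"
    using n by (rule real_sqrt_less_mono)
  also have "sqrt (1 / 4) = (1 / 2 :: real)" by (simp add: real_sqrt_divide)
  finally show ?thesis by simp
qed

end

section \<open>Graphs that contain the cycle\<close>

locale torus_graph =
  fixes N :: nat and E :: "nat set set"
  assumes N_ge_2: "N \<ge> 2"
    and edges: "E \<subseteq> torus_edges N"
    and cycle: "\<And>x y. \<lbrakk>x \<in> torus N; y \<in> torus N; x \<noteq> y; consecutive N x y\<rbrakk> \<Longrightarrow> {x, y} \<in> E"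
begin

lemma Suc_edge: "1 \<le> x \<Longrightarrow> x < N \<Longrightarrow> {x, Suc x} \<in> E"
  by (rule cycle) (auto simp: torus_def consecutive_def)

sublocale finite_graph "torus N" E
proof
  show "finite (torus N)" "torus N \<noteq> {}" using N_ge_2 by (auto simp: torus_def)
  show "{x} \<notin> E" for x
    using edges by (auto simp: torus_edges_def doubleton_eq_iff)
  show "degree (torus N) E x > 0" if x: "x \<in> torus N" for x
  proof -
    have "\<exists>y\<in>torus N. {x, y} \<in> E"
    proof (cases "x < N")
      case True
      then show ?thesis using Suc_edge[of x] x by (intro bexI[of _ "Suc x"]) (auto simp: torus_def)
    next
      case False
      then have "x = N" using x by (simp add: torus_def)
      then show ?thesis using Suc_edge[of "N - 1"] N_ge_2
        by (intro bexI[of _ "N - 1"]) (auto simp: torus_def insert_commute)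
    qed
    then show ?thesis unfolding degree_def by (subst card_gt_0_iff) (auto simp: torus_def)
  qed
qed

text \<open>Two values of \<open>h\<close> differ by a telescoping sum along the path from \<open>1\<close> to \<open>N\<close>, whose square is at
  most \<open>N\<close> times the sum of the squared increments; the latter is controlled by the part of the energy
  on the path. The variance is at most the second moment around the value \<open>h 1\<close>.\<close>

lemma poincare:
  assumes "(\<Sum>x\<in>torus N. D x * h x) = 0"
  shows "1 / (4 * total_degree * real N) * inner_deg h h \<le> energy h"
proof -
  define S where "S = (\<Sum>i\<in>{1..<N}. (h (Suc i) - h i)\<^sup>2)"
  have "S \<le> 4 * energy h"
  proof -
    have "S \<le> (\<Sum>x\<in>{1..<N}. \<Sum>y\<in>torus N. adj x y * (h x - h y)\<^sup>2)"
      unfolding S_def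
    proof (rule sum_mono)
      fix i assume i: "i \<in> {1..<N}"
      then have "(h (Suc i) - h i)\<^sup>2 = adj i (Suc i) * (h i - h (Suc i))\<^sup>2"
        using Suc_edge[of i] by (simp add: adj_def power2_commute)
      also have "\<dots> \<le> (\<Sum>y\<in>torus N. adj i y * (h i - h y)\<^sup>2)"
        by (rule member_le_sum) (use i in \<open>auto simp: torus_def\<close>)
      finally show "(h (Suc i) - h i)\<^sup>2 \<le> (\<Sum>y\<in>torus N. adj i y * (h i - h y)\<^sup>2)" .
    qed
    also have "\<dots> \<le> (\<Sum>x\<in>torus N. \<Sum>y\<in>torus N. adj x y * (h x - h y)\<^sup>2)"
      by (rule sum_mono2) (auto simp: torus_def intro!: sum_nonneg)
    finally show ?thesis by (simp add: energy_def)
  qed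
  moreover have pt: "(h x - h 1)\<^sup>2 \<le> real N * S" if x: "x \<in> torus N" for x
  proof -
    have "h x - h 1 = (\<Sum>i\<in>{1..<x}. 1 * (h (Suc i) - h i))"
      using x by (simp add: sum_Suc_diff' torus_def)
    also have "\<dots>\<^sup>2 \<le> (\<Sum>i\<in>{1..<x}. 1\<^sup>2) * (\<Sum>i\<in>{1..<x}. (h (Suc i) - h i)\<^sup>2)"
      by (rule Cauchy_Schwarz_ineq_sum)
    also have "\<dots> \<le> real N * S"
      unfolding S_def using x by (intro mult_mono sum_mono2) (auto simp: torus_def sum_nonneg)
    finally show ?thesis .
  qed
  moreover have "inner_deg h h \<le> total_degree * (real N * S)"
  proof -
    have "inner_deg h h \<le> inner_deg h h + total_degree * (h 1)\<^sup>2"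
      using total_degree_ge_1 by simp
    also have "\<dots> = (\<Sum>x\<in>torus N. D x * (h x * h x)) - 2 * h 1 * (\<Sum>x\<in>torus N. D x * h x)
        + (\<Sum>x\<in>torus N. D x * (h 1)\<^sup>2)"
      using assms by (simp add: inner_deg_def total_degree_def sum_distrib_right)
    also have "\<dots> = (\<Sum>x\<in>torus N. D x * (h x - h 1)\<^sup>2)"
      by (simp add: sum_distrib_left sum_subtractf[symmetric] sum.distrib[symmetric]
          power2_eq_square algebra_simps)
    also have "\<dots> \<le> (\<Sum>x\<in>torus N. D x * (real N * S))"
      by (intro sum_mono mult_left_mono pt) auto
    finally show ?thesis by (simp add: total_degree_def sum_distrib_right)
  qed
  moreover have "total_degree * (real N * S) \<le> total_degree * (real N * (4 * energy h))"
    using calculation(1) total_degree_ge_1 by (intro mult_left_mono) auto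
  ultimately have "inner_deg h h \<le> total_degree * (real N * (4 * energy h))" by linarith
  then show ?thesis using total_degree_ge_1 N_ge_2 by (simp add: field_simps)
qed

lemma mixing_dist_small:
  assumes n: "real n > 4 * total_degree * real N * ln (4 * total_degree)"
  shows "mixing_dist (torus N) E n < 1 / 4"
proof (rule mixing_dist_upper_bound[OF poincare])
  let ?g = "1 / (4 * total_degree * real N)"
  have "4 * total_degree * real N \<ge> 4 * 1 * 1"
    using total_degree_ge_1 N_ge_2 by (intro mult_mono) auto
  then have "4 * total_degree * real N \<ge> 1" by linarith
  moreover have "0 < total_degree * real N" using total_degree_ge_1 N_ge_2 by simp
  ultimately show g: "0 \<le> ?g" "?g \<le> 1" by (simp_all add: divide_le_eq_1 mult.commute)
  have "(1 - ?g) ^ n \<le> exp (- ?g) ^ n"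
    using exp_ge_add_one_self[of "- ?g"] g by (intro power_mono) auto
  also have "\<dots> = exp (- (real n * ?g))" by (simp add: exp_of_nat_mult[symmetric])
  also have "\<dots> < exp (- ln (4 * total_degree))"
    using n total_degree_ge_1 N_ge_2 by (simp add: field_simps)
  also have "\<dots> = 1 / (4 * total_degree)"
    using total_degree_ge_1 by (simp add: exp_minus inverse_eq_divide)
  finally show "total_degree * (1 - ?g) ^ n < 1 / 4"
    using total_degree_ge_1 by (simp add: field_simps)
qed auto

theorem mixing_time_le:
  "real (mixing_time (torus N) E) \<le> 4 * total_degree * real N * ln (4 * total_degree) + 1"
proof -
  let ?b = "4 * total_degree * real N * ln (4 * total_degree)"
  have b: "?b \<ge> 0" using total_degree_ge_1 by (intro mult_nonneg_nonneg) auto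
  define n where "n = nat \<lfloor>?b\<rfloor> + 1"
  have "real n > ?b" unfolding n_def using b by linarith
  then have "mixing_dist (torus N) E n < 1 / 4" by (rule mixing_dist_small)
  then have "mixing_time (torus N) E \<le> n"
    unfolding mixing_time_def by (intro cInf_lower) simp_all
  moreover have "real n \<le> ?b + 1" unfolding n_def using b by linarith
  ultimately show ?thesis by linarith
qed

lemma mixing_dist_mixing_time: "mixing_dist (torus N) E (mixing_time (torus N) E) < 1 / 4"
proof -
  obtain n :: nat where "real n > 4 * total_degree * real N * ln (4 * total_degree)"
    using reals_Archimedean2 by blast
  then have "n \<in> {n. mixing_dist (torus N) E n < 1 / 4}" using mixing_dist_small by simp
  then have "{n. mixing_dist (torus N) E n < 1 / 4} \<noteq> {}" by blast
  from Inf_nat_def1[OF this] show ?thesis by (simp add: mixing_time_def)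
qed

text \<open>The tent climbs by one at each point of \<open>Z\<close> in the first half of \<open>Z\<close>, descends by one at each point
  in the second half, and vanishes outside the range of \<open>Z\<close>.\<close>

definition tent :: "nat set \<Rightarrow> nat \<Rightarrow> nat" where
  "tent Z x = min (card {z\<in>Z. z < x}) (card {z\<in>Z. x \<le> z})"

lemma tent_Suc:
  assumes "finite Z"
  shows "\<bar>real (tent Z (Suc x)) - real (tent Z x)\<bar> \<le> 1"
proof -
  have 1: "card {z\<in>Z. z < Suc x} = card {z\<in>Z. z < x} + (if x \<in> Z then 1 else 0)"
  proof -
    have "{z\<in>Z. z < Suc x} = {z\<in>Z. z < x} \<union> (if x \<in> Z then {x} else {})"
      by (auto simp: less_Suc_eq)
    then show ?thesis using assms by (auto simp: card_insert_if)
  qed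
  have 2: "card {z\<in>Z. x \<le> z} = card {z\<in>Z. Suc x \<le> z} + (if x \<in> Z then 1 else 0)"
  proof -
    have "{z\<in>Z. x \<le> z} = {z\<in>Z. Suc x \<le> z} \<union> (if x \<in> Z then {x} else {})"
      by (auto simp: Suc_le_eq le_less)
    then show ?thesis using assms by (auto simp: card_insert_if)
  qed
  show ?thesis unfolding tent_def 1 2 by auto
qed

text \<open>The energy of the tent comes from the edges of the path alone, each of which contributes at most one
  to it, while the tent vanishes on at least half of the torus and has height at least a quarter of
  \<open>card Z\<close> on at least as many points. So its variance is at least of order \<open>(card Z)\<^sup>3\<close>.\<close>

theorem mixing_time_ge_tent:
  assumes Z: "Z \<subseteq> {a..<b}" and ab: "1 \<le> a" "a \<le> b" "b \<le> N" "2 * (b - a) \<le> N"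
    and m: "card Z \<ge> 4"
    and flat: "\<And>x y. \<lbrakk>{x, y} \<in> E; Suc x < y\<rbrakk> \<Longrightarrow> tent Z x = tent Z y"
  shows "real (card Z) ^ 3 / (256 * real N) \<le> real (mixing_time (torus N) E)"
proof -
  have fin: "finite Z" using Z finite_subset by blast
  define f where "f x = real (tent Z x)" for x
  define M where "M = card Z"
  have "energy f \<le> real N / 2"
  proof -
    have inner: "(\<Sum>y\<in>torus N. adj x y * (f x - f y)\<^sup>2) \<le> 2" for x
    proof -
      have "adj x y * (f x - f y)\<^sup>2 \<le> (if y = Suc x then 1 else 0) + (if Suc y = x then 1 else 0)" for y
      proof (cases "{x, y} \<in> E \<and> f x \<noteq> f y")
        case True
        then have "y = Suc x \<or> x = Suc y"
          using flat[of x y] flat[of y x] by (auto simp: f_def insert_commute) (metis Suc_lessI linorder_neqE_nat)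
        moreover have "(f x - f y)\<^sup>2 \<le> 1" if "y = Suc x \<or> x = Suc y"
          using tent_Suc[OF fin, of x] tent_Suc[OF fin, of y] that
          by (auto simp: f_def abs_square_le_1 abs_minus_commute)
        ultimately show ?thesis by (auto simp: adj_def)
      qed (auto simp: adj_def)
      then have "(\<Sum>y\<in>torus N. adj x y * (f x - f y)\<^sup>2)
          \<le> (\<Sum>y\<in>torus N. (if y = Suc x then 1 else 0) + (if Suc y = x then 1 else 0))"
        by (rule sum_mono)
      also have "\<dots> \<le> 1 + 1"
      proof -
        have "(\<Sum>y\<in>torus N. (if y = Suc x then 1 else 0)) \<le> (1 :: real)"
          by (simp add: finite_V sum.delta)
        moreover have "(\<Sum>y\<in>torus N. (if Suc y = x then 1 else 0)) \<le> (1 :: real)"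
        proof -
          have "(\<Sum>y\<in>torus N. (if Suc y = x then 1 else 0)) \<le> (\<Sum>y\<in>torus N. (if y = x - 1 then 1 else 0 :: real))"
            by (rule sum_mono) auto
          also have "\<dots> \<le> 1" by (simp add: finite_V sum.delta)
          finally show ?thesis .
        qed
        ultimately show ?thesis by (simp add: sum.distrib)
      qed
      finally show ?thesis by simp
    qed
    have "energy f \<le> (\<Sum>x\<in>torus N. 2) / 4"
      unfolding energy_def by (intro divide_right_mono sum_mono inner) auto
    then show ?thesis by (simp add: torus_def)
  qed
  moreover have "real M ^ 3 / 256 \<le> 2 * real (mixing_time (torus N) E) * energy f"
  proof (rule mixing_lower_bound[OF mixing_dist_mixing_time])
    fix c :: real
    have Dsum: "real (card A) * u\<^sup>2 \<le> (\<Sum>x\<in>torus N. D x * (f x - c)\<^sup>2)"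
      if A: "A \<subseteq> torus N" and u: "\<And>x. x \<in> A \<Longrightarrow> u \<le> \<bar>f x - c\<bar>" "u \<ge> 0" for A u
    proof -
      have "real (card A) * u\<^sup>2 = (\<Sum>x\<in>A. u\<^sup>2)" by simp
      also have "\<dots> \<le> (\<Sum>x\<in>A. D x * (f x - c)\<^sup>2)"
      proof (rule sum_mono)
        fix x assume x: "x \<in> A"
        have "u\<^sup>2 \<le> \<bar>f x - c\<bar>\<^sup>2" using u x by (intro power_mono) auto
        also have "\<dots> \<le> D x * (f x - c)\<^sup>2"
          using mult_right_mono[OF D_ge_1, of x "(f x - c)\<^sup>2"] x A by auto
        finally show "u\<^sup>2 \<le> D x * (f x - c)\<^sup>2" .
      qed
      also have "\<dots> \<le> (\<Sum>x\<in>torus N. D x * (f x - c)\<^sup>2)"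
        by (rule sum_mono2) (use A finite_V in auto)
      finally show ?thesis .
    qed
    have MN: "2 * M \<le> N"
    proof -
      have "M \<le> card {a..<b}" unfolding M_def by (rule card_mono) (use Z in auto)
      then show ?thesis using ab by simp
    qed
    show "real M ^ 3 / 256 \<le> (\<Sum>x\<in>torus N. D x * (f x - c)\<^sup>2)"
    proof (cases "c \<ge> real M / 8")
      case True
      define A where "A = {1..a} \<union> {b..N}"
      have "card A \<ge> N - (b - a)"
      proof (cases "a = b")
        case True
        then have "A = {1..N}" using ab by (auto simp: A_def)
        then show ?thesis by simp
      next
        case False
        then have "card A = a + (N + 1 - b)"
          unfolding A_def using ab by (subst card_Un_disjoint) auto
        then show ?thesis using ab by linarith
      qed
      then have cA: "real M \<le> real (card A)" using ab MN by linarith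
      have zero: "f x = 0" if "x \<in> A" for x
      proof -
        have "{z\<in>Z. z < x} = {} \<or> {z\<in>Z. x \<le> z} = {}"
          using that Z by (fastforce simp: A_def)
        then have "card {z\<in>Z. z < x} = 0 \<or> card {z\<in>Z. x \<le> z} = 0"
          by (elim disjE) (simp_all only: card.empty, simp_all)
        then show ?thesis
          unfolding f_def tent_def by (elim disjE) (simp_all only: min_0L min_0R of_nat_0)
      qed
      have "real M * (real M / 8)\<^sup>2 \<le> real (card A) * (real M / 8)\<^sup>2"
        using cA by (intro mult_right_mono) auto
      also have "\<dots> \<le> (\<Sum>x\<in>torus N. D x * (f x - c)\<^sup>2)"
        by (rule Dsum) (use zero True ab in \<open>auto simp: A_def torus_def\<close>)
      finally have "real M * (real M / 8)\<^sup>2 \<le> (\<Sum>x\<in>torus N. D x * (f x - c)\<^sup>2)" .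
      moreover have "real M ^ 3 / 256 \<le> real M * (real M / 8)\<^sup>2"
        by (simp add: power2_eq_square power3_eq_cube)
      ultimately show ?thesis by linarith
    next
      case False
      define r where "r x = card {z\<in>Z. z < x}" for x
      have r_Suc: "r (Suc x) \<le> Suc (r x)" for x
      proof -
        have "{z\<in>Z. z < Suc x} \<subseteq> insert x {z\<in>Z. z < x}" by (auto simp: less_Suc_eq)
        then have "r (Suc x) \<le> card (insert x {z\<in>Z. z < x})"
          unfolding r_def by (rule card_mono[rotated]) (use fin in auto)
        also have "\<dots> \<le> Suc (r x)" unfolding r_def by (rule card_insert_le_m1) auto
        finally show ?thesis .
      qed
      have "\<exists>x\<le>b. r x = i" if "i \<le> M" for i
      proof -
        have rb: "r b = M"
        proof -
          have "{z\<in>Z. z < b} = Z" using Z by auto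
          then show ?thesis by (simp add: r_def M_def)
        qed
        define x where "x = (LEAST x. i \<le> r x)"
        have "i \<le> r x" unfolding x_def by (rule LeastI[of _ b]) (use rb that in simp)
        moreover have "x \<le> b" unfolding x_def by (rule Least_le) (use rb that in simp)
        moreover have "r x \<le> i"
        proof (cases x)
          case 0
          then show ?thesis by (simp add: r_def)
        next
          case (Suc y)
          then have "\<not> i \<le> r y" unfolding x_def by (metis lessI not_less_Least)
          then show ?thesis using r_Suc[of y] Suc by simp
        qed
        ultimately show ?thesis by (intro exI[of _ x]) auto
      qed
      then obtain X where X: "\<And>i. i \<le> M \<Longrightarrow> X i \<le> b \<and> r (X i) = i" by metis
      \<comment> \<open>the ranks at which the height is at least \<open>M / 4\<close>\<close>
      define I where "I = {(M + 3) div 4..3 * M div 4}"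
      have I: "i \<le> M" "M \<le> 4 * i" "M \<le> 4 * (M - i)" "1 \<le> i" if "i \<in> I" for i
        using that m by (auto simp: I_def M_def)
      have r_f: "f x = real (min (r x) (M - r x))" for x
      proof -
        have "card {z\<in>Z. x \<le> z} = M - r x"
        proof -
          have "{z\<in>Z. x \<le> z} = Z - {z\<in>Z. z < x}" by auto
          then show ?thesis unfolding r_def M_def
            by (simp only:) (rule card_Diff_subset, use fin in auto)
        qed
        then show ?thesis by (simp add: f_def tent_def r_def)
      qed
      have "inj_on X I" by (intro inj_onI) (metis I(1) X)
      then have "card (X ` I) = card I" by (rule card_image)
      then have cX: "real M / 4 \<le> real (card (X ` I))" using m by (simp add: I_def M_def)
      have "real M / 4 * (real M / 8)\<^sup>2 \<le> real (card (X ` I)) * (real M / 8)\<^sup>2"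
        using cX by (rule mult_right_mono) simp
      also have "\<dots> \<le> (\<Sum>x\<in>torus N. D x * (f x - c)\<^sup>2)"
      proof (rule Dsum)
        show "X ` I \<subseteq> torus N"
        proof
          fix x assume "x \<in> X ` I"
          then obtain i where i: "i \<in> I" "x = X i" by blast
          have "x \<noteq> 0"
          proof
            assume "x = 0"
            then have "r x = 0" by (simp add: r_def)
            then show False using X[of i] I[OF i(1)] i by simp
          qed
          then show "x \<in> torus N" using X[of i] I[OF i(1)] i ab by (auto simp: torus_def)
        qed
        show "real M / 8 \<le> \<bar>f x - c\<bar>" if xI: "x \<in> X ` I" for x
        proof -
          obtain i where i: "i \<in> I" "x = X i" using xI by blast
          have "r x = i" using X[of i] I[OF i(1)] i by simp
          then have "M \<le> 4 * min (r x) (M - r x)" using I[OF i(1)] by simp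
          then have "real M / 4 \<le> f x" unfolding r_f by linarith
          then show ?thesis using False by linarith
        qed
      qed simp
      finally show ?thesis by (simp add: power2_eq_square power3_eq_cube)
    qed
  qed
  moreover have "2 * real (mixing_time (torus N) E) * energy f
      \<le> 2 * real (mixing_time (torus N) E) * (real N / 2)"
    using calculation(1) by (intro mult_left_mono) auto
  ultimately show ?thesis using N_ge_2 by (simp add: M_def field_simps)
qed

end

section \<open>Blocks and points that no edge crosses\<close>

text \<open>The pairs of length at most \<open>R\<close> that straddle the edge between \<open>z\<close> and \<open>z + 1\<close>. Length is measured on the
  line, which agrees with the distance on the torus for \<open>R \<le> N / 2\<close>.\<close>

definition crossing :: "nat \<Rightarrow> real \<Rightarrow> nat \<Rightarrow> (nat \<times> nat) set" where
  "crossing N R z = {(x, y) \<in> random_pairs N. x \<le> z \<and> z < y \<and> real y - real x \<le> R}"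

text \<open>The blocks \<open>0, ..., 2 k - 1\<close> fill the middle half of the torus, so that no pair of vertices at small
  distance that wraps around from \<open>N\<close> to \<open>1\<close> has an end point in a block.\<close>

definition block_start :: "nat \<Rightarrow> nat \<Rightarrow> nat \<Rightarrow> nat" where
  "block_start N k j = N div 4 + 1 + j * (N div (4 * k))"

definition block :: "nat \<Rightarrow> nat \<Rightarrow> nat \<Rightarrow> nat set" where
  "block N k j = {block_start N k j..<block_start N k (Suc j)}"

lemma block_start_Suc: "block_start N k (Suc j) = block_start N k j + N div (4 * k)"
  by (simp add: block_start_def)

lemma card_block: "card (block N k j) = N div (4 * k)"
  by (simp add: block_def block_start_Suc)

lemma block_start_bounds:
  assumes "j \<le> 2 * k"
  shows "N div 4 + 1 \<le> block_start N k j" "block_start N k j \<le> N div 4 + 1 + N div 2"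
proof -
  show "N div 4 + 1 \<le> block_start N k j" by (simp add: block_start_def)
  have "j * (N div (4 * k)) \<le> 2 * k * (N div (4 * k))" using assms by (rule mult_right_mono) simp
  also have "\<dots> \<le> N div 2"
  proof -
    have "4 * k * (N div (4 * k)) \<le> N" by (rule times_div_less_eq_dividend)
    then have "4 * (k * (N div (4 * k))) \<le> N" by (simp only: mult.assoc)
    then have "2 * (k * (N div (4 * k))) \<le> N div 2" by linarith
    then show ?thesis by (simp only: mult.assoc)
  qed
  finally show "block_start N k j \<le> N div 4 + 1 + N div 2" by (simp add: block_start_def)
qed

lemma blocks_disjoint:
  assumes "x \<in> block N k i" "x \<in> block N k j"
  shows "i = j"
proof -
  have mono: "block_start N k a \<le> block_start N k b" if "a \<le> b" for a b
    using that by (simp add: block_start_def mult_right_mono)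
  have "\<not> i < j"
    using assms mono[of "Suc i" j] by (auto simp: block_def)
  moreover have "\<not> j < i"
    using assms mono[of "Suc j" i] by (auto simp: block_def)
  ultimately show ?thesis by simp
qed

lemma random_pairs_bounds:
  assumes "(x, y) \<in> random_pairs N"
  shows "1 \<le> x" "x < y" "y \<le> N"
  using assms by (auto simp: random_pairs_def torus_def)

lemma torus_dist_random_pair:
  assumes "(x, y) \<in> random_pairs N"
  shows "torus_dist N x y = min (real y - real x) (real N - (real y - real x))"
    and "torus_dist N x y \<ge> 1"
  using random_pairs_bounds[OF assms] by (auto simp: torus_dist_def min_def abs_if)

context torus_graph
begin

definition open_random_pairs :: "(nat \<times> nat) set" where
  "open_random_pairs = {(x, y) \<in> random_pairs N. {x, y} \<in> E}"

lemma finite_open_random_pairs: "finite open_random_pairs"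
  by (rule finite_subset[of _ "torus N \<times> torus N"])
    (auto simp: open_random_pairs_def random_pairs_def torus_def)

text \<open>Each vertex has two neighbours on the cycle, and every other edge is counted at both ends.\<close>

lemma total_degree_le: "total_degree \<le> 2 * real (card open_random_pairs) + 2 * real N"
proof -
  let ?C1 = "(\<lambda>x. (x, x mod N + 1)) ` torus N" and ?C2 = "(\<lambda>x. (x mod N + 1, x)) ` torus N"
  let ?swap = "prod.swap ` open_random_pairs"
  have "(\<Sum>x\<in>torus N. degree (torus N) E x) = card (SIGMA x:torus N. {y\<in>torus N. {x, y} \<in> E})"
    unfolding degree_def by (rule card_SigmaI[symmetric]) (auto simp: torus_def)
  also have "\<dots> \<le> card (open_random_pairs \<union> ?swap \<union> (?C1 \<union> ?C2))"
  proof (rule card_mono)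
    show "finite (open_random_pairs \<union> ?swap \<union> (?C1 \<union> ?C2))"
      using finite_open_random_pairs finite_V by auto
    show "(SIGMA x:torus N. {y\<in>torus N. {x, y} \<in> E}) \<subseteq> open_random_pairs \<union> ?swap \<union> (?C1 \<union> ?C2)"
    proof
      fix e assume "e \<in> (SIGMA x:torus N. {y\<in>torus N. {x, y} \<in> E})"
      then obtain x y where e: "e = (x, y)" "x \<in> torus N" "y \<in> torus N" "{x, y} \<in> E" by blast
      then have "x \<noteq> y" using loopfree[of x] by auto
      consider "consecutive N x y" | "\<not> consecutive N x y" "x < y" | "\<not> consecutive N x y" "y < x"
        using \<open>x \<noteq> y\<close> by linarith
      then show "e \<in> open_random_pairs \<union> ?swap \<union> (?C1 \<union> ?C2)"
      proof cases
        case 1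
        then show ?thesis using e by (auto simp: consecutive_def)
      next
        case 2
        then have "e \<in> open_random_pairs" using e by (auto simp: open_random_pairs_def random_pairs_def)
        then show ?thesis by blast
      next
        case 3
        then have "(y, x) \<in> open_random_pairs"
          using e by (auto simp: open_random_pairs_def random_pairs_def consecutive_def insert_commute)
        then have "e \<in> ?swap" using e by force
        then show ?thesis by blast
      qed
    qed
  qed
  also have "\<dots> \<le> (card open_random_pairs + card ?swap) + (card ?C1 + card ?C2)"
    by (intro order_trans[OF card_Un_le] add_mono card_Un_le)
  also have "\<dots> \<le> (card open_random_pairs + card open_random_pairs) + (N + N)"
    using card_image_le[OF finite_V, of "\<lambda>x. (x, x mod N + 1)"]
      card_image_le[OF finite_V, of "\<lambda>x. (x mod N + 1, x)"]
      card_image_le[OF finite_open_random_pairs, of prod.swap]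
    by (intro add_mono) (auto simp: torus_def)
  finally have "(\<Sum>x\<in>torus N. degree (torus N) E x) \<le> 2 * card open_random_pairs + 2 * N" by simp
  then have "real (\<Sum>x\<in>torus N. degree (torus N) E x) \<le> real (2 * card open_random_pairs + 2 * N)"
    by (simp only: of_nat_le_iff)
  then show ?thesis by (simp add: total_degree_def)
qed

text \<open>Fewer than \<open>k\<close> long edges have fewer than \<open>2 k\<close> end points, so one of the \<open>2 k\<close> blocks contains none
  of them. In this block the tent is placed on the points crossed by no edge up to length \<open>\<delta> N\<close>. Those
  are the points crossed by no short edge, except for the points covered by edges of medium length,
  whose number is at most the sum of the lengths of these edges.\<close>

theorem mixing_time_ge_blocks:
  fixes \<delta> R m :: real
  assumes k: "k \<ge> 1" and N: "N \<ge> 16" and \<delta>: "\<delta> \<le> 1 / 16"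
    and long: "card {(x, y) \<in> open_random_pairs. torus_dist N x y > \<delta> * N} < k"
    and short: "\<And>j. j < 2 * k \<Longrightarrow>
      m + (\<Sum>(x, y) | (x, y) \<in> open_random_pairs \<and> R < real y - real x \<and> real y - real x \<le> \<delta> * N. real y - real x)
        \<le> card {z \<in> block N k j. crossing N R z \<inter> open_random_pairs = {}}"
    and m: "m \<ge> 4"
  shows "m ^ 3 / (256 * real N) \<le> real (mixing_time (torus N) E)"
proof -
  define L where "L = {(x, y) \<in> open_random_pairs. torus_dist N x y > \<delta> * N}"
  have fL: "finite L" unfolding L_def by (rule finite_subset[OF _ finite_open_random_pairs]) auto
  obtain j where j: "j < 2 * k" and free: "\<And>x y. (x, y) \<in> L \<Longrightarrow> x \<notin> block N k j \<and> y \<notin> block N k j"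
  proof -
    define B where "B = {j. \<exists>x\<in>fst ` L \<union> snd ` L. x \<in> block N k j}"
    define num where "num x = (THE j. x \<in> block N k j)" for x
    have "num x = j" if "x \<in> block N k j" for x j
      unfolding num_def using that blocks_disjoint by (intro the_equality) blast+
    then have "B \<subseteq> num ` (fst ` L \<union> snd ` L)" by (force simp: B_def)
    then have "card B \<le> card (num ` (fst ` L \<union> snd ` L))" by (rule card_mono[rotated]) (use fL in auto)
    also have "\<dots> \<le> card (fst ` L \<union> snd ` L)" by (rule card_image_le) (use fL in auto)
    also have "\<dots> \<le> card (fst ` L) + card (snd ` L)" by (rule card_Un_le)
    also have "\<dots> \<le> card L + card L" by (intro add_mono card_image_le fL)
    also have "\<dots> < 2 * k" using long by (simp add: L_def)
    finally have "card B < card {..<2 * k}" by simp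
    moreover have "finite B"
      by (rule finite_subset[OF \<open>B \<subseteq> num ` (fst ` L \<union> snd ` L)\<close>]) (use fL in auto)
    ultimately have "\<not> {..<2 * k} \<subseteq> B" using card_mono by (metis linorder_not_less)
    then obtain j where "j < 2 * k" "j \<notin> B" by auto
    then show ?thesis by (intro that[of j]) (force simp: B_def)+
  qed
  define a where "a = block_start N k j"
  define b where "b = block_start N k (Suc j)"
  define U where "U = {z \<in> block N k j. crossing N R z \<inter> open_random_pairs = {}}"
  define Z where "Z = {z \<in> block N k j. crossing N (\<delta> * N) z \<inter> open_random_pairs = {}}"
  define F where "F = {(x, y). (x, y) \<in> open_random_pairs \<and> R < real y - real x \<and> real y - real x \<le> \<delta> * N}"
  have fF: "finite F" unfolding F_def by (rule finite_subset[OF _ finite_open_random_pairs]) auto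
  have fB: "finite (block N k j)" by (simp add: block_def)
  have a: "N div 4 + 1 \<le> a" unfolding a_def using j by (intro block_start_bounds) auto
  have b: "b \<le> N div 4 + 1 + N div 2" unfolding b_def using j by (intro block_start_bounds) auto
  have ab: "b = a + N div (4 * k)" by (simp add: a_def b_def block_start_Suc)
  have Zab: "Z \<subseteq> {a..<b}" by (auto simp: Z_def block_def a_def b_def)
  have mZ: "m \<le> card Z"
  proof -
    have "U \<subseteq> Z \<union> (\<Union>(x, y)\<in>F. {x..<y})"
    proof
      fix z assume z: "z \<in> U"
      show "z \<in> Z \<union> (\<Union>(x, y)\<in>F. {x..<y})"
      proof (cases "z \<in> Z")
        case False
        then obtain x y where xy: "(x, y) \<in> crossing N (\<delta> * N) z" "(x, y) \<in> open_random_pairs"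
          using z by (auto simp: U_def Z_def)
        then have "(x, y) \<notin> crossing N R z" using z by (auto simp: U_def)
        then have "(x, y) \<in> F" "z \<in> {x..<y}" using xy by (auto simp: crossing_def F_def)
        then show ?thesis by blast
      qed simp
    qed
    then have "card U \<le> card (Z \<union> (\<Union>(x, y)\<in>F. {x..<y}))"
      by (rule card_mono[rotated]) (use fF fB in \<open>auto simp: Z_def\<close>)
    also have "\<dots> \<le> card Z + card (\<Union>(x, y)\<in>F. {x..<y})" by (rule card_Un_le)
    also have "card (\<Union>(x, y)\<in>F. {x..<y}) \<le> (\<Sum>e\<in>F. card (case e of (x, y) \<Rightarrow> {x..<y}))"
      by (rule card_UN_le[OF fF])
    finally have "real (card U) \<le> real (card Z) + real (\<Sum>e\<in>F. card (case e of (x, y) \<Rightarrow> {x..<y}))"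
      by (simp only: of_nat_add[symmetric] of_nat_le_iff)
    also have "real (\<Sum>e\<in>F. card (case e of (x, y) \<Rightarrow> {x..<y})) = (\<Sum>(x, y)\<in>F. real y - real x)"
      unfolding of_nat_sum
    proof (intro sum.cong refl)
      fix e assume "e \<in> F"
      then have "fst e < snd e"
        using random_pairs_bounds[of "fst e" "snd e" N] by (auto simp: F_def open_random_pairs_def)
      then show "real (card (case e of (x, y) \<Rightarrow> {x..<y})) = (case e of (x, y) \<Rightarrow> real y - real x)"
        by (auto simp: case_prod_unfold of_nat_diff)
    qed
    finally show ?thesis using short[OF j] by (simp add: U_def F_def)
  qed
  have tent_outside: "tent Z x = 0" if "x \<le> a \<or> b \<le> x" for x
  proof -
    have "{z\<in>Z. z < x} = {} \<or> {z\<in>Z. x \<le> z} = {}" using that Zab by fastforce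
    then have "card {z\<in>Z. z < x} = 0 \<or> card {z\<in>Z. x \<le> z} = 0"
      by (elim disjE) (simp_all only: card.empty, simp_all)
    then show ?thesis unfolding tent_def by (elim disjE) (simp_all only: min_0L min_0R)
  qed
  have "real (card Z) ^ 3 / (256 * real N) \<le> real (mixing_time (torus N) E)"
  proof (rule mixing_time_ge_tent[OF Zab])
    show "1 \<le> a" using a by simp
    show "a \<le> b" using ab by simp
    show "b \<le> N" using b N by linarith
    show "2 * (b - a) \<le> N"
    proof -
      have "4 * k * (N div (4 * k)) \<le> N" by (rule times_div_less_eq_dividend)
      moreover have "2 * (N div (4 * k)) \<le> 4 * k * (N div (4 * k))" using k by (intro mult_right_mono) auto
      moreover have "b - a = N div (4 * k)" using ab by simp
      ultimately show ?thesis by linarith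
    qed
    show "4 \<le> card Z" using mZ m by linarith
    fix x y assume E: "{x, y} \<in> E" and xy: "Suc x < y"
    have V: "x \<in> torus N" "y \<in> torus N" using E edges by (auto simp: torus_edges_def doubleton_eq_iff)
    show "tent Z x = tent Z y"
    proof (cases "consecutive N x y")
      case True
      have "x = 1 \<and> y = N"
      proof (cases "y < N")
        case True
        then show ?thesis using \<open>consecutive N x y\<close> xy V by (auto simp: consecutive_def torus_def)
      next
        case False
        then show ?thesis using \<open>consecutive N x y\<close> xy V by (auto simp: consecutive_def torus_def)
      qed
      moreover have "b \<le> N" using b N by linarith
      ultimately show ?thesis using tent_outside[of x] tent_outside[of y] a by simp
    next
      case False
      then have O: "(x, y) \<in> open_random_pairs" "(x, y) \<in> random_pairs N"
        using E V xy by (auto simp: open_random_pairs_def random_pairs_def)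
      show ?thesis
      proof (cases "torus_dist N x y > \<delta> * N")
        case True
        then have "x \<notin> {a..<b}" "y \<notin> {a..<b}"
          using free[of x y] O by (auto simp: L_def block_def a_def b_def)
        then show ?thesis using tent_outside[of x] tent_outside[of y] by auto
      next
        case False
        then consider "real y - real x \<le> \<delta> * N" | "real N - (real y - real x) \<le> \<delta> * N"
          using torus_dist_random_pair(1)[OF O(2)] by linarith
        then show ?thesis
        proof cases
          case 1
          have none: "z \<notin> Z" if "x \<le> z" "z < y" for z
            using that 1 O by (auto simp: Z_def crossing_def)
          have "{z\<in>Z. z < x} = {z\<in>Z. z < y}" using none xy by (auto simp: not_less) (meson leI)
          moreover have "{z\<in>Z. x \<le> z} = {z\<in>Z. y \<le> z}" using none xy by (auto simp: not_less) (meson leI)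
          ultimately show ?thesis by (simp add: tent_def)
        next
          \<comment> \<open>the edge wraps around, so both of its ends lie outside the middle half\<close>
          case 2
          have "\<delta> * N \<le> N / 16" using \<delta> mult_right_mono[of \<delta> "1 / 16" "real N"] by simp
          with 2 have "real N - (real y - real x) \<le> N / 16" by (rule order_trans)
          then have "16 * (real N - (real y - real x)) \<le> real N" by simp
          moreover have "real y \<le> real N" "real x \<ge> 0" using V by (auto simp: torus_def)
          ultimately have "15 * real N \<le> 16 * real y" and "16 * real x \<le> real N"
            by (simp_all add: algebra_simps)
          then have "16 * x \<le> N" "15 * N \<le> 16 * y" by linarith+
          then have "x \<le> a" "b \<le> y" using a b N by linarith+
          then show ?thesis using tent_outside[of x] tent_outside[of y] by simp
        qed
      qed
    qed
  qed
  moreover have "m ^ 3 / (256 * real N) \<le> real (card Z) ^ 3 / (256 * real N)"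
    using mZ m by (intro divide_right_mono power_mono) auto
  ultimately show ?thesis by linarith
qed

end

section \<open>Connection probabilities for fixed weights\<close>

text \<open>Estimates for fixed weights. They involve the weights only through the sum of their powers with
  exponent \<open>\<theta>\<close>. The number \<open>b = \<alpha> \<theta> / 2\<close> exceeds one, so the sequence \<open>r\<^sup>-\<^sup>b\<close> is summable; its sum
  \<open>zeta\<close> depends on neither the weights nor \<open>N\<close>.\<close>

locale weighted_torus =
  fixes \<alpha> \<theta> :: real and w :: "nat \<Rightarrow> real" and N :: nat
  assumes w_ge_1: "\<And>x. x \<ge> 1 \<Longrightarrow> w x \<ge> 1"
    and theta: "0 < \<theta>" "\<theta> \<le> 1"
    and exponent: "\<alpha> * \<theta> > 2"
begin

definition rate :: "nat \<times> nat \<Rightarrow> real" where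
  "rate e = w (fst e) * w (snd e) / torus_dist N (fst e) (snd e) powr \<alpha>"

definition edge_prob :: "nat \<times> nat \<Rightarrow> real" where
  "edge_prob e = 1 - exp (- rate e)"

definition v :: "nat \<Rightarrow> real" where
  "v x = w x powr \<theta>"

definition total_weight :: real where
  "total_weight = (\<Sum>x\<in>{1..N}. v x)"

abbreviation b :: real where "b \<equiv> \<alpha> * \<theta> / 2"

definition decay :: "nat \<Rightarrow> real" where
  "decay r = real r powr (- b)"

definition zeta :: real where
  "zeta = (\<Sum>r. decay r)"

lemma decay_nonneg [simp]: "decay r \<ge> 0"
  by (simp add: decay_def)

lemma sum_decay_le:
  assumes "finite A" "inj_on g A"
  shows "(\<Sum>x\<in>A. decay (g x)) \<le> zeta"
proof -
  have "summable decay"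
    unfolding decay_def using exponent by (subst summable_real_powr_iff) auto
  then have "(\<Sum>r\<in>g ` A. decay r) \<le> zeta"
    unfolding zeta_def using assms by (intro sum_le_suminf) auto
  then show ?thesis using assms by (simp add: sum.reindex)
qed

lemma zeta_nonneg: "zeta \<ge> 0"
  using sum_decay_le[of "{}" id] by simp

lemma v_nonneg [simp]: "v x \<ge> 0"
  by (simp add: v_def)

lemma total_weight_nonneg: "total_weight \<ge> 0"
  unfolding total_weight_def by (intro sum_nonneg) auto

lemma rate_pos: "e \<in> random_pairs N \<Longrightarrow> rate e > 0"
  using w_ge_1[of "fst e"] w_ge_1[of "snd e"] torus_dist_random_pair(2)[of "fst e" "snd e" N]
    random_pairs_bounds[of "fst e" "snd e" N]
  unfolding rate_def by (intro divide_pos_pos mult_pos_pos) auto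

lemma rate_powr:
  assumes "e \<in> random_pairs N"
  shows "rate e powr \<theta> = v (fst e) * v (snd e) * torus_dist N (fst e) (snd e) powr (- (2 * b))"
    and "rate e powr (\<theta> / 2) \<le> (v (fst e) + v (snd e)) / 2 * torus_dist N (fst e) (snd e) powr (- b)"
proof -
  define x y d where "x = fst e" and "y = snd e" and "d = torus_dist N x y"
  have wx: "w x \<ge> 1" "w y \<ge> 1" and d: "d \<ge> 1"
    using assms w_ge_1 torus_dist_random_pair(2)[of x y N] random_pairs_bounds[of x y N]
    by (auto simp: x_def y_def d_def)
  have p: "rate e powr s = w x powr s * w y powr s * d powr (- (\<alpha> * s))" for s
    unfolding rate_def x_def[symmetric] y_def[symmetric] d_def[symmetric]
    using wx d by (simp add: divide_inverse powr_minus[symmetric] powr_mult powr_powr)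
  show "rate e powr \<theta> = v x * v y * d powr (- (2 * b))" by (simp add: p v_def)
  have "w u powr (\<theta> / 2) = sqrt (v u)" if "w u \<ge> 1" for u
    using that by (simp add: v_def powr_half_sqrt[symmetric] powr_powr)
  then have "rate e powr (\<theta> / 2) = sqrt (v x * v y) * d powr (- b)"
    using wx by (simp add: p real_sqrt_mult)
  also have "\<dots> \<le> (v x + v y) / 2 * d powr (- b)"
    by (intro mult_right_mono arith_geo_mean_sqrt) auto
  finally show "rate e powr (\<theta> / 2) \<le> (v x + v y) / 2 * d powr (- b)" .
qed

lemma edge_prob_le_rate_powr:
  assumes e: "e \<in> random_pairs N" and s: "0 < s" "s \<le> 1"
  shows "edge_prob e \<le> rate e powr s"
proof (cases "rate e \<le> 1")
  case True
  have "edge_prob e \<le> rate e powr 1"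
    using exp_ge_add_one_self[of "- rate e"] rate_pos[OF e] by (simp add: edge_prob_def)
  also have "\<dots> \<le> rate e powr s" using True rate_pos[OF e] s by (intro powr_mono') auto
  finally show ?thesis .
next
  case False
  have "edge_prob e \<le> 1" by (simp add: edge_prob_def)
  also have "1 \<le> rate e powr s" using False s by (intro ge_one_powr_ge_zero) auto
  finally show ?thesis .
qed

lemma random_pairs_square: "random_pairs N \<subseteq> {e \<in> {1..N} \<times> {1..N}. fst e < snd e}"
  by (auto simp: random_pairs_def torus_def)

text \<open>With exponent \<open>\<theta> / 2\<close> the arithmetic-geometric mean inequality separates the two weights of a pair, so the
  bound is linear in the total weight. The terms \<open>decay (y - x)\<close> and \<open>decay (N - (y - x))\<close> account for the
  two arcs between \<open>x\<close> and \<open>y\<close>.\<close>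

lemma sum_edge_prob_le: "(\<Sum>e\<in>random_pairs N. edge_prob e) \<le> 2 * zeta * total_weight"
proof -
  define D where "D x y = decay (y - x) + decay (N - (y - x))" for x y :: nat
  have D0: "D x y \<ge> 0" for x y by (simp add: D_def)
  have edge_prob_D: "edge_prob e \<le> (v (fst e) * D (fst e) (snd e) + v (snd e) * D (fst e) (snd e)) / 2"
    if e: "e \<in> random_pairs N" for e
  proof -
    have bd: "fst e < snd e" "snd e \<le> N" "1 \<le> fst e"
      using random_pairs_bounds[of "fst e" "snd e" N] e by auto
    have "torus_dist N (fst e) (snd e) powr (- b) \<le> D (fst e) (snd e)"
    proof -
      have "real (snd e - fst e) = real (snd e) - real (fst e)"
        "real (N - (snd e - fst e)) = real N - (real (snd e) - real (fst e))"
        using bd by (simp_all add: of_nat_diff)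
      then show ?thesis
        using torus_dist_random_pair(1)[of "fst e" "snd e" N] e
        by (simp only: D_def decay_def min_def prod.collapse split: if_splits) simp
    qed
    then have "(v (fst e) + v (snd e)) / 2 * torus_dist N (fst e) (snd e) powr (- b)
        \<le> (v (fst e) + v (snd e)) / 2 * D (fst e) (snd e)"
      by (intro mult_left_mono) auto
    moreover have "edge_prob e \<le> rate e powr (\<theta> / 2)" using e theta by (intro edge_prob_le_rate_powr) auto
    ultimately show ?thesis using rate_powr(2)[OF e] by (simp add: algebra_simps)
  qed
  have fin: "finite (random_pairs N)" by (rule finite_subset[OF random_pairs_square]) auto
  have "(\<Sum>e\<in>random_pairs N. edge_prob e)
      \<le> (\<Sum>e\<in>random_pairs N. (v (fst e) * D (fst e) (snd e) + v (snd e) * D (fst e) (snd e)) / 2)"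
    by (intro sum_mono edge_prob_D)
  also have "\<dots> \<le> (\<Sum>e\<in>{e \<in> {1..N} \<times> {1..N}. fst e < snd e}.
      (v (fst e) * D (fst e) (snd e) + v (snd e) * D (fst e) (snd e)) / 2)"
    by (rule sum_mono2) (use random_pairs_square D0 in auto)
  also have "\<dots> = (\<Sum>e\<in>{1..N} \<times> {1..N}. if fst e < snd e then
      (v (fst e) * D (fst e) (snd e) + v (snd e) * D (fst e) (snd e)) / 2 else 0)"
    by (rule sum.inter_filter) auto
  also have "\<dots> = (\<Sum>x\<in>{1..N}. \<Sum>y\<in>{1..N}. if x < y then (v x * D x y + v y * D x y) / 2 else 0)"
    by (simp add: sum.cartesian_product case_prod_unfold)
  also have "\<dots> = (\<Sum>x\<in>{1..N}. \<Sum>y\<in>{1..N}. (v x / 2 * (if x < y then D x y else 0)) + (v y / 2 * (if x < y then D x y else 0)))"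
    by (intro sum.cong refl) (auto simp: algebra_simps add_divide_distrib)
  also have "\<dots> = (\<Sum>x\<in>{1..N}. v x / 2 * (\<Sum>y\<in>{1..N}. if x < y then D x y else 0))
      + (\<Sum>y\<in>{1..N}. v y / 2 * (\<Sum>x\<in>{1..N}. if x < y then D x y else 0))"
    unfolding sum.distrib sum_distrib_left by (intro arg_cong2[where f = "(+)"] refl sum.swap)
  also have "\<dots> \<le> (\<Sum>x\<in>{1..N}. v x / 2 * (2 * zeta)) + (\<Sum>y\<in>{1..N}. v y / 2 * (2 * zeta))"
  proof (intro add_mono sum_mono mult_left_mono)
    fix x assume x: "x \<in> {1..N}"
    have "(\<Sum>y\<in>{1..N}. if x < y then D x y else 0) = (\<Sum>y\<in>{y\<in>{1..N}. x < y}. D x y)"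
      by (rule sum.inter_filter[symmetric]) auto
    also have "\<dots> = (\<Sum>y\<in>{y\<in>{1..N}. x < y}. decay (y - x)) + (\<Sum>y\<in>{y\<in>{1..N}. x < y}. decay (N - (y - x)))"
      by (simp add: D_def sum.distrib)
    also have "\<dots> \<le> zeta + zeta" by (intro add_mono sum_decay_le) (auto intro!: inj_onI)
    finally show "(\<Sum>y\<in>{1..N}. if x < y then D x y else 0) \<le> 2 * zeta" by simp
  next
    fix y assume y: "y \<in> {1..N}"
    have "(\<Sum>x\<in>{1..N}. if x < y then D x y else 0) = (\<Sum>x\<in>{x\<in>{1..N}. x < y}. D x y)"
      by (rule sum.inter_filter[symmetric]) auto
    also have "\<dots> = (\<Sum>x\<in>{x\<in>{1..N}. x < y}. decay (y - x)) + (\<Sum>x\<in>{x\<in>{1..N}. x < y}. decay (N - (y - x)))"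
      by (simp add: D_def sum.distrib)
    also have "\<dots> \<le> zeta + zeta" using y by (intro add_mono sum_decay_le) (auto intro!: inj_onI)
    finally show "(\<Sum>x\<in>{1..N}. if x < y then D x y else 0) \<le> 2 * zeta" by simp
  qed auto
  also have "\<dots> = 2 * zeta * total_weight"
    by (simp add: total_weight_def sum_distrib_left sum_distrib_right sum.distrib[symmetric] algebra_simps)
  finally show ?thesis .
qed

text \<open>For pairs at large distance the crude bound by the square of the total weight suffices, with the full
  exponent \<open>\<theta>\<close>.\<close>

lemma sum_weighted_edge_prob_le:
  assumes S: "S \<subseteq> random_pairs N"
    and f: "\<And>e. e \<in> S \<Longrightarrow> f e \<ge> 0"
    and M: "\<And>x y. (x, y) \<in> S \<Longrightarrow> f (x, y) * torus_dist N x y powr (- (2 * b)) \<le> M" "M \<ge> 0"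
  shows "(\<Sum>e\<in>S. f e * edge_prob e) \<le> M * total_weight\<^sup>2"
proof -
  have fin: "finite S" by (rule finite_subset[OF order_trans[OF S random_pairs_square]]) auto
  have "f e * edge_prob e \<le> M * (v (fst e) * v (snd e))" if e: "e \<in> S" for e
  proof -
    have "edge_prob e \<le> v (fst e) * v (snd e) * torus_dist N (fst e) (snd e) powr (- (2 * b))"
      using edge_prob_le_rate_powr[of e \<theta>] rate_powr(1)[of e] e S theta by auto
    then have "f e * edge_prob e \<le> f e * (v (fst e) * v (snd e) * torus_dist N (fst e) (snd e) powr (- (2 * b)))"
      by (rule mult_left_mono) (rule f[OF e])
    also have "\<dots> = (f e * torus_dist N (fst e) (snd e) powr (- (2 * b))) * (v (fst e) * v (snd e))"
      by (simp only: mult_ac)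
    also have "\<dots> \<le> M * (v (fst e) * v (snd e))"
      using M(1)[of "fst e" "snd e"] e by (intro mult_right_mono) auto
    finally show ?thesis .
  qed
  then have "(\<Sum>e\<in>S. f e * edge_prob e) \<le> (\<Sum>e\<in>S. M * (v (fst e) * v (snd e)))" by (rule sum_mono)
  also have "\<dots> \<le> (\<Sum>e\<in>{1..N} \<times> {1..N}. M * (v (fst e) * v (snd e)))"
    by (rule sum_mono2) (use S random_pairs_square M(2) in auto)
  also have "\<dots> = M * total_weight\<^sup>2"
  proof -
    have "total_weight\<^sup>2 = (\<Sum>e\<in>{1..N} \<times> {1..N}. v (fst e) * v (snd e))"
      unfolding total_weight_def power2_eq_square sum_product
      by (simp only: sum.cartesian_product case_prod_unfold)
    then show ?thesis by (simp only: sum_distrib_left)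
  qed
  finally show ?thesis .
qed

text \<open>A pair \<open>x \<le> z < y\<close> has length at least \<open>z - x + 1\<close> and at least \<open>y - z\<close>, so the decay in the length
  with exponent \<open>2 b\<close> is at most the product of the decays in these two numbers with exponent \<open>b\<close>. Thus the sum
  over all pairs crossing \<open>z\<close> factorises into a contribution from each side, and each of these is
  linear in the weights.\<close>

definition left_load :: "nat \<Rightarrow> real" where
  "left_load z = (\<Sum>x\<in>{1..z}. v x * decay (z - x + 1))"

definition right_load :: "nat \<Rightarrow> real" where
  "right_load z = (\<Sum>y\<in>{z<..N}. v y * decay (y - z))"

lemma left_load_nonneg: "left_load z \<ge> 0" and right_load_nonneg: "right_load z \<ge> 0"
  by (auto simp: left_load_def right_load_def intro!: sum_nonneg)

lemma sum_left_load_le: "(\<Sum>z\<in>{1..N}. left_load z) \<le> zeta * total_weight"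
proof -
  have "(\<Sum>z\<in>{1..N}. left_load z) = (\<Sum>z\<in>{1..N}. \<Sum>x\<in>{1..N}. v x * (if x \<le> z then decay (z - x + 1) else 0))"
  proof (rule sum.cong[OF refl])
    fix z assume z: "z \<in> {1..N}"
    have "left_load z = (\<Sum>x\<in>{x\<in>{1..N}. x \<le> z}. v x * decay (z - x + 1))"
      unfolding left_load_def by (rule sum.cong) (use z in auto)
    also have "\<dots> = (\<Sum>x\<in>{1..N}. if x \<le> z then v x * decay (z - x + 1) else 0)"
      by (rule sum.inter_filter) auto
    finally show "left_load z = (\<Sum>x\<in>{1..N}. v x * (if x \<le> z then decay (z - x + 1) else 0))"
      by (simp add: if_distrib[of "\<lambda>u. _ * u"] cong: if_cong)
  qed
  also have "\<dots> = (\<Sum>x\<in>{1..N}. v x * (\<Sum>z\<in>{1..N}. if x \<le> z then decay (z - x + 1) else 0))"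
    unfolding sum_distrib_left by (rule sum.swap)
  also have "\<dots> \<le> (\<Sum>x\<in>{1..N}. v x * zeta)"
  proof (intro sum_mono mult_left_mono)
    fix x
    have "(\<Sum>z\<in>{1..N}. if x \<le> z then decay (z - x + 1) else 0) = (\<Sum>z\<in>{z\<in>{1..N}. x \<le> z}. decay (z - x + 1))"
      by (rule sum.inter_filter[symmetric]) auto
    also have "\<dots> \<le> zeta" by (rule sum_decay_le) (auto intro!: inj_onI)
    finally show "(\<Sum>z\<in>{1..N}. if x \<le> z then decay (z - x + 1) else 0) \<le> zeta" .
  qed auto
  finally show ?thesis by (simp add: total_weight_def sum_distrib_left mult.commute)
qed

lemma sum_right_load_le: "(\<Sum>z\<in>{1..N}. right_load z) \<le> zeta * total_weight"
proof -
  have "(\<Sum>z\<in>{1..N}. right_load z) = (\<Sum>z\<in>{1..N}. \<Sum>y\<in>{1..N}. v y * (if z < y then decay (y - z) else 0))"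
  proof (rule sum.cong[OF refl])
    fix z assume z: "z \<in> {1..N}"
    have "right_load z = (\<Sum>y\<in>{y\<in>{1..N}. z < y}. v y * decay (y - z))"
      unfolding right_load_def by (rule sum.cong) (use z in auto)
    also have "\<dots> = (\<Sum>y\<in>{1..N}. if z < y then v y * decay (y - z) else 0)"
      by (rule sum.inter_filter) auto
    finally show "right_load z = (\<Sum>y\<in>{1..N}. v y * (if z < y then decay (y - z) else 0))"
      by (simp add: if_distrib[of "\<lambda>u. _ * u"] cong: if_cong)
  qed
  also have "\<dots> = (\<Sum>y\<in>{1..N}. v y * (\<Sum>z\<in>{1..N}. if z < y then decay (y - z) else 0))"
    unfolding sum_distrib_left by (rule sum.swap)
  also have "\<dots> \<le> (\<Sum>y\<in>{1..N}. v y * zeta)"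
  proof (intro sum_mono mult_left_mono)
    fix y
    have "(\<Sum>z\<in>{1..N}. if z < y then decay (y - z) else 0) = (\<Sum>z\<in>{z\<in>{1..N}. z < y}. decay (y - z))"
      by (rule sum.inter_filter[symmetric]) auto
    also have "\<dots> \<le> zeta" by (rule sum_decay_le) (auto intro!: inj_onI)
    finally show "(\<Sum>z\<in>{1..N}. if z < y then decay (y - z) else 0) \<le> zeta" .
  qed auto
  finally show ?thesis by (simp add: total_weight_def sum_distrib_left mult.commute)
qed

lemma crossing_rate_powr_le:
  assumes R: "R \<le> real N / 2"
  shows "(\<Sum>e\<in>crossing N R z. rate e powr \<theta>) \<le> left_load z * right_load z"
proof -
  have "rate e powr \<theta> \<le> (v (fst e) * decay (z - fst e + 1)) * (v (snd e) * decay (snd e - z))"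
    if e: "e \<in> crossing N R z" for e
  proof -
    obtain x y where xy: "e = (x, y)" "(x, y) \<in> random_pairs N" "x \<le> z" "z < y" "real y - real x \<le> R"
      using e by (auto simp: crossing_def)
    have d: "torus_dist N x y = real y - real x"
      using torus_dist_random_pair(1)[OF xy(2)] xy R by (simp add: min_def)
    have mono: "(real y - real x) powr (- b) \<le> decay r" if "1 \<le> r" "r \<le> y - x" for r
    proof -
      have "real r \<le> real y - real x" using that xy by (simp add: of_nat_diff)
      then show ?thesis unfolding decay_def using that exponent by (intro powr_mono2') auto
    qed
    have "(real y - real x) powr (- (2 * b)) = (real y - real x) powr (- b) * (real y - real x) powr (- b)"
      by (simp add: powr_add[symmetric])
    also have "\<dots> \<le> decay (z - x + 1) * decay (y - z)"
      using xy by (intro mult_mono mono) auto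
    finally have "(real y - real x) powr (- (2 * b)) \<le> decay (z - x + 1) * decay (y - z)" .
    then have "v x * v y * (real y - real x) powr (- (2 * b)) \<le> v x * v y * (decay (z - x + 1) * decay (y - z))"
      by (intro mult_left_mono) auto
    then show ?thesis using rate_powr(1)[OF xy(2)] d by (simp add: xy(1) mult_ac)
  qed
  then have "(\<Sum>e\<in>crossing N R z. rate e powr \<theta>)
      \<le> (\<Sum>e\<in>crossing N R z. (v (fst e) * decay (z - fst e + 1)) * (v (snd e) * decay (snd e - z)))"
    by (rule sum_mono)
  also have "\<dots> \<le> (\<Sum>e\<in>{1..z} \<times> {z<..N}. (v (fst e) * decay (z - fst e + 1)) * (v (snd e) * decay (snd e - z)))"
    by (rule sum_mono2) (auto simp: crossing_def dest: random_pairs_bounds)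
  also have "\<dots> = left_load z * right_load z"
    by (simp add: left_load_def right_load_def sum_product sum.cartesian_product case_prod_unfold)
  finally show ?thesis .
qed

text \<open>As \<open>1 / \<theta> \<ge> 1\<close>, a bound on the sum of the \<open>\<theta>\<close>-th powers of the rates bounds the sum of the rates.\<close>

lemma crossing_rate_le:
  assumes R: "R \<le> real N / 2" and K: "left_load z \<le> K" "right_load z \<le> K" "K \<ge> 1"
  shows "(\<Sum>e\<in>crossing N R z. rate e) \<le> (K\<^sup>2) powr (1 / \<theta>)"
proof -
  define s where "s e = rate e powr \<theta>" for e
  have fin: "finite (crossing N R z)"
    by (rule finite_subset[of _ "{1..N} \<times> {1..N}"]) (use random_pairs_square in \<open>auto simp: crossing_def\<close>)
  have S: "(\<Sum>e\<in>crossing N R z. s e) \<le> K\<^sup>2"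
  proof -
    have "left_load z * right_load z \<le> K * K"
      using K left_load_nonneg right_load_nonneg by (intro mult_mono) auto
    then show ?thesis using crossing_rate_powr_le[OF R, of z] by (simp add: s_def power2_eq_square)
  qed
  have "rate e \<le> s e * (K\<^sup>2) powr (1 / \<theta> - 1)" if e: "e \<in> crossing N R z" for e
  proof -
    have pos: "rate e > 0" using e by (intro rate_pos) (auto simp: crossing_def)
    then have sp: "s e > 0" by (simp add: s_def)
    have "s e \<le> (\<Sum>e\<in>crossing N R z. s e)"
      by (rule member_le_sum) (use e fin in \<open>auto simp: s_def\<close>)
    then have "s e \<le> K\<^sup>2" using S by linarith
    have "rate e = s e powr (1 / \<theta>)" using pos theta by (simp add: s_def powr_powr)
    also have "\<dots> = s e * s e powr (1 / \<theta> - 1)" using sp by (simp add: powr_diff)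
    also have "\<dots> \<le> s e * (K\<^sup>2) powr (1 / \<theta> - 1)"
      using sp \<open>s e \<le> K\<^sup>2\<close> theta by (intro mult_left_mono powr_mono2) auto
    finally show ?thesis .
  qed
  then have "(\<Sum>e\<in>crossing N R z. rate e) \<le> (\<Sum>e\<in>crossing N R z. s e * (K\<^sup>2) powr (1 / \<theta> - 1))"
    by (rule sum_mono)
  also have "\<dots> = (\<Sum>e\<in>crossing N R z. s e) * (K\<^sup>2) powr (1 / \<theta> - 1)"
    by (simp add: sum_distrib_right)
  also have "\<dots> \<le> K\<^sup>2 * (K\<^sup>2) powr (1 / \<theta> - 1)" by (intro mult_right_mono S) auto
  also have "\<dots> = (K\<^sup>2) powr (1 / \<theta>)" using K by (simp add: powr_diff)
  finally show ?thesis .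
qed

text \<open>By Markov's inequality for the counting measure, few points \<open>z\<close> have a load above \<open>K\<close>.\<close>

lemma sum_exp_crossing_ge:
  assumes R: "R \<le> real N / 2" and K: "K \<ge> 1" and Z: "Z \<subseteq> {1..N}"
  shows "exp (- ((K\<^sup>2) powr (1 / \<theta>))) * (real (card Z) - 2 * zeta * total_weight / K)
    \<le> (\<Sum>z\<in>Z. exp (- (\<Sum>e\<in>crossing N R z. rate e)))"
proof -
  define B where "B = {z\<in>Z. left_load z > K \<or> right_load z > K}"
  have fZ: "finite Z" using Z finite_subset by blast
  have fB: "finite B" "B \<subseteq> Z" using fZ by (auto simp: B_def)
  have "K * real (card B) = (\<Sum>z\<in>B. K)" by simp
  also have "\<dots> \<le> (\<Sum>z\<in>B. left_load z + right_load z)"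
  proof (rule sum_mono)
    fix z assume "z \<in> B"
    then show "K \<le> left_load z + right_load z"
      using left_load_nonneg[of z] right_load_nonneg[of z] by (auto simp: B_def)
  qed
  also have "\<dots> \<le> (\<Sum>z\<in>{1..N}. left_load z + right_load z)"
    by (rule sum_mono2) (use fB Z left_load_nonneg right_load_nonneg in auto)
  also have "\<dots> \<le> zeta * total_weight + zeta * total_weight"
    unfolding sum.distrib by (intro add_mono sum_left_load_le sum_right_load_le)
  finally have cB: "real (card B) \<le> 2 * zeta * total_weight / K" using K by (simp add: field_simps)
  let ?q = "exp (- ((K\<^sup>2) powr (1 / \<theta>)))"
  have "?q * (real (card Z) - 2 * zeta * total_weight / K) \<le> ?q * (real (card Z) - real (card B))"
    using cB by (intro mult_left_mono) auto
  also have "\<dots> = (\<Sum>z\<in>Z - B. ?q)"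
    using fB fZ card_mono[OF fZ fB(2)] by (simp add: card_Diff_subset of_nat_diff)
  also have "\<dots> \<le> (\<Sum>z\<in>Z - B. exp (- (\<Sum>e\<in>crossing N R z. rate e)))"
  proof (rule sum_mono)
    fix z assume "z \<in> Z - B"
    then have "(\<Sum>e\<in>crossing N R z. rate e) \<le> (K\<^sup>2) powr (1 / \<theta>)"
      using K R by (intro crossing_rate_le) (auto simp: B_def)
    then show "?q \<le> exp (- (\<Sum>e\<in>crossing N R z. rate e))" by simp
  qed
  also have "\<dots> \<le> (\<Sum>z\<in>Z. exp (- (\<Sum>e\<in>crossing N R z. rate e)))"
    by (rule sum_mono2) (use fZ in auto)
  finally show ?thesis .
qed

end

section \<open>Conditionally independent edges\<close>

context scale_free_percolation
begin

definition intensity :: "nat \<Rightarrow> 'a \<Rightarrow> nat \<times> nat \<Rightarrow> real" where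
  "intensity N \<omega> e = W (fst e) \<omega> * W (snd e) \<omega> / torus_dist N (fst e) (snd e) powr \<alpha>"

definition connection_prob :: "nat \<Rightarrow> 'a \<Rightarrow> nat \<times> nat \<Rightarrow> real" where
  "connection_prob N \<omega> e = 1 - exp (- intensity N \<omega> e)"

definition open_pairs :: "nat \<Rightarrow> 'a \<Rightarrow> (nat \<times> nat) set" where
  "open_pairs N \<omega> = {(x, y). {x, y} \<in> G N \<omega>}"

lemma finite_random_pairs: "finite (random_pairs N)"
  by (rule finite_subset[of _ "torus N \<times> torus N"]) (auto simp: random_pairs_def torus_def)

lemma W_measurable [measurable]: "x \<ge> 1 \<Longrightarrow> W x \<in> borel_measurable M"
  using weights_indep unfolding indep_vars_def by auto

lemma AE_weight_ge_1: "AE \<omega> in M. \<forall>x\<ge>1. W x \<omega> \<ge> 1"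
proof -
  have "AE \<omega> in M. W x \<omega> \<ge> 1" if "x \<ge> 1" for x
  proof -
    have "{\<omega> \<in> space M. W x \<omega> \<ge> 1} \<in> events" using that by measurable
    moreover have "prob {\<omega> \<in> space M. W x \<omega> \<ge> 1} = 1"
      using weights_pareto[OF that, of 1] by simp
    ultimately have "AE \<omega> in M. \<omega> \<in> {\<omega> \<in> space M. W x \<omega> \<ge> 1}" by (simp only: prob_eq_1)
    then show ?thesis by auto
  qed
  then show ?thesis unfolding AE_all_countable by auto
qed

lemma weight_algebra_subalgebra: "subalgebra M (weight_algebra M W N)"
  unfolding weight_algebra_def subalgebra_def
proof
  have meas: "(\<lambda>\<omega>. \<lambda>x\<in>torus N. W x \<omega>) \<in> M \<rightarrow>\<^sub>M (\<Pi>\<^sub>M x\<in>torus N. borel)"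
    by (rule measurable_restrict) (auto simp: torus_def)
  show "sets (vimage_algebra (space M) (\<lambda>\<omega>. \<lambda>x\<in>torus N. W x \<omega>) (\<Pi>\<^sub>M x\<in>torus N. borel)) \<subseteq> events"
    using measurable_sets[OF meas] measurable_space[OF meas] by (subst sets_vimage_algebra2) auto
qed simp

lemma W_measurable_weight_algebra:
  assumes "x \<in> torus N"
  shows "W x \<in> borel_measurable (weight_algebra M W N)"
proof -
  have "(\<lambda>\<omega>. \<lambda>x\<in>torus N. W x \<omega>) \<in> weight_algebra M W N \<rightarrow>\<^sub>M (\<Pi>\<^sub>M x\<in>torus N. borel)"
    unfolding weight_algebra_def by (rule measurable_vimage_algebra1) (auto simp: space_PiM)
  from measurable_compose[OF this measurable_component_singleton[OF assms]]
  show ?thesis using assms by simp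
qed

lemma intensity_measurable:
  assumes "e \<in> random_pairs N"
  shows "(\<lambda>\<omega>. intensity N \<omega> e) \<in> borel_measurable (weight_algebra M W N)"
proof -
  have [measurable]: "W (fst e) \<in> borel_measurable (weight_algebra M W N)"
    "W (snd e) \<in> borel_measurable (weight_algebra M W N)"
    using assms by (auto intro!: W_measurable_weight_algebra simp: random_pairs_def)
  show ?thesis unfolding intensity_def by measurable
qed

lemma open_event: "{\<omega> \<in> space M. F \<subseteq> open_pairs N \<omega>} \<in> events"
proof -
  have "{\<omega> \<in> space M. F \<subseteq> open_pairs N \<omega>}
      = G N -` {E \<in> Pow (torus_edges N). \<forall>(x, y)\<in>F. {x, y} \<in> E} \<inter> space M"
    using measurable_space[OF graph_measurable[of N]] by (auto simp: open_pairs_def)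
  also have "\<dots> \<in> events" by (rule measurable_sets[OF graph_measurable]) auto
  finally show ?thesis .
qed

lemma open_pair_event [measurable]: "{\<omega> \<in> space M. e \<in> open_pairs N \<omega>} \<in> events"
  using open_event[of "{e}" N] by simp

lemma open_pair_pred [measurable]: "Measurable.pred M (\<lambda>\<omega>. e \<in> open_pairs N \<omega>)"
  unfolding pred_def by (rule open_pair_event)

text \<open>The defining property of the conditional expectation, tested against a bounded function \<open>h\<close> of the
  weights.\<close>

lemma expectation_open_pairs:
  assumes F: "F \<subseteq> random_pairs N"
    and h: "h \<in> borel_measurable (weight_algebra M W N)" and B: "\<And>\<omega>. \<bar>h \<omega>\<bar> \<le> B"
  shows "(\<integral>\<omega>. h \<omega> * (if F \<subseteq> open_pairs N \<omega> then 1 else 0) \<partial>M)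
    = (\<integral>\<omega>. h \<omega> * (\<Prod>e\<in>F. connection_prob N \<omega> e) \<partial>M)"
proof -
  interpret fs: finite_measure_subalgebra M "weight_algebra M W N"
    by unfold_locales (rule weight_algebra_subalgebra)
  have hM [measurable]: "h \<in> borel_measurable M"
    using measurable_from_subalg[OF weight_algebra_subalgebra h] .
  define A where "A = {\<omega> \<in> space M. \<forall>(x, y)\<in>F. {x, y} \<in> G N \<omega>}"
  have A_eq: "A = {\<omega> \<in> space M. F \<subseteq> open_pairs N \<omega>}" by (auto simp: A_def open_pairs_def)
  then have A [measurable]: "A \<in> events" using open_event by simp
  have ind: "indicator A \<omega> = (if F \<subseteq> open_pairs N \<omega> then 1 else 0 :: real)" if "\<omega> \<in> space M" for \<omega>
    using that by (auto simp: A_eq)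
  have int: "integrable M (\<lambda>\<omega>. h \<omega> * indicator A \<omega>)"
    by (rule integrable_const_bound[of _ B])
      (use B order_trans[OF abs_ge_zero B] in \<open>auto simp: indicator_def\<close>)
  have "(\<integral>\<omega>. h \<omega> * (if F \<subseteq> open_pairs N \<omega> then 1 else 0) \<partial>M) = (\<integral>\<omega>. h \<omega> * indicator A \<omega> \<partial>M)"
    by (rule Bochner_Integration.integral_cong) (auto simp: ind)
  also have "\<dots> = (\<integral>\<omega>. h \<omega> * real_cond_exp M (weight_algebra M W N) (indicator A) \<omega> \<partial>M)"
    by (rule fs.real_cond_exp_intg(2)[symmetric, OF int h]) simp
  also have "\<dots> = (\<integral>\<omega>. h \<omega> * (\<Prod>e\<in>F. connection_prob N \<omega> e) \<partial>M)"
  proof (rule integral_cong_AE)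
    show "AE \<omega> in M. h \<omega> * real_cond_exp M (weight_algebra M W N) (indicator A) \<omega>
        = h \<omega> * (\<Prod>e\<in>F. connection_prob N \<omega> e)"
      using random_edges[OF F] unfolding A_def[symmetric]
      by eventually_elim (simp add: connection_prob_def intensity_def case_prod_unfold)
    have [measurable]: "(\<lambda>\<omega>. intensity N \<omega> e) \<in> borel_measurable M" if "e \<in> F" for e
      using that F by (intro measurable_from_subalg[OF weight_algebra_subalgebra intensity_measurable]) blast
    show "(\<lambda>\<omega>. h \<omega> * (\<Prod>e\<in>F. connection_prob N \<omega> e)) \<in> borel_measurable M"
      unfolding connection_prob_def by measurable
    show "(\<lambda>\<omega>. h \<omega> * real_cond_exp M (weight_algebra M W N) (indicator A) \<omega>) \<in> borel_measurable M"
      by measurable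
  qed
  finally show ?thesis .
qed

lemma intensity_measurable_M [measurable]:
  "e \<in> random_pairs N \<Longrightarrow> (\<lambda>\<omega>. intensity N \<omega> e) \<in> borel_measurable M"
  using measurable_from_subalg[OF weight_algebra_subalgebra intensity_measurable] .

lemma intensity_nonneg:
  assumes "\<forall>x\<ge>1. W x \<omega> \<ge> 1" and "e \<in> random_pairs N"
  shows "intensity N \<omega> e \<ge> 0"
proof -
  have "W (fst e) \<omega> \<ge> 1" "W (snd e) \<omega> \<ge> 1"
    using assms by (auto simp: random_pairs_def torus_def)
  then show ?thesis by (simp add: intensity_def)
qed

lemma connection_prob_bounds:
  assumes "\<forall>x\<ge>1. W x \<omega> \<ge> 1" and "e \<in> random_pairs N"
  shows "connection_prob N \<omega> e \<ge> 0" "connection_prob N \<omega> e \<le> 1"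
  using intensity_nonneg[OF assms] by (auto simp: connection_prob_def)

text \<open>Given the weights, edges are independent. The assumption speaks only of the events that all pairs
  of a set are open; expanding the product over subsets reduces the claim to these events. The coefficients \<open>a e\<close>
  may be negative: \<open>a e = - 1\<close> makes a factor the indicator that \<open>e\<close> is closed.\<close>

theorem expectation_prod_open_pairs:
  assumes S: "S \<subseteq> random_pairs N"
    and h: "h \<in> borel_measurable (weight_algebra M W N)" and B: "\<And>\<omega>. \<bar>h \<omega>\<bar> \<le> B"
  shows "(\<integral>\<omega>. h \<omega> * (\<Prod>e\<in>S. 1 + (if e \<in> open_pairs N \<omega> then a e else 0)) \<partial>M)
    = (\<integral>\<omega>. h \<omega> * (\<Prod>e\<in>S. 1 + a e * connection_prob N \<omega> e) \<partial>M)"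
proof -
  have fS: "finite S" using S finite_random_pairs finite_subset by blast
  have hM [measurable]: "h \<in> borel_measurable M"
    using measurable_from_subalg[OF weight_algebra_subalgebra h] .
  have Bn: "B \<ge> 0" using B[of undefined] by linarith
  have open_prod: "(\<Prod>e\<in>F. if e \<in> open_pairs N \<omega> then a e else 0)
      = (\<Prod>e\<in>F. a e) * (if F \<subseteq> open_pairs N \<omega> then 1 else 0)" if "finite F" for F \<omega>
    using that by (induction F rule: finite_induct) auto
  have int1: "integrable M (\<lambda>\<omega>. h \<omega> * (if F \<subseteq> open_pairs N \<omega> then 1 else 0))" for F
  proof (rule integrable_const_bound[of _ B])
    have [measurable]: "Measurable.pred M (\<lambda>\<omega>. F \<subseteq> open_pairs N \<omega>)"
      unfolding pred_def by (rule open_event)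
    show "(\<lambda>\<omega>. h \<omega> * (if F \<subseteq> open_pairs N \<omega> then 1 else 0)) \<in> borel_measurable M" by measurable
  qed (use B Bn in auto)
  have int2: "integrable M (\<lambda>\<omega>. h \<omega> * (\<Prod>e\<in>F. connection_prob N \<omega> e))" if F: "F \<subseteq> S" for F
  proof (rule integrable_const_bound[of _ B])
    show "AE \<omega> in M. norm (h \<omega> * (\<Prod>e\<in>F. connection_prob N \<omega> e)) \<le> B"
      using AE_weight_ge_1
    proof eventually_elim
      case (elim \<omega>)
      have "\<bar>h \<omega>\<bar> * (\<Prod>e\<in>F. connection_prob N \<omega> e) \<le> B * 1"
        using connection_prob_bounds[OF elim] F S B Bn
        by (intro mult_mono prod_le_1 prod_nonneg) auto
      moreover have "(\<Prod>e\<in>F. connection_prob N \<omega> e) \<ge> 0"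
        using connection_prob_bounds[OF elim] F S by (intro prod_nonneg) auto
      ultimately show ?case by (simp add: abs_mult)
    qed
    have [measurable]: "(\<lambda>\<omega>. intensity N \<omega> e) \<in> borel_measurable M" if "e \<in> F" for e
      using that F S by (intro intensity_measurable_M) blast
    show "(\<lambda>\<omega>. h \<omega> * (\<Prod>e\<in>F. connection_prob N \<omega> e)) \<in> borel_measurable M"
      unfolding connection_prob_def by measurable
  qed
  have expand: "(\<Prod>e\<in>S. 1 + u e) = (\<Sum>F\<in>Pow S. \<Prod>e\<in>F. u e)" for u :: "nat \<times> nat \<Rightarrow> real"
    using prod_add[OF fS, of u "\<lambda>_. 1"] by (simp add: add.commute)
  have "(\<integral>\<omega>. h \<omega> * (\<Prod>e\<in>S. 1 + (if e \<in> open_pairs N \<omega> then a e else 0)) \<partial>M)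
      = (\<integral>\<omega>. (\<Sum>F\<in>Pow S. (\<Prod>e\<in>F. a e) * (h \<omega> * (if F \<subseteq> open_pairs N \<omega> then 1 else 0))) \<partial>M)"
  proof (rule Bochner_Integration.integral_cong[OF refl])
    fix \<omega>
    have "(\<Sum>F\<in>Pow S. \<Prod>e\<in>F. if e \<in> open_pairs N \<omega> then a e else 0)
        = (\<Sum>F\<in>Pow S. (\<Prod>e\<in>F. a e) * (if F \<subseteq> open_pairs N \<omega> then 1 else 0))"
      by (rule sum.cong[OF refl], rule open_prod) (use fS finite_subset in blast)
    then show "h \<omega> * (\<Prod>e\<in>S. 1 + (if e \<in> open_pairs N \<omega> then a e else 0))
      = (\<Sum>F\<in>Pow S. (\<Prod>e\<in>F. a e) * (h \<omega> * (if F \<subseteq> open_pairs N \<omega> then 1 else 0)))"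
      by (simp add: expand sum_distrib_left mult_ac)
  qed
  also have "\<dots> = (\<Sum>F\<in>Pow S. (\<Prod>e\<in>F. a e) * (\<integral>\<omega>. h \<omega> * (if F \<subseteq> open_pairs N \<omega> then 1 else 0) \<partial>M))"
    by (subst Bochner_Integration.integral_sum)
      (simp_all only: integral_mult_right_zero int1 integrable_mult_right)
  also have "\<dots> = (\<Sum>F\<in>Pow S. (\<Prod>e\<in>F. a e) * (\<integral>\<omega>. h \<omega> * (\<Prod>e\<in>F. connection_prob N \<omega> e) \<partial>M))"
    using S by (intro sum.cong refl arg_cong2[where f = "(*)"] expectation_open_pairs[OF _ h B]) auto
  also have "\<dots> = (\<integral>\<omega>. (\<Sum>F\<in>Pow S. (\<Prod>e\<in>F. a e) * (h \<omega> * (\<Prod>e\<in>F. connection_prob N \<omega> e))) \<partial>M)"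
    by (subst Bochner_Integration.integral_sum) (auto intro!: integrable_mult_right int2)
  also have "\<dots> = (\<integral>\<omega>. h \<omega> * (\<Prod>e\<in>S. 1 + a e * connection_prob N \<omega> e) \<partial>M)"
    by (simp add: expand prod.distrib sum_distrib_left mult_ac)
  finally show ?thesis .
qed

lemma exp_Markov:
  assumes X [measurable]: "X \<in> borel_measurable M"
    and bounds: "AE \<omega> in M. 0 \<le> X \<omega> \<and> X \<omega> \<le> B"
    and mean: "(\<integral>\<omega>. X \<omega> \<partial>M) \<le> 1"
    and A: "AE \<omega> in M. \<omega> \<in> A \<longrightarrow> exp t \<le> X \<omega>"
  shows "prob A \<le> exp (- t)"
proof -
  have int: "integrable M X"
    by (rule integrable_const_bound[of _ B]) (use bounds in auto)
  have "prob A \<le> prob {\<omega> \<in> space M. exp t \<le> X \<omega>}"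
  proof (rule finite_measure_mono_AE)
    show "AE \<omega> in M. \<omega> \<in> A \<longrightarrow> \<omega> \<in> {\<omega> \<in> space M. exp t \<le> X \<omega>}"
      using A AE_space by eventually_elim auto
  qed measurable
  also have "\<dots> \<le> (\<integral>\<omega>. X \<omega> \<partial>M) / exp t"
    by (rule integral_Markov_inequality_measure[where A = "space M"]) (use int bounds in auto)
  also have "\<dots> \<le> 1 / exp t" using mean by (intro divide_right_mono) auto
  finally show ?thesis by (simp add: exp_minus inverse_eq_divide)
qed

text \<open>Chernoff's bound with the compensator \<open>\<Sum> a e * p e\<close>, itself a function of the weights, on the other side:
  the exponential of the difference has mean at most one because \<open>1 + a p \<le> exp (a p)\<close>.\<close>

lemma open_pairs_upper_deviation:
  assumes S: "S \<subseteq> random_pairs N" and a: "\<And>e. e \<in> S \<Longrightarrow> a e \<ge> 0"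
  shows "prob {\<omega> \<in> space M. (\<Sum>e\<in>S. a e * connection_prob N \<omega> e) + t
      \<le> (\<Sum>e\<in>S. if e \<in> open_pairs N \<omega> then ln (1 + a e) else 0)} \<le> exp (- t)"
proof (rule exp_Markov)
  have fS: "finite S" using S finite_random_pairs finite_subset by blast
  define m where "m \<omega> = (\<Sum>e\<in>S. a e * connection_prob N \<omega> e)" for \<omega>
  \<comment> \<open>almost surely \<open>m\<close> is nonnegative; the minimum makes \<open>h\<close> bounded also on the null set where it is not\<close>
  define h where "h \<omega> = min 1 (exp (- m \<omega>))" for \<omega>
  let ?P = "\<lambda>\<omega>. \<Prod>e\<in>S. 1 + (if e \<in> open_pairs N \<omega> then a e else 0)"
  have h: "h \<in> borel_measurable (weight_algebra M W N)"
  proof -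
    have [measurable]: "(\<lambda>\<omega>. intensity N \<omega> e) \<in> borel_measurable (weight_algebra M W N)" if "e \<in> S" for e
      using that S by (intro intensity_measurable) blast
    show ?thesis unfolding h_def m_def connection_prob_def by measurable
  qed
  have h_bounds: "0 \<le> h \<omega>" "h \<omega> \<le> 1" for \<omega> by (auto simp: h_def)
  show "(\<lambda>\<omega>. h \<omega> * ?P \<omega>) \<in> borel_measurable M"
    using measurable_from_subalg[OF weight_algebra_subalgebra h] by measurable
  have m_nonneg: "AE \<omega> in M. m \<omega> \<ge> 0"
    using AE_weight_ge_1
  proof eventually_elim
    case (elim \<omega>)
    show ?case unfolding m_def
      using S a connection_prob_bounds[OF elim] by (intro sum_nonneg mult_nonneg_nonneg) blast+
  qed
  have "0 \<le> h \<omega> * ?P \<omega>" "h \<omega> * ?P \<omega> \<le> (\<Prod>e\<in>S. 1 + a e)" for \<omega>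
  proof -
    show "0 \<le> h \<omega> * ?P \<omega>" using a h_bounds by (intro mult_nonneg_nonneg prod_nonneg) auto
    have "h \<omega> * ?P \<omega> \<le> 1 * (\<Prod>e\<in>S. 1 + a e)"
      using a h_bounds by (intro mult_mono prod_mono prod_nonneg) auto
    then show "h \<omega> * ?P \<omega> \<le> (\<Prod>e\<in>S. 1 + a e)" by simp
  qed
  then show "AE \<omega> in M. 0 \<le> h \<omega> * ?P \<omega> \<and> h \<omega> * ?P \<omega> \<le> (\<Prod>e\<in>S. 1 + a e)" by simp
  have "(\<integral>\<omega>. h \<omega> * ?P \<omega> \<partial>M) = (\<integral>\<omega>. h \<omega> * (\<Prod>e\<in>S. 1 + a e * connection_prob N \<omega> e) \<partial>M)"
    by (rule expectation_prod_open_pairs[OF S h, of 1]) (use h_bounds in \<open>simp add: abs_le_iff order_trans[OF _ h_bounds(1)]\<close>)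
  also have "\<dots> \<le> (\<integral>\<omega>. 1 \<partial>M)"
  proof (rule integral_mono_AE')
    show "AE \<omega> in M. h \<omega> * (\<Prod>e\<in>S. 1 + a e * connection_prob N \<omega> e) \<le> 1"
      using AE_weight_ge_1 m_nonneg
    proof eventually_elim
      case (elim \<omega>)
      have ap: "a e * connection_prob N \<omega> e \<ge> 0" if "e \<in> S" for e
        using that a S connection_prob_bounds[OF elim(1)] by (intro mult_nonneg_nonneg) blast+
      have "(\<Prod>e\<in>S. 1 + a e * connection_prob N \<omega> e) \<le> (\<Prod>e\<in>S. exp (a e * connection_prob N \<omega> e))"
        using ap by (intro prod_mono) (auto simp: exp_ge_add_one_self)
      also have "\<dots> = exp (m \<omega>)" by (simp add: m_def exp_sum fS)
      finally have "h \<omega> * (\<Prod>e\<in>S. 1 + a e * connection_prob N \<omega> e) \<le> exp (- m \<omega>) * exp (m \<omega>)"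
        using ap by (intro mult_mono prod_nonneg) (auto simp: h_def)
      then show ?case by (simp add: exp_minus)
    qed
  qed auto
  finally show "(\<integral>\<omega>. h \<omega> * ?P \<omega> \<partial>M) \<le> 1" by (simp add: prob_space)
  show "AE \<omega> in M. \<omega> \<in> {\<omega> \<in> space M. (\<Sum>e\<in>S. a e * connection_prob N \<omega> e) + t
      \<le> (\<Sum>e\<in>S. if e \<in> open_pairs N \<omega> then ln (1 + a e) else 0)} \<longrightarrow> exp t \<le> h \<omega> * ?P \<omega>"
    using m_nonneg
  proof eventually_elim
    case (elim \<omega>)
    have "?P \<omega> = (\<Prod>e\<in>S. exp (if e \<in> open_pairs N \<omega> then ln (1 + a e) else 0))"
      using a by (intro prod.cong) (auto simp: add_nonneg_pos add_pos_nonneg)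
    also have "\<dots> = exp (\<Sum>e\<in>S. if e \<in> open_pairs N \<omega> then ln (1 + a e) else 0)"
      by (simp add: exp_sum fS)
    finally have "h \<omega> * ?P \<omega> = exp ((\<Sum>e\<in>S. if e \<in> open_pairs N \<omega> then ln (1 + a e) else 0) - m \<omega>)"
      using elim by (simp add: h_def exp_diff exp_minus field_simps)
    then show ?case by (auto simp: m_def)
  qed
qed

text \<open>The lower tail of the number of families \<open>S z\<close> without an open pair. Families that share no pair are independent given the
  weights, so the expectation of two to the power of minus this number factorises; each factor is
  \<open>1 - q / 2 \<le> exp (- q / 2)\<close>, where \<open>q\<close> is the conditional probability that a family is closed.\<close>

lemma closed_families_lower_deviation:
  assumes Z: "finite Z" and S: "\<And>z. z \<in> Z \<Longrightarrow> S z \<subseteq> random_pairs N"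
    and disj: "\<And>z z'. \<lbrakk>z \<in> Z; z' \<in> Z; z \<noteq> z'\<rbrakk> \<Longrightarrow> S z \<inter> S z' = {}"
  shows "prob {\<omega> \<in> space M. ln 2 * (\<Sum>z\<in>Z. if \<forall>e\<in>S z. e \<notin> open_pairs N \<omega> then 1 else 0)
      \<le> (\<Sum>z\<in>Z. exp (- (\<Sum>e\<in>S z. intensity N \<omega> e))) / 2 - t} \<le> exp (- t)"
proof (rule exp_Markov)
  have fS: "finite (S z)" if "z \<in> Z" for z
    using that S finite_random_pairs finite_subset by blast
  define q where "q \<omega> z = exp (- (\<Sum>e\<in>S z. intensity N \<omega> e))" for \<omega> z
  define cl where "cl \<omega> z = (if \<forall>e\<in>S z. e \<notin> open_pairs N \<omega> then 1 else 0 :: real)" for \<omega> z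
  define h where "h \<omega> = min (exp (card Z / 2)) (exp ((\<Sum>z\<in>Z. q \<omega> z) / 2))" for \<omega>
  let ?P = "\<lambda>\<omega>. \<Prod>z\<in>Z. 1 + (- 1 / 2) * cl \<omega> z"
  have h: "h \<in> borel_measurable (weight_algebra M W N)"
  proof -
    have [measurable]: "(\<lambda>\<omega>. intensity N \<omega> e) \<in> borel_measurable (weight_algebra M W N)"
      if "z \<in> Z" "e \<in> S z" for e z
      using that S by (intro intensity_measurable) blast
    show ?thesis unfolding h_def q_def by measurable
  qed
  have hM [measurable]: "h \<in> borel_measurable M"
    using measurable_from_subalg[OF weight_algebra_subalgebra h] .
  have h_bounds: "0 \<le> h \<omega>" "h \<omega> \<le> exp (card Z / 2)" for \<omega> by (auto simp: h_def)
  have q_meas [measurable]: "(\<lambda>\<omega>. q \<omega> z) \<in> borel_measurable M" if "z \<in> Z" for z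
  proof -
    have [measurable]: "(\<lambda>\<omega>. intensity N \<omega> e) \<in> borel_measurable M" if "e \<in> S z" for e
      using that \<open>z \<in> Z\<close> S by (intro intensity_measurable_M) blast
    show ?thesis unfolding q_def by measurable
  qed
  have cl_meas [measurable]: "(\<lambda>\<omega>. cl \<omega> z) \<in> borel_measurable M" if "z \<in> Z" for z
  proof -
    have [measurable]: "Measurable.pred M (\<lambda>\<omega>. \<forall>e\<in>S z. e \<notin> open_pairs N \<omega>)"
      by (rule pred_intros_finite) (use fS that in auto)
    show ?thesis unfolding cl_def by measurable
  qed
  show X_meas: "(\<lambda>\<omega>. h \<omega> * ?P \<omega>) \<in> borel_measurable M" by measurable
  have cl01: "cl \<omega> z \<in> {0, 1}" for \<omega> z by (simp add: cl_def)
  have fac: "0 \<le> 1 + (- 1 / 2) * cl \<omega> z" "1 + (- 1 / 2) * cl \<omega> z \<le> 1" for \<omega> z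
    using cl01[of \<omega> z] by auto
  have "0 \<le> h \<omega> * ?P \<omega>" "h \<omega> * ?P \<omega> \<le> exp (card Z / 2)" for \<omega>
  proof -
    show "0 \<le> h \<omega> * ?P \<omega>" using fac h_bounds by (intro mult_nonneg_nonneg prod_nonneg) auto
    have "h \<omega> * ?P \<omega> \<le> exp (card Z / 2) * 1"
      using fac h_bounds by (intro mult_mono prod_le_1 prod_nonneg) auto
    then show "h \<omega> * ?P \<omega> \<le> exp (card Z / 2)" by simp
  qed
  then show "AE \<omega> in M. 0 \<le> h \<omega> * ?P \<omega> \<and> h \<omega> * ?P \<omega> \<le> exp (card Z / 2)" by simp
  have expand: "(\<Prod>z\<in>Z. 1 + u z) = (\<Sum>F\<in>Pow Z. \<Prod>z\<in>F. u z)" for u :: "'b \<Rightarrow> real"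
    using prod_add[OF Z, of u "\<lambda>_. 1"] by (simp add: add.commute)
  have bound_int: "integrable M (\<lambda>\<omega>. h \<omega> * (\<Prod>z\<in>F. u \<omega> z))"
    if F: "F \<subseteq> Z" and u: "\<And>\<omega> z. z \<in> F \<Longrightarrow> 0 \<le> u \<omega> z"
      "AE \<omega> in M. \<forall>z\<in>F. u \<omega> z \<le> 1"
      and [measurable]: "\<And>z. z \<in> F \<Longrightarrow> (\<lambda>\<omega>. u \<omega> z) \<in> borel_measurable M"
    for F and u :: "'a \<Rightarrow> 'b \<Rightarrow> real"
  proof (rule integrable_const_bound[of _ "exp (card Z / 2)"])
    show "AE \<omega> in M. norm (h \<omega> * (\<Prod>z\<in>F. u \<omega> z)) \<le> exp (card Z / 2)"
      using u(2)
    proof eventually_elim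
      case (elim \<omega>)
      have "\<bar>h \<omega>\<bar> * (\<Prod>z\<in>F. u \<omega> z) \<le> exp (card Z / 2) * 1"
        using elim u(1) h_bounds by (intro mult_mono prod_le_1 prod_nonneg) auto
      moreover have "(\<Prod>z\<in>F. u \<omega> z) \<ge> 0" using u(1) by (intro prod_nonneg) auto
      ultimately show ?case by (simp add: abs_mult)
    qed
  qed measurable
  have q_le_1: "AE \<omega> in M. \<forall>z\<in>Z. q \<omega> z \<le> 1"
    using AE_weight_ge_1
  proof eventually_elim
    case (elim \<omega>)
    have "0 \<le> (\<Sum>e\<in>S z. intensity N \<omega> e)" if "z \<in> Z" for z
      using S[OF that] intensity_nonneg[OF elim] by (intro sum_nonneg) blast
    then show ?case by (simp add: q_def)
  qed
  have int_cl: "integrable M (\<lambda>\<omega>. h \<omega> * (\<Prod>z\<in>F. cl \<omega> z))" if "F \<subseteq> Z" for F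
    by (rule bound_int) (use that cl_meas in \<open>auto simp: cl_def\<close>)
  have int_q: "integrable M (\<lambda>\<omega>. h \<omega> * (\<Prod>z\<in>F. q \<omega> z))" if "F \<subseteq> Z" for F
    by (rule bound_int) (use that q_meas q_le_1 in \<open>auto simp: q_def intro: eventually_mono\<close>)
  have closed_eq: "(\<integral>\<omega>. h \<omega> * (\<Prod>z\<in>F. cl \<omega> z) \<partial>M) = (\<integral>\<omega>. h \<omega> * (\<Prod>z\<in>F. q \<omega> z) \<partial>M)"
    if F: "F \<subseteq> Z" for F
  proof -
    have fin: "finite F" using F Z finite_subset by blast
    have union: "(\<Prod>e\<in>(\<Union>z\<in>F. S z). u e) = (\<Prod>z\<in>F. \<Prod>e\<in>S z. u e)" for u :: "nat \<times> nat \<Rightarrow> real"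
      by (rule prod.UNION_disjoint[OF fin]) (use fS F disj in blast)+
    have c: "cl \<omega> z = (\<Prod>e\<in>S z. 1 + (if e \<in> open_pairs N \<omega> then - 1 else 0))" if "z \<in> F" for \<omega> z
    proof (cases "\<forall>e\<in>S z. e \<notin> open_pairs N \<omega>")
      case True
      then show ?thesis by (simp add: cl_def)
    next
      case False
      then obtain e where "e \<in> S z" "e \<in> open_pairs N \<omega>" by blast
      then have "(\<Prod>e\<in>S z. 1 + (if e \<in> open_pairs N \<omega> then - 1 else 0 :: real)) = 0"
        using fS[of z] that F by (intro prod_zero) (auto intro!: bexI[of _ e])
      then show ?thesis using False by (auto simp: cl_def)
    qed
    have qq: "q \<omega> z = (\<Prod>e\<in>S z. 1 + - 1 * connection_prob N \<omega> e)" if "z \<in> F" for \<omega> z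
      using fS[of z] that F by (auto simp: q_def connection_prob_def exp_sum sum_negf[symmetric])
    have "(\<integral>\<omega>. h \<omega> * (\<Prod>z\<in>F. cl \<omega> z) \<partial>M)
        = (\<integral>\<omega>. h \<omega> * (\<Prod>e\<in>(\<Union>z\<in>F. S z). 1 + (if e \<in> open_pairs N \<omega> then - 1 else 0)) \<partial>M)"
      by (simp only: union) (simp add: c)
    also have "\<dots> = (\<integral>\<omega>. h \<omega> * (\<Prod>e\<in>(\<Union>z\<in>F. S z). 1 + - 1 * connection_prob N \<omega> e) \<partial>M)"
      by (rule expectation_prod_open_pairs[OF _ h, of _ "exp (card Z / 2)"])
        (use S F h_bounds in \<open>auto simp: abs_of_nonneg\<close>)
    also have "\<dots> = (\<integral>\<omega>. h \<omega> * (\<Prod>z\<in>F. q \<omega> z) \<partial>M)"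
      by (simp only: union) (simp add: qq)
    finally show ?thesis .
  qed
  have "(\<integral>\<omega>. h \<omega> * ?P \<omega> \<partial>M)
      = (\<integral>\<omega>. (\<Sum>F\<in>Pow Z. (\<Prod>z\<in>F. - 1 / 2) * (h \<omega> * (\<Prod>z\<in>F. cl \<omega> z))) \<partial>M)"
    by (simp only: expand prod.distrib sum_distrib_left mult_ac)
  also have "\<dots> = (\<Sum>F\<in>Pow Z. (\<Prod>z\<in>F. - 1 / 2) * (\<integral>\<omega>. h \<omega> * (\<Prod>z\<in>F. cl \<omega> z) \<partial>M))"
    by (subst Bochner_Integration.integral_sum) (auto intro!: integrable_mult_right int_cl simp del: prod_constant)
  also have "\<dots> = (\<Sum>F\<in>Pow Z. (\<Prod>z\<in>F. - 1 / 2) * (\<integral>\<omega>. h \<omega> * (\<Prod>z\<in>F. q \<omega> z) \<partial>M))"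
    by (intro sum.cong refl) (auto simp: closed_eq simp del: prod_constant)
  also have "\<dots> = (\<integral>\<omega>. (\<Sum>F\<in>Pow Z. (\<Prod>z\<in>F. - 1 / 2) * (h \<omega> * (\<Prod>z\<in>F. q \<omega> z))) \<partial>M)"
    by (subst Bochner_Integration.integral_sum) (auto intro!: integrable_mult_right int_q simp del: prod_constant)
  also have "\<dots> = (\<integral>\<omega>. h \<omega> * (\<Prod>z\<in>Z. 1 + (- 1 / 2) * q \<omega> z) \<partial>M)"
    by (simp only: expand prod.distrib sum_distrib_left mult_ac)
  also have "\<dots> \<le> (\<integral>\<omega>. 1 \<partial>M)"
  proof (rule integral_mono_AE')
    show "AE \<omega> in M. h \<omega> * (\<Prod>z\<in>Z. 1 + (- 1 / 2) * q \<omega> z) \<le> 1"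
      using q_le_1
    proof eventually_elim
      case (elim \<omega>)
      have "(\<Prod>z\<in>Z. 1 + (- 1 / 2) * q \<omega> z) \<le> (\<Prod>z\<in>Z. exp ((- 1 / 2) * q \<omega> z))"
        using elim exp_ge_add_one_self[of "(- 1 / 2) * q \<omega> _"] by (intro prod_mono) fastforce
      also have "\<dots> = exp (- (\<Sum>z\<in>Z. q \<omega> z) / 2)"
        using exp_sum[OF Z, of "\<lambda>z. (- 1 / 2) * q \<omega> z", symmetric]
        by (simp only: sum_distrib_left[symmetric]) simp
      finally have "h \<omega> * (\<Prod>z\<in>Z. 1 + (- 1 / 2) * q \<omega> z)
          \<le> exp ((\<Sum>z\<in>Z. q \<omega> z) / 2) * exp (- (\<Sum>z\<in>Z. q \<omega> z) / 2)"
        using elim by (intro mult_mono prod_nonneg) (fastforce simp: h_def)+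
      then show ?case by (simp add: exp_minus)
    qed
  qed auto
  finally show "(\<integral>\<omega>. h \<omega> * ?P \<omega> \<partial>M) \<le> 1" by (simp add: prob_space)
  show "AE \<omega> in M. \<omega> \<in> {\<omega> \<in> space M. ln 2 * (\<Sum>z\<in>Z. if \<forall>e\<in>S z. e \<notin> open_pairs N \<omega> then 1 else 0)
      \<le> (\<Sum>z\<in>Z. exp (- (\<Sum>e\<in>S z. intensity N \<omega> e))) / 2 - t} \<longrightarrow> exp t \<le> h \<omega> * ?P \<omega>"
    using q_le_1
  proof eventually_elim
    case (elim \<omega>)
    have "(\<Sum>z\<in>Z. q \<omega> z) \<le> (\<Sum>z\<in>Z. 1)" using elim by (intro sum_mono) auto
    then have h_eq: "h \<omega> = exp ((\<Sum>z\<in>Z. q \<omega> z) / 2)" by (simp add: h_def)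
    have "?P \<omega> = (\<Prod>z\<in>Z. exp (- (ln 2 * cl \<omega> z)))"
      by (intro prod.cong) (auto simp: cl_def exp_minus)
    also have "\<dots> = exp (- (ln 2 * (\<Sum>z\<in>Z. cl \<omega> z)))"
      using exp_sum[OF Z, of "\<lambda>z. - (ln 2 * cl \<omega> z)"] by (simp add: sum_negf sum_distrib_left)
    finally have "h \<omega> * ?P \<omega> = exp ((\<Sum>z\<in>Z. q \<omega> z) / 2) * exp (- (ln 2 * (\<Sum>z\<in>Z. cl \<omega> z)))"
      by (simp only: h_eq)
    then have "h \<omega> * ?P \<omega> = exp ((\<Sum>z\<in>Z. q \<omega> z) / 2 - ln 2 * (\<Sum>z\<in>Z. cl \<omega> z))"
      by (simp add: mult_exp_exp)
    then show ?case by (auto simp: q_def cl_def)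
  qed
qed

text \<open>At most \<open>N\<^sup>2\<close> events of probability at most \<open>N\<^sup>-\<^sup>4\<close> each have a union of summable probability.\<close>

lemma borel_cantelli_union:
  assumes A: "\<And>N i. i \<in> I N \<Longrightarrow> A N i \<in> events"
    and I: "\<And>N. finite (I N)" "\<And>N. card (I N) \<le> N ^ 2"
    and p: "\<And>N i. \<lbrakk>N \<ge> 1; i \<in> I N\<rbrakk> \<Longrightarrow> prob (A N i) \<le> exp (- 4 * ln (real N))"
  shows "AE \<omega> in M. \<forall>\<^sub>F N in sequentially. \<forall>i\<in>I N. \<omega> \<notin> A N i"
proof -
  define U where "U N = (\<Union>i\<in>I N. A N i)" for N
  have U [measurable]: "U N \<in> events" for N
    unfolding U_def using A I by (intro sets.finite_UN) auto
  have "prob (U N) \<le> 1 / real N ^ 2" if N: "N \<ge> 1" for N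
  proof -
    have "prob (U N) \<le> (\<Sum>i\<in>I N. prob (A N i))"
      unfolding U_def using A I by (intro finite_measure_subadditive_finite) auto
    also have "\<dots> \<le> (\<Sum>i\<in>I N. exp (- 4 * ln (real N)))" by (intro sum_mono p N)
    also have "\<dots> \<le> real (N ^ 2) * exp (- 4 * ln (real N))"
      using I(2)[of N] by (simp only: sum_constant of_nat_le_iff mult_right_mono exp_ge_zero)
    also have "exp (- 4 * ln (real N)) = 1 / real N ^ 4"
      using N exp_of_nat_mult[of 4 "ln (real N)"] by (simp add: exp_minus inverse_eq_divide)
    also have "real (N ^ 2) * (1 / real N ^ 4) = 1 / real N ^ 2"
      using N by (simp add: power2_eq_square power4_eq_xxxx)
    finally show ?thesis .
  qed
  then have "summable (\<lambda>N. prob (U N))"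
    by (intro summable_comparison_test_ev[OF _ inverse_power_summable[of 2]])
      (auto simp: eventually_sequentially inverse_eq_divide intro!: exI[of _ 1])
  from borel_cantelli_AE1[OF U _ this]
  have "AE \<omega> in M. \<forall>\<^sub>F N in sequentially. \<omega> \<in> space M - U N" by (simp add: emeasure_eq_measure)
  then show ?thesis by eventually_elim (auto simp: U_def elim: eventually_mono)
qed

theorem AE_eventually_open_pairs_le:
  assumes S: "\<And>N. S N \<subseteq> random_pairs N" and a: "\<And>N e. e \<in> S N \<Longrightarrow> a N e \<ge> 0"
  shows "AE \<omega> in M. \<forall>\<^sub>F N in sequentially.
    (\<Sum>e\<in>S N. if e \<in> open_pairs N \<omega> then ln (1 + a N e) else 0)
      < (\<Sum>e\<in>S N. a N e * connection_prob N \<omega> e) + 4 * ln (real N)"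
proof -
  define A where "A N = {\<omega> \<in> space M. (\<Sum>e\<in>S N. a N e * connection_prob N \<omega> e) + 4 * ln (real N)
      \<le> (\<Sum>e\<in>S N. if e \<in> open_pairs N \<omega> then ln (1 + a N e) else 0)}" for N
  have A: "A N \<in> events" for N
  proof -
    have [measurable]: "(\<lambda>\<omega>. intensity N \<omega> e) \<in> borel_measurable M" if "e \<in> S N" for e
      using that S by (intro intensity_measurable_M) blast
    show ?thesis unfolding A_def connection_prob_def by measurable
  qed
  have "AE \<omega> in M. \<forall>\<^sub>F N in sequentially. \<forall>i\<in>(if N = 0 then {} else {()}). \<omega> \<notin> A N"
  proof (rule borel_cantelli_union)
    show "prob (A N) \<le> exp (- 4 * ln (real N))" for N
      using open_pairs_upper_deviation[of "S N" N "a N" "4 * ln (real N)"] S a by (simp add: A_def)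
  qed (use A in \<open>auto simp: Suc_le_eq\<close>)
  then show ?thesis using AE_space
  proof eventually_elim
    case (elim \<omega>)
    from elim(1) eventually_gt_at_top[of 0] show ?case
      by eventually_elim (use elim(2) in \<open>auto simp: A_def not_le\<close>)
  qed
qed

theorem AE_eventually_closed_families_ge:
  assumes Z: "\<And>N i. i \<in> I N \<Longrightarrow> finite (Z N i)"
    and S: "\<And>N i z. \<lbrakk>i \<in> I N; z \<in> Z N i\<rbrakk> \<Longrightarrow> S N z \<subseteq> random_pairs N"
    and disj: "\<And>N i z z'. \<lbrakk>i \<in> I N; z \<in> Z N i; z' \<in> Z N i; z \<noteq> z'\<rbrakk> \<Longrightarrow> S N z \<inter> S N z' = {}"
    and I: "\<And>N. finite (I N)" "\<And>N. card (I N) \<le> N ^ 2"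
  shows "AE \<omega> in M. \<forall>\<^sub>F N in sequentially. \<forall>i\<in>I N.
    (\<Sum>z\<in>Z N i. exp (- (\<Sum>e\<in>S N z. intensity N \<omega> e))) / 2 - 4 * ln (real N)
      < ln 2 * (\<Sum>z\<in>Z N i. if \<forall>e\<in>S N z. e \<notin> open_pairs N \<omega> then 1 else 0)"
proof -
  define A where "A N i = {\<omega> \<in> space M.
      ln 2 * (\<Sum>z\<in>Z N i. if \<forall>e\<in>S N z. e \<notin> open_pairs N \<omega> then 1 else 0)
      \<le> (\<Sum>z\<in>Z N i. exp (- (\<Sum>e\<in>S N z. intensity N \<omega> e))) / 2 - 4 * ln (real N)}" for N i
  have "AE \<omega> in M. \<forall>\<^sub>F N in sequentially. \<forall>i\<in>I N. \<omega> \<notin> A N i"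
  proof (rule borel_cantelli_union[OF _ I])
    show "A N i \<in> events" if i: "i \<in> I N" for N i
    proof -
      have [measurable]: "(\<lambda>\<omega>. intensity N \<omega> e) \<in> borel_measurable M"
        if "z \<in> Z N i" "e \<in> S N z" for z e
        using that i S by (intro intensity_measurable_M) blast
      have [measurable]: "Measurable.pred M (\<lambda>\<omega>. \<forall>e\<in>S N z. e \<notin> open_pairs N \<omega>)"
        if "z \<in> Z N i" for z
        using S[OF i that] finite_random_pairs finite_subset
        by (intro pred_intros_finite) (blast, measurable)
      show ?thesis unfolding A_def by measurable
    qed
    show "prob (A N i) \<le> exp (- 4 * ln (real N))" if i: "i \<in> I N" for N i
      using closed_families_lower_deviation[OF Z[OF i], of "S N" N "4 * ln (real N)"] S[OF i] disj[OF i]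
      by (simp add: A_def)
  qed
  then show ?thesis using AE_space
  proof eventually_elim
    case (elim \<omega>)
    from elim(1) show ?case
      by eventually_elim (use elim(2) in \<open>auto simp: A_def not_le\<close>)
  qed
qed

end

section \<open>Linear growth of the sum of weight powers\<close>

lemma (in prob_space) variance_sum_le:
  fixes Y :: "'i \<Rightarrow> 'a \<Rightarrow> real"
  assumes "finite I" "indep_vars (\<lambda>_. borel) Y I" "\<And>i \<omega>. i \<in> I \<Longrightarrow> \<bar>Y i \<omega>\<bar> \<le> B"
  shows "expectation (\<lambda>\<omega>. (\<Sum>i\<in>I. Y i \<omega>)\<^sup>2) - (expectation (\<lambda>\<omega>. \<Sum>i\<in>I. Y i \<omega>))\<^sup>2
    \<le> (\<Sum>i\<in>I. expectation (\<lambda>\<omega>. (Y i \<omega>)\<^sup>2))"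
  using assms
proof (induction I rule: finite_induct)
  case (insert i I)
  let ?S = "\<lambda>\<omega>. \<Sum>j\<in>I. Y j \<omega>"
  have meas: "Y j \<in> borel_measurable M" if "j \<in> insert i I" for j
    using insert.prems(1) that unfolding indep_vars_def by blast
  have [measurable]: "Y i \<in> borel_measurable M" "\<And>j. j \<in> I \<Longrightarrow> Y j \<in> borel_measurable M"
    using meas by auto
  have B: "B \<ge> 0" using insert.prems(2)[of i undefined] by auto
  have S_bound: "\<bar>?S \<omega>\<bar> \<le> real (card I) * B" for \<omega>
    by (rule order_trans[OF sum_abs sum_bounded_above]) (use insert.prems(2) in auto)
  have iY: "integrable M (Y i)"
    by (rule integrable_const_bound[of _ B]) (use insert.prems(2) in auto)
  have iS: "integrable M ?S"
    by (rule integrable_const_bound[of _ "real (card I) * B"]) (use S_bound in auto)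
  have iY2: "integrable M (\<lambda>\<omega>. (Y i \<omega>)\<^sup>2)"
    by (rule integrable_const_bound[of _ "B\<^sup>2"])
      (use insert.prems(2) B in \<open>auto simp: abs_le_square_iff[symmetric]\<close>)
  have iS2: "integrable M (\<lambda>\<omega>. (?S \<omega>)\<^sup>2)"
    by (rule integrable_const_bound[of _ "(real (card I) * B)\<^sup>2"])
      (use S_bound B in \<open>auto simp: abs_le_square_iff[symmetric]\<close>)
  have ind: "indep_var borel (Y i) borel ?S"
    using insert by (intro indep_vars_sum) auto
  have prod: "expectation (\<lambda>\<omega>. Y i \<omega> * ?S \<omega>) = expectation (Y i) * expectation ?S"
    "integrable M (\<lambda>\<omega>. Y i \<omega> * ?S \<omega>)"
    using indep_var_lebesgue_integral[OF ind iY iS] indep_var_integrable[OF ind iY iS] by auto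
  have "expectation (\<lambda>\<omega>. (Y i \<omega> + ?S \<omega>)\<^sup>2)
      = expectation (\<lambda>\<omega>. (Y i \<omega>)\<^sup>2 + (?S \<omega>)\<^sup>2 + 2 * (Y i \<omega> * ?S \<omega>))"
    by (intro Bochner_Integration.integral_cong) (auto simp: power2_sum)
  also have "\<dots> = expectation (\<lambda>\<omega>. (Y i \<omega>)\<^sup>2) + expectation (\<lambda>\<omega>. (?S \<omega>)\<^sup>2)
      + 2 * (expectation (Y i) * expectation ?S)"
    using iY2 iS2 prod by simp
  finally have "expectation (\<lambda>\<omega>. (Y i \<omega> + ?S \<omega>)\<^sup>2) - (expectation (\<lambda>\<omega>. Y i \<omega> + ?S \<omega>))\<^sup>2
      = expectation (\<lambda>\<omega>. (Y i \<omega>)\<^sup>2) - (expectation (Y i))\<^sup>2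
        + (expectation (\<lambda>\<omega>. (?S \<omega>)\<^sup>2) - (expectation ?S)\<^sup>2)"
    using iY iS by (simp add: power2_sum)
  moreover have "expectation (\<lambda>\<omega>. (?S \<omega>)\<^sup>2) - (expectation ?S)\<^sup>2
      \<le> (\<Sum>i\<in>I. expectation (\<lambda>\<omega>. (Y i \<omega>)\<^sup>2))"
    using insert.prems by (intro insert.IH) (auto intro: indep_vars_subset)
  moreover have "0 \<le> (expectation (Y i))\<^sup>2" by simp
  ultimately have "expectation (\<lambda>\<omega>. (Y i \<omega> + ?S \<omega>)\<^sup>2) - (expectation (\<lambda>\<omega>. Y i \<omega> + ?S \<omega>))\<^sup>2
      \<le> expectation (\<lambda>\<omega>. (Y i \<omega>)\<^sup>2) + (\<Sum>i\<in>I. expectation (\<lambda>\<omega>. (Y i \<omega>)\<^sup>2))"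
    by linarith
  then show ?case using insert.hyps by simp
qed simp

text \<open>Passing from the truncation level \<open>2 ^ n\<close> to \<open>2 ^ (n + 1)\<close> changes the truncated value only when
  \<open>v \<ge> 2 ^ n\<close>. This turns tail bounds into bounds for truncated moments by finite sums.\<close>

lemma truncation_le_levels:
  fixes v :: real
  assumes "v \<ge> 1"
  shows "min v (2 ^ n) \<le> 1 + (\<Sum>k<n. 2 ^ k * (if v \<ge> 2 ^ k then 1 else 0))"
    and "(min v (2 ^ n))\<^sup>2 \<le> 1 + 3 * (\<Sum>k<n. 4 ^ k * (if v \<ge> 2 ^ k then 1 else 0))"
proof -
  show "min v (2 ^ n) \<le> 1 + (\<Sum>k<n. 2 ^ k * (if v \<ge> 2 ^ k then 1 else 0))"
  proof (induction n)
    case (Suc n)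
    have "min v (2 ^ Suc n) \<le> min v (2 ^ n) + 2 ^ n * (if v \<ge> 2 ^ n then 1 else 0)" by auto
    then show ?case using Suc by simp
  qed (use assms in auto)
  show "(min v (2 ^ n))\<^sup>2 \<le> 1 + 3 * (\<Sum>k<n. 4 ^ k * (if v \<ge> 2 ^ k then 1 else 0))"
  proof (induction n)
    case (Suc n)
    have p4: "(2 ^ k :: real)\<^sup>2 = 4 ^ k" for k
      by (simp add: power2_eq_square flip: power_mult_distrib)
    have "(min v (2 ^ Suc n))\<^sup>2 \<le> (min v (2 ^ n))\<^sup>2 + 3 * (4 ^ n * (if v \<ge> 2 ^ n then 1 else 0))"
    proof (cases "v \<ge> 2 ^ n")
      case True
      have "(min v (2 ^ Suc n))\<^sup>2 \<le> (2 ^ Suc n)\<^sup>2"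
        using assms by (intro power_mono) auto
      also have "\<dots> = (min v (2 ^ n))\<^sup>2 + 3 * (4 ^ n * (if v \<ge> 2 ^ n then 1 else 0))"
        using True p4[of n] p4[of "Suc n"] by (simp add: min_absorb2)
      finally show ?thesis .
    next
      case False
      then have "v \<le> 2 ^ n" "v \<le> 2 ^ Suc n" using assms by auto
      then show ?thesis using False by (simp add: min_def)
    qed
    then show ?case using Suc by simp
  qed (use assms in auto)
qed

context scale_free_percolation
begin

text \<open>Almost surely every weight is at least one, and the maximum changes nothing; it makes the power
  monotone in the weight also on the exceptional null set.\<close>

definition weight_power :: "real \<Rightarrow> nat \<Rightarrow> 'a \<Rightarrow> real" where
  "weight_power \<theta> x \<omega> = max 1 (W x \<omega>) powr \<theta>"

lemma weight_power_ge_1: "\<theta> > 0 \<Longrightarrow> weight_power \<theta> x \<omega> \<ge> 1"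
  unfolding weight_power_def by (rule ge_one_powr_ge_zero) auto

lemma weight_power_measurable [measurable]: "x \<ge> 1 \<Longrightarrow> weight_power \<theta> x \<in> borel_measurable M"
  unfolding weight_power_def by measurable

lemma weight_power_tail:
  assumes x: "x \<ge> 1" and \<theta>: "\<theta> > 0" and v: "v \<ge> 1"
  shows "prob {\<omega> \<in> space M. weight_power \<theta> x \<omega> \<ge> v} \<le> v powr (- (\<tau> - 1) / \<theta>)"
proof -
  define t where "t = v powr (1 / \<theta>)"
  have t: "t \<ge> 1" unfolding t_def using v \<theta> by (intro ge_one_powr_ge_zero) auto
  have v_eq: "v = t powr \<theta>" using \<theta> v by (simp add: t_def powr_powr)
  have iff: "weight_power \<theta> x \<omega> \<ge> v \<longleftrightarrow> max 1 (W x \<omega>) \<ge> t" for \<omega>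
  proof
    assume *: "weight_power \<theta> x \<omega> \<ge> v"
    show "max 1 (W x \<omega>) \<ge> t"
    proof (rule ccontr)
      assume "\<not> max 1 (W x \<omega>) \<ge> t"
      then have "max 1 (W x \<omega>) powr \<theta> < t powr \<theta>" using \<theta> by (intro powr_less_mono2) auto
      then show False using * v_eq by (simp add: weight_power_def)
    qed
  next
    assume "max 1 (W x \<omega>) \<ge> t"
    then have "t powr \<theta> \<le> max 1 (W x \<omega>) powr \<theta>" using t \<theta> by (intro powr_mono2) auto
    then show "weight_power \<theta> x \<omega> \<ge> v" using v_eq by (simp add: weight_power_def)
  qed
  show ?thesis
  proof (cases "t = 1")
    case True
    then show ?thesis using v_eq by simp
  next
    case False
    then have "{\<omega> \<in> space M. weight_power \<theta> x \<omega> \<ge> v} = {\<omega> \<in> space M. W x \<omega> \<ge> t}"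
      using t by (auto simp: iff)
    then have "prob {\<omega> \<in> space M. weight_power \<theta> x \<omega> \<ge> v} = t powr (- (\<tau> - 1))"
      using weights_pareto[OF x, of t] t by simp
    also have "\<dots> = v powr (- (\<tau> - 1) / \<theta>)" by (simp add: t_def powr_powr)
    finally show ?thesis by simp
  qed
qed

lemma weight_power_indep: "indep_vars (\<lambda>_. borel) (\<lambda>x \<omega>. f (weight_power \<theta> x \<omega>)) {1..}"
  if [measurable]: "f \<in> borel_measurable borel" for f :: "real \<Rightarrow> real"
  unfolding weight_power_def by (rule indep_vars_compose2[OF weights_indep]) measurable

text \<open>It suffices to treat \<open>N = 2 ^ n\<close>, since the sums increase in \<open>N\<close>. The powers have tail exponent
  \<open>(\<tau> - 1) / \<theta> > 1\<close>. So with probability exponentially close to one in \<open>n\<close> none of the first \<open>2 ^ n\<close> of them reaches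
  \<open>2 ^ n\<close>, and the second moment of the powers truncated at \<open>2 ^ n\<close> is exponentially smaller than
  \<open>2 ^ n\<close>, up to a factor linear in \<open>n\<close>. Chebyshev's inequality for the truncated sum then leaves a
  summable error.\<close>

theorem AE_eventually_weight_power_sum_le:
  assumes \<theta>: "0 < \<theta>" "\<theta> < \<tau> - 1"
  shows "\<exists>C>0. AE \<omega> in M. \<forall>\<^sub>F N in sequentially. (\<Sum>x\<in>{1..N}. weight_power \<theta> x \<omega>) \<le> C * real N"
proof -
  \<comment> \<open>a tail exponent below \<open>2\<close>, so that the sum for the truncated second moment is dominated by its last term\<close>
  define b where "b = min ((\<tau> - 1) / \<theta>) (3 / 2)"
  have b: "1 < b" "b \<le> 3 / 2" "b \<le> (\<tau> - 1) / \<theta>"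
    unfolding b_def using \<theta> by (simp_all only: min_less_iff_conj min.cobounded1 min.cobounded2) simp
  define \<delta> where "\<delta> = 2 powr (- b)"
  have d1: "2 * \<delta> < 1"
  proof -
    have "2 * \<delta> = 2 powr (1 - b)" by (simp add: \<delta>_def powr_diff powr_minus divide_inverse)
    also have "\<dots> < 2 powr 0" using b by (intro powr_less_mono) auto
    finally show ?thesis by simp
  qed
  have d2: "1 < 4 * \<delta>"
  proof -
    have "4 * \<delta> = 2 powr (2 - b)" by (simp add: \<delta>_def powr_diff powr_minus divide_inverse)
    moreover have "2 powr 0 < 2 powr (2 - b)" using b by (intro powr_less_mono) auto
    ultimately show ?thesis by simp
  qed
  have d0: "\<delta> > 0" by (simp add: \<delta>_def)
  have tail: "prob {\<omega> \<in> space M. weight_power \<theta> x \<omega> \<ge> 2 ^ k} \<le> \<delta> ^ k" if "x \<ge> 1" for x k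
  proof -
    have "prob {\<omega> \<in> space M. weight_power \<theta> x \<omega> \<ge> 2 ^ k} \<le> (2 ^ k) powr (- (\<tau> - 1) / \<theta>)"
      using that \<theta> by (intro weight_power_tail) auto
    also have "\<dots> \<le> (2 ^ k) powr (- b)"
    proof (rule powr_mono)
      show "- (\<tau> - 1) / \<theta> \<le> - b" using b(3) by linarith
    qed simp
    also have "\<dots> = \<delta> ^ k"
      unfolding \<delta>_def by (simp add: powr_realpow[symmetric] powr_powr mult.commute)
    finally show ?thesis .
  qed
  define Y where "Y n x \<omega> = min (weight_power \<theta> x \<omega>) (2 ^ n)" for n :: nat and x \<omega>
  have Y_meas [measurable]: "Y n x \<in> borel_measurable M" if "x \<ge> 1" for n x
    using that unfolding Y_def by measurable
  have Y_bound: "0 \<le> Y n x \<omega>" "Y n x \<omega> \<le> 2 ^ n" for n x \<omega>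
    using weight_power_ge_1[OF \<theta>(1), of x \<omega>] by (auto simp: Y_def)
  have Y_int: "integrable M (Y n x)" if "x \<ge> 1" for n x
    by (rule integrable_const_bound[of _ "2 ^ n"]) (use Y_bound that in auto)
  have level_int: "expectation (\<lambda>\<omega>. c + d * (\<Sum>k<n. a k * (if weight_power \<theta> x \<omega> \<ge> 2 ^ k then 1 else 0)))
        \<le> c + d * (\<Sum>k<n. a k * \<delta> ^ k)"
      "integrable M (\<lambda>\<omega>. c + d * (\<Sum>k<n. a k * (if weight_power \<theta> x \<omega> \<ge> 2 ^ k then 1 else 0)))"
    if x: "x \<ge> 1" and a: "\<And>k. a k \<ge> 0" and d: "d \<ge> 0" for x c d a and n :: nat
  proof -
    have ev [measurable]: "{\<omega> \<in> space M. weight_power \<theta> x \<omega> \<ge> 2 ^ k} \<in> events" for k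
      using x by measurable
    have if_ind: "(if weight_power \<theta> x \<omega> \<ge> 2 ^ k then 1 else 0 :: real)
        = indicator {\<omega> \<in> space M. weight_power \<theta> x \<omega> \<ge> 2 ^ k} \<omega>" if "\<omega> \<in> space M" for k \<omega>
      using that by (auto simp: indicator_def)
    have int: "integrable M (\<lambda>\<omega>. if weight_power \<theta> x \<omega> \<ge> 2 ^ k then 1 else 0 :: real)" for k
      by (rule integrable_const_bound[of _ 1]) (use x in auto)
    have E: "expectation (\<lambda>\<omega>. if weight_power \<theta> x \<omega> \<ge> 2 ^ k then 1 else 0 :: real)
        = prob {\<omega> \<in> space M. weight_power \<theta> x \<omega> \<ge> 2 ^ k}" for k
    proof -
      have "expectation (\<lambda>\<omega>. if weight_power \<theta> x \<omega> \<ge> 2 ^ k then 1 else 0 :: real)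
          = expectation (indicator {\<omega> \<in> space M. weight_power \<theta> x \<omega> \<ge> 2 ^ k})"
        by (rule Bochner_Integration.integral_cong[OF refl if_ind])
      also have "\<dots> = prob {\<omega> \<in> space M. weight_power \<theta> x \<omega> \<ge> 2 ^ k}"
        using ev[of k] by (simp add: sets.Int_space_eq2)
      finally show ?thesis .
    qed
    show "integrable M (\<lambda>\<omega>. c + d * (\<Sum>k<n. a k * (if weight_power \<theta> x \<omega> \<ge> 2 ^ k then 1 else 0)))"
      by (intro Bochner_Integration.integrable_add integrable_const integrable_mult_right
          Bochner_Integration.integrable_sum int)
    have "expectation (\<lambda>\<omega>. c + d * (\<Sum>k<n. a k * (if weight_power \<theta> x \<omega> \<ge> 2 ^ k then 1 else 0)))
        = c + d * (\<Sum>k<n. a k * prob {\<omega> \<in> space M. weight_power \<theta> x \<omega> \<ge> 2 ^ k})"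
      by (subst Bochner_Integration.integral_add, simp,
          intro integrable_mult_right Bochner_Integration.integrable_sum int,
          subst integral_mult_right_zero, subst Bochner_Integration.integral_sum,
          intro integrable_mult_right int, simp only: integral_mult_right_zero E)
        (simp add: prob_space)
    also have "\<dots> \<le> c + d * (\<Sum>k<n. a k * \<delta> ^ k)"
      by (intro add_left_mono mult_left_mono sum_mono tail x a d)
    finally show "expectation (\<lambda>\<omega>. c + d * (\<Sum>k<n. a k * (if weight_power \<theta> x \<omega> \<ge> 2 ^ k then 1 else 0)))
        \<le> c + d * (\<Sum>k<n. a k * \<delta> ^ k)" .
  qed
  define \<kappa> where "\<kappa> = 1 + 1 / (1 - 2 * \<delta>)"
  have mean: "expectation (Y n x) \<le> \<kappa>" if x: "x \<ge> 1" for n x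
  proof -
    have "expectation (Y n x) \<le> expectation (\<lambda>\<omega>. 1 + 1 * (\<Sum>k<n. 2 ^ k * (if weight_power \<theta> x \<omega> \<ge> 2 ^ k then 1 else 0)))"
      by (intro integral_mono Y_int x level_int)
        (use truncation_le_levels(1)[OF weight_power_ge_1[OF \<theta>(1)]] in \<open>auto simp: Y_def\<close>)
    also have "\<dots> \<le> 1 + 1 * (\<Sum>k<n. 2 ^ k * \<delta> ^ k)"
      using x by (intro level_int) auto
    also have "(\<Sum>k<n. 2 ^ k * \<delta> ^ k) = (\<Sum>k<n. (2 * \<delta>) ^ k)" by (simp add: power_mult_distrib)
    also have "\<dots> \<le> 1 / (1 - 2 * \<delta>)"
    proof -
      have "summable (\<lambda>k. (2 * \<delta>) ^ k)" by (rule summable_geometric) (use d0 d1 in simp)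
      then have "(\<Sum>k<n. (2 * \<delta>) ^ k) \<le> (\<Sum>k. (2 * \<delta>) ^ k)"
        by (rule sum_le_suminf) (use d0 in auto)
      also have "\<dots> = 1 / (1 - 2 * \<delta>)" by (rule suminf_geometric) (use d0 d1 in simp)
      finally show ?thesis .
    qed
    finally show ?thesis by (simp add: \<kappa>_def)
  qed
  have second: "expectation (\<lambda>\<omega>. (Y n x \<omega>)\<^sup>2) \<le> (1 + 3 * real n) * (4 * \<delta>) ^ n" if x: "x \<ge> 1" for n x
  proof -
    have "integrable M (\<lambda>\<omega>. (Y n x \<omega>)\<^sup>2)"
    proof (rule integrable_const_bound[of _ "(2 ^ n)\<^sup>2"])
      have "(Y n x \<omega>)\<^sup>2 \<le> (2 ^ n)\<^sup>2" for \<omega> using Y_bound by (intro power_mono) auto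
      then show "AE \<omega> in M. norm ((Y n x \<omega>)\<^sup>2) \<le> (2 ^ n)\<^sup>2" by auto
    qed (use x in measurable)
    then have "expectation (\<lambda>\<omega>. (Y n x \<omega>)\<^sup>2)
        \<le> expectation (\<lambda>\<omega>. 1 + 3 * (\<Sum>k<n. 4 ^ k * (if weight_power \<theta> x \<omega> \<ge> 2 ^ k then 1 else 0)))"
      by (rule integral_mono[OF _ level_int(2)[OF x]])
        (use truncation_le_levels(2)[OF weight_power_ge_1[OF \<theta>(1)]] in \<open>auto simp: Y_def\<close>)
    also have "\<dots> \<le> 1 + 3 * (\<Sum>k<n. 4 ^ k * \<delta> ^ k)"
      using x by (intro level_int) auto
    also have "(\<Sum>k<n. 4 ^ k * \<delta> ^ k) \<le> (\<Sum>k<n. (4 * \<delta>) ^ n)"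
      unfolding power_mult_distrib[symmetric] using d2 by (intro sum_mono power_increasing) auto
    also have "1 + 3 * (\<Sum>k<n. (4 * \<delta>) ^ n) \<le> (4 * \<delta>) ^ n + 3 * (\<Sum>k<n. (4 * \<delta>) ^ n)"
      using d2 by (intro add_right_mono one_le_power) simp
    finally show ?thesis by (simp add: algebra_simps)
  qed
  define I where "I n = {1..2 ^ n :: nat}" for n :: nat
  have I: "finite (I n)" "card (I n) = 2 ^ n" "\<And>x. x \<in> I n \<Longrightarrow> x \<ge> 1" for n
    by (auto simp: I_def)
  define T where "T n \<omega> = (\<Sum>x\<in>I n. Y n x \<omega>)" for n \<omega>
  have T_meas [measurable]: "T n \<in> borel_measurable M" for n
    unfolding T_def using I by measurable
  have T_mean: "expectation (T n) \<le> 2 ^ n * \<kappa>" for n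
  proof -
    have "expectation (T n) = (\<Sum>x\<in>I n. expectation (Y n x))"
      unfolding T_def using I Y_int by (intro Bochner_Integration.integral_sum) auto
    also have "\<dots> \<le> (\<Sum>x\<in>I n. \<kappa>)" using I mean by (intro sum_mono) auto
    finally show ?thesis using I by simp
  qed
  have T2: "integrable M (\<lambda>\<omega>. (T n \<omega>)\<^sup>2)" for n
  proof (rule integrable_const_bound[of _ "(\<Sum>x\<in>I n. 2 ^ n)\<^sup>2"])
    have "(T n \<omega>)\<^sup>2 \<le> (\<Sum>x\<in>I n. 2 ^ n)\<^sup>2" for \<omega>
      unfolding T_def using Y_bound by (intro power_mono sum_mono sum_nonneg) auto
    then show "AE \<omega> in M. norm ((T n \<omega>)\<^sup>2) \<le> (\<Sum>x\<in>I n. 2 ^ n)\<^sup>2" by auto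
  qed measurable
  have T_int: "integrable M (T n)" for n
    using square_integrable_imp_integrable[OF T_meas T2] .
  have T_var: "variance (T n) \<le> 2 ^ n * ((1 + 3 * real n) * (4 * \<delta>) ^ n)" for n
  proof -
    have "variance (T n) = expectation (\<lambda>\<omega>. (T n \<omega>)\<^sup>2) - (expectation (T n))\<^sup>2"
      by (rule variance_eq[OF T_int T2])
    also have "\<dots> \<le> (\<Sum>x\<in>I n. expectation (\<lambda>\<omega>. (Y n x \<omega>)\<^sup>2))"
      unfolding T_def
    proof (rule variance_sum_le[where B = "2 ^ n"])
      have "indep_vars (\<lambda>_. borel) (Y n) {1..}"
        unfolding Y_def by (rule weight_power_indep) measurable
      then show "indep_vars (\<lambda>_. borel) (Y n) (I n)"
        by (rule indep_vars_subset) (auto simp: I_def)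
    qed (use I Y_bound in auto)
    also have "\<dots> \<le> (\<Sum>x\<in>I n. (1 + 3 * real n) * (4 * \<delta>) ^ n)"
      using I second by (intro sum_mono) auto
    finally show ?thesis using I by simp
  qed
  define A where "A n = {\<omega> \<in> space M. \<bar>T n \<omega> - expectation (T n)\<bar> \<ge> 2 ^ n}
    \<union> (\<Union>x\<in>I n. {\<omega> \<in> space M. weight_power \<theta> x \<omega> \<ge> 2 ^ n})" for n
  have A_ev: "{\<omega> \<in> space M. weight_power \<theta> x \<omega> \<ge> 2 ^ n} \<in> events" if "x \<in> I n" for x n
    using I(3)[OF that] by measurable
  have A_meas [measurable]: "A n \<in> events" for n
    unfolding A_def using I A_ev by (intro sets.Un sets.finite_UN) auto
  have A_prob: "prob (A n) \<le> (2 + 3 * real n) * (2 * \<delta>) ^ n" for n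
  proof -
    have p4: "(2 ^ n :: real)\<^sup>2 = 4 ^ n" by (simp add: power2_eq_square flip: power_mult_distrib)
    have "prob {\<omega> \<in> space M. \<bar>T n \<omega> - expectation (T n)\<bar> \<ge> 2 ^ n} \<le> variance (T n) / (2 ^ n)\<^sup>2"
      by (rule Chebyshev_inequality) (use T2 in auto)
    also have "\<dots> \<le> 2 ^ n * ((1 + 3 * real n) * (4 * \<delta>) ^ n) / (2 ^ n)\<^sup>2"
      by (intro divide_right_mono T_var) auto
    also have "\<dots> = (1 + 3 * real n) * (2 * \<delta>) ^ n"
      unfolding p4 by (simp add: power_mult_distrib)
    finally have 1: "prob {\<omega> \<in> space M. \<bar>T n \<omega> - expectation (T n)\<bar> \<ge> 2 ^ n}
        \<le> (1 + 3 * real n) * (2 * \<delta>) ^ n" .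
    have "prob (\<Union>x\<in>I n. {\<omega> \<in> space M. weight_power \<theta> x \<omega> \<ge> 2 ^ n})
        \<le> (\<Sum>x\<in>I n. prob {\<omega> \<in> space M. weight_power \<theta> x \<omega> \<ge> 2 ^ n})"
      using I A_ev by (intro finite_measure_subadditive_finite) auto
    also have "\<dots> \<le> (\<Sum>x\<in>I n. \<delta> ^ n)" using I tail by (intro sum_mono) auto
    finally have 2: "prob (\<Union>x\<in>I n. {\<omega> \<in> space M. weight_power \<theta> x \<omega> \<ge> 2 ^ n}) \<le> (2 * \<delta>) ^ n"
      using I by (simp add: power_mult_distrib)
    have "prob (A n) \<le> prob {\<omega> \<in> space M. \<bar>T n \<omega> - expectation (T n)\<bar> \<ge> 2 ^ n}
        + prob (\<Union>x\<in>I n. {\<omega> \<in> space M. weight_power \<theta> x \<omega> \<ge> 2 ^ n})"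
      unfolding A_def using I A_ev by (intro measure_Un_le sets.finite_UN) auto
    then show ?thesis using 1 2 by (simp add: algebra_simps)
  qed
  have "summable (\<lambda>n. of_nat (Suc n) * (2 * \<delta>) ^ n)"
    using geometric_deriv_sums[of "2 * \<delta>"] d0 d1 by (auto simp: sums_iff)
  then have "summable (\<lambda>n. 3 * (of_nat (Suc n) * (2 * \<delta>) ^ n))" by (rule summable_mult)
  then have "summable (\<lambda>n. (2 + 3 * real n) * (2 * \<delta>) ^ n)"
    by (rule summable_comparison_test'[of _ 0])
      (use d0 in \<open>auto simp: abs_mult mult.assoc[symmetric] intro!: mult_right_mono\<close>)
  then have "summable (\<lambda>n. prob (A n))"
    by (rule summable_comparison_test') (use A_prob in auto)
  from borel_cantelli_AE1[OF A_meas _ this]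
  have ae: "AE \<omega> in M. \<forall>\<^sub>F n in sequentially. \<omega> \<in> space M - A n" by (simp add: emeasure_eq_measure)
  have good: "(\<Sum>x\<in>{1..2 ^ n}. weight_power \<theta> x \<omega>) \<le> (\<kappa> + 1) * 2 ^ n" if "\<omega> \<in> space M - A n" for n \<omega>
  proof -
    have "T n \<omega> < expectation (T n) + 2 ^ n" using that by (auto simp: A_def)
    then have "T n \<omega> \<le> (\<kappa> + 1) * 2 ^ n" using T_mean[of n] by (simp add: algebra_simps)
    moreover have "T n \<omega> = (\<Sum>x\<in>{1..2 ^ n}. weight_power \<theta> x \<omega>)"
      unfolding T_def I_def
    proof (intro sum.cong refl)
      fix x assume "x \<in> {1..2 ^ n :: nat}"
      then have "\<not> weight_power \<theta> x \<omega> \<ge> 2 ^ n" using that by (auto simp: A_def I_def)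
      then show "Y n x \<omega> = weight_power \<theta> x \<omega>" by (simp add: Y_def)
    qed
    ultimately show ?thesis by simp
  qed
  have \<kappa>: "\<kappa> > 0" using d1 by (simp add: \<kappa>_def add_pos_pos)
  show ?thesis
  proof (intro exI conjI)
    show "2 * (\<kappa> + 1) > 0" using \<kappa> by simp
    show "AE \<omega> in M. \<forall>\<^sub>F N in sequentially. (\<Sum>x\<in>{1..N}. weight_power \<theta> x \<omega>) \<le> 2 * (\<kappa> + 1) * real N"
      using ae
    proof eventually_elim
      case (elim \<omega>)
      then obtain n0 where n0: "\<And>n. n \<ge> n0 \<Longrightarrow> \<omega> \<in> space M - A n"
        by (auto simp: eventually_sequentially)
      show ?case
        unfolding eventually_sequentially
      proof (intro exI allI impI)
        fix N :: nat assume N: "2 ^ n0 \<le> N"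
        then have "N \<ge> 1" by (metis less_one linorder_not_less order_less_le_trans zero_less_numeral zero_less_power)
        then obtain n where n: "2 ^ n \<le> N" "N < 2 ^ (n + 1)"
          using ex_power_ivl1[of 2 N] by auto
        have "n0 \<le> n + 1"
        proof (rule ccontr)
          assume "\<not> n0 \<le> n + 1"
          then have "(2 :: nat) ^ (n + 1) \<le> 2 ^ n0" by (intro power_increasing) auto
          then show False using n N by simp
        qed
        then have "(\<Sum>x\<in>{1..2 ^ (n + 1)}. weight_power \<theta> x \<omega>) \<le> (\<kappa> + 1) * 2 ^ (n + 1)"
          by (intro good n0)
        moreover have "(\<Sum>x\<in>{1..N}. weight_power \<theta> x \<omega>) \<le> (\<Sum>x\<in>{1..2 ^ (n + 1)}. weight_power \<theta> x \<omega>)"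
          using n weight_power_ge_1[OF \<theta>(1)] by (intro sum_mono2) (auto intro: order_trans[of 0 1])
        moreover have "(\<kappa> + 1) * 2 ^ (n + 1) \<le> (\<kappa> + 1) * (2 * real N)"
        proof (rule mult_left_mono)
          have "real (2 ^ n) \<le> real N" using n(1) by (simp only: of_nat_le_iff)
          then show "(2 :: real) ^ (n + 1) \<le> 2 * real N" by simp
        qed (use \<kappa> in simp)
        ultimately show "(\<Sum>x\<in>{1..N}. weight_power \<theta> x \<omega>) \<le> 2 * (\<kappa> + 1) * real N"
          by (simp add: mult_ac)
      qed
    qed
  qed
qed

end

section \<open>The mixing time of scale-free percolation\<close>

locale percolation_regime = scale_free_percolation +
  fixes \<theta> C :: real
  assumes theta: "0 < \<theta>" "\<theta> \<le> 1"
    and exponent: "\<alpha> * \<theta> > 2"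
    and C_pos: "C > 0"
    and weight_sum: "AE \<omega> in M. \<forall>\<^sub>F N in sequentially. (\<Sum>x\<in>{1..N}. weight_power \<theta> x \<omega>) \<le> C * real N"
begin

abbreviation \<beta> :: real where "\<beta> \<equiv> \<alpha> * \<theta>"

abbreviation \<zeta> :: real where "\<zeta> \<equiv> weighted_torus.zeta \<alpha> \<theta>"

text \<open>The exponent is less than one, and it is chosen so that \<open>short_range N\<close> to the power \<open>1 - \<beta>\<close> is
  \<open>N\<close> to the power \<open>- \<beta> / 2\<close>.\<close>

definition short_range :: "nat \<Rightarrow> real" where
  "short_range N = real N powr (\<beta> / 2 / (\<beta> - 1))"

lemma weighted_torusI:
  assumes "\<forall>x\<ge>1. W x \<omega> \<ge> 1"
  shows "weighted_torus \<alpha> \<theta> (\<lambda>x. W x \<omega>)"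
  by unfold_locales (use assms theta exponent in auto)

lemma intensity_eq:
  assumes "\<forall>x\<ge>1. W x \<omega> \<ge> 1"
  shows "intensity N \<omega> e = weighted_torus.rate \<alpha> (\<lambda>x. W x \<omega>) N e"
    and "connection_prob N \<omega> e = weighted_torus.edge_prob \<alpha> (\<lambda>x. W x \<omega>) N e"
    and "(\<Sum>x\<in>{1..N}. weight_power \<theta> x \<omega>) = weighted_torus.total_weight \<theta> (\<lambda>x. W x \<omega>) N"
proof -
  interpret wt: weighted_torus \<alpha> \<theta> "\<lambda>x. W x \<omega>" N by (rule weighted_torusI[OF assms])
  show *: "intensity N \<omega> e = wt.rate e" by (simp add: intensity_def wt.rate_def)
  show "connection_prob N \<omega> e = wt.edge_prob e" by (simp add: connection_prob_def wt.edge_prob_def *)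
  show "(\<Sum>x\<in>{1..N}. weight_power \<theta> x \<omega>) = wt.total_weight"
    unfolding wt.total_weight_def wt.v_def weight_power_def
    using assms by (intro sum.cong refl) (auto simp: max_absorb2)
qed

lemma zeta_nonneg: "\<zeta> \<ge> 0"
proof -
  interpret wt: weighted_torus \<alpha> \<theta> "\<lambda>_. 1" 0 by unfold_locales (use theta exponent in auto)
  show ?thesis by (rule wt.zeta_nonneg)
qed

lemma AE_card_open_pairs_le:
  "AE \<omega> in M. \<forall>\<^sub>F N in sequentially.
    real (card (random_pairs N \<inter> open_pairs N \<omega>)) \<le> 2 * (2 * \<zeta> * C + 4) * real N"
proof -
  have "AE \<omega> in M. \<forall>\<^sub>F N in sequentially.
      (\<Sum>e\<in>random_pairs N. if e \<in> open_pairs N \<omega> then ln (1 + 1) else 0)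
        < (\<Sum>e\<in>random_pairs N. 1 * connection_prob N \<omega> e) + 4 * ln (real N)"
    by (rule AE_eventually_open_pairs_le) auto
  then show ?thesis using AE_weight_ge_1 weight_sum
  proof eventually_elim
    case (elim \<omega>)
    from elim(1,3) eventually_ge_at_top[of 1] show ?case
    proof eventually_elim
      case (elim N)
      interpret wt: weighted_torus \<alpha> \<theta> "\<lambda>x. W x \<omega>" N
        by (rule weighted_torusI) fact
      note eqs = intensity_eq[OF \<open>\<forall>x\<ge>1. W x \<omega> \<ge> 1\<close>]
      have "ln 2 * real (card (random_pairs N \<inter> open_pairs N \<omega>))
          = (\<Sum>e\<in>random_pairs N \<inter> open_pairs N \<omega>. ln (1 + 1))" by simp
      also have "\<dots> = (\<Sum>e\<in>random_pairs N. if e \<in> open_pairs N \<omega> then ln (1 + 1) else 0)"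
        by (rule sum.inter_restrict[OF finite_random_pairs])
      also have "\<dots> \<le> (\<Sum>e\<in>random_pairs N. wt.edge_prob e) + 4 * ln (real N)"
        using elim(1) by (simp add: eqs)
      also have "\<dots> \<le> 2 * \<zeta> * (C * real N) + 4 * real N"
      proof (intro add_mono)
        have "2 * \<zeta> * wt.total_weight \<le> 2 * \<zeta> * (C * real N)"
          using elim(2)[unfolded eqs(3)] zeta_nonneg by (intro mult_left_mono) auto
        then show "(\<Sum>e\<in>random_pairs N. wt.edge_prob e) \<le> 2 * \<zeta> * (C * real N)"
          using wt.sum_edge_prob_le by linarith
        show "4 * ln (real N) \<le> 4 * real N" using elim(3) ln_le_minus_one[of "real N"] by simp
      qed
      finally have "ln 2 * real (card (random_pairs N \<inter> open_pairs N \<omega>)) \<le> (2 * \<zeta> * C + 4) * real N"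
        by (simp add: algebra_simps)
      moreover have "1 / 2 * real (card (random_pairs N \<inter> open_pairs N \<omega>))
          \<le> ln 2 * real (card (random_pairs N \<inter> open_pairs N \<omega>))"
        using ln2_ge_two_thirds by (intro mult_right_mono) auto
      ultimately show ?case by linarith
    qed
  qed
qed

text \<open>The expected number of edges longer than \<open>\<delta> N\<close> is of order \<open>N\<close> to the power \<open>2 - \<beta>\<close>. The inverse of
  this order as the coefficient in the exponential bound keeps the compensator bounded, and \<open>k\<close> edges
  exceed the deviation \<open>4 ln N\<close> as soon as \<open>k (\<beta> - 2) \<ge> 5\<close>.\<close>

lemma AE_long_edges_lt:
  assumes \<delta>: "\<delta> > 0" and k: "real k * (\<beta> - 2) \<ge> 5"
  shows "AE \<omega> in M. \<forall>\<^sub>F N in sequentially.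
    card {(x, y) \<in> random_pairs N \<inter> open_pairs N \<omega>. torus_dist N x y > \<delta> * real N} < k"
proof -
  define S where "S N = {(x, y) \<in> random_pairs N. torus_dist N x y > \<delta> * real N}" for N
  define A where "A N = real N powr (\<beta> - 2)" for N
  have "AE \<omega> in M. \<forall>\<^sub>F N in sequentially.
      (\<Sum>e\<in>S N. if e \<in> open_pairs N \<omega> then ln (1 + A N) else 0)
        < (\<Sum>e\<in>S N. A N * connection_prob N \<omega> e) + 4 * ln (real N)"
    by (rule AE_eventually_open_pairs_le) (auto simp: S_def A_def)
  then show ?thesis using AE_weight_ge_1 weight_sum
  proof eventually_elim
    case (elim \<omega>)
    have "\<forall>\<^sub>F N in sequentially. ln (real N) > C\<^sup>2 * \<delta> powr (- \<beta>)" by real_asymp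
    with elim(1,3) show ?case using eventually_ge_at_top[of 2]
    proof eventually_elim
      case (elim N)
      interpret wt: weighted_torus \<alpha> \<theta> "\<lambda>x. W x \<omega>" N
        by (rule weighted_torusI) fact
      note eqs = intensity_eq[OF \<open>\<forall>x\<ge>1. W x \<omega> \<ge> 1\<close>]
      define L where "L = S N \<inter> open_pairs N \<omega>"
      have fS: "finite (S N)" by (rule finite_subset[OF _ finite_random_pairs[of N]]) (auto simp: S_def)
      have N: "real N \<ge> 2" using elim(4) by simp
      have "real (card L) * ln (1 + A N) = (\<Sum>e\<in>S N. if e \<in> open_pairs N \<omega> then ln (1 + A N) else 0)"
        unfolding L_def using sum.inter_restrict[OF fS, of "\<lambda>_. ln (1 + A N)" "open_pairs N \<omega>"] by simp
      also have "\<dots> < (\<Sum>e\<in>S N. A N * wt.edge_prob e) + 4 * ln (real N)"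
        using elim(1) by (simp add: eqs)
      also have "(\<Sum>e\<in>S N. A N * wt.edge_prob e) \<le> A N * (\<delta> * real N) powr (- \<beta>) * wt.total_weight\<^sup>2"
      proof (rule wt.sum_weighted_edge_prob_le)
        fix x y assume "(x, y) \<in> S N"
        then have "torus_dist N x y powr (- \<beta>) \<le> (\<delta> * real N) powr (- \<beta>)"
          using \<delta> N exponent by (intro powr_mono2') (auto simp: S_def)
        then show "A N * torus_dist N x y powr (- (2 * (\<beta> / 2))) \<le> A N * (\<delta> * real N) powr (- \<beta>)"
          by (intro mult_left_mono) (auto simp: A_def)
      qed (auto simp: S_def A_def)
      also have "\<dots> \<le> A N * (\<delta> * real N) powr (- \<beta>) * (C * real N)\<^sup>2"
        using elim(2)[unfolded eqs(3)] wt.total_weight_nonneg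
        by (intro mult_left_mono power_mono) (auto simp: A_def)
      also have "\<dots> = C\<^sup>2 * \<delta> powr (- \<beta>)"
      proof -
        have "A N * real N powr (- \<beta>) * real N powr 2 = real N powr ((\<beta> - 2) + (- \<beta>) + 2)"
          by (simp only: A_def powr_add)
        also have "\<dots> = 1" using N by simp
        finally have "A N * real N powr (- \<beta>) * (real N)\<^sup>2 = 1" using N by (simp only: powr_numeral)
        moreover have "A N * (\<delta> * real N) powr (- \<beta>) * (C * real N)\<^sup>2
            = (C\<^sup>2 * \<delta> powr (- \<beta>)) * (A N * real N powr (- \<beta>) * (real N)\<^sup>2)"
          using \<delta> N by (simp add: powr_mult power_mult_distrib mult_ac)
        ultimately show ?thesis by simp
      qed
      finally have upper: "real (card L) * ln (1 + A N) < C\<^sup>2 * \<delta> powr (- \<beta>) + 4 * ln (real N)" by simp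
      have "card L < k"
      proof (rule ccontr)
        assume "\<not> card L < k"
        then have "real k \<le> real (card L)" by simp
        moreover have "(\<beta> - 2) * ln (real N) \<le> ln (1 + A N)"
        proof -
          have "(\<beta> - 2) * ln (real N) = ln (A N)" using N by (simp add: A_def ln_powr)
          also have "\<dots> \<le> ln (1 + A N)" using N by (intro ln_mono) (auto simp: A_def)
          finally show ?thesis .
        qed
        ultimately have "real k * ((\<beta> - 2) * ln (real N)) \<le> real (card L) * ln (1 + A N)"
          using exponent N by (intro mult_mono) auto
        moreover have "5 * ln (real N) \<le> real k * (\<beta> - 2) * ln (real N)"
          using k N by (intro mult_right_mono) auto
        ultimately show False using upper elim(3) by (simp add: mult.assoc)
      qed
      moreover have "L = {(x, y) \<in> random_pairs N \<inter> open_pairs N \<omega>. torus_dist N x y > \<delta> * real N}"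
        by (auto simp: L_def S_def)
      ultimately show ?case by simp
    qed
  qed
qed

text \<open>An exponential moment of the sum of the lengths, with parameter \<open>a = c ln N / (\<delta> N)\<close>. As lengths are at most
  \<open>\<delta> N\<close>, the exponential of \<open>a\<close> times a length is at most \<open>N\<close> to the power \<open>c\<close>, and the small
  number \<open>c = (\<beta> - 2) / 4\<close> leaves the compensator below \<open>ln N\<close> for lengths above \<open>short_range N\<close>. Dividing the
  deviation \<open>5 ln N\<close> by \<open>a\<close> gives a multiple of \<open>\<delta> N\<close>.\<close>

lemma AE_medium_edges_le:
  assumes \<delta>: "0 < \<delta>" "\<delta> \<le> 1 / 2"
  shows "AE \<omega> in M. \<forall>\<^sub>F N in sequentially.
    (\<Sum>(x, y) | (x, y) \<in> random_pairs N \<inter> open_pairs N \<omega> \<and> short_range N < real y - real x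
        \<and> real y - real x \<le> \<delta> * real N. real y - real x) \<le> 20 * \<delta> / (\<beta> - 2) * real N"
proof -
  define c where "c = (\<beta> - 2) / 4"
  have c: "c > 0" using exponent by (simp add: c_def)
  define len where "len e = real (snd e) - real (fst e)" for e :: "nat \<times> nat"
  define S where "S N = {e \<in> random_pairs N. short_range N < len e \<and> len e \<le> \<delta> * real N}" for N
  define a where "a N = c * ln (real N) / (\<delta> * real N)" for N
  define A where "A N e = exp (a N * len e) - 1" for N e
  have a_nonneg: "a N \<ge> 0" for N
    using c \<delta> by (cases "N = 0") (auto simp: a_def intro!: divide_nonneg_nonneg mult_nonneg_nonneg)
  have len_nonneg: "len e \<ge> 0" if "e \<in> S N" for N e
  proof -
    have "fst e < snd e" using that random_pairs_bounds(2)[of "fst e" "snd e" N] by (simp add: S_def)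
    then show ?thesis by (simp add: len_def)
  qed
  have "AE \<omega> in M. \<forall>\<^sub>F N in sequentially.
      (\<Sum>e\<in>S N. if e \<in> open_pairs N \<omega> then ln (1 + A N e) else 0)
        < (\<Sum>e\<in>S N. A N e * connection_prob N \<omega> e) + 4 * ln (real N)"
    by (rule AE_eventually_open_pairs_le) (use a_nonneg len_nonneg in \<open>auto simp: S_def A_def\<close>)
  then show ?thesis using AE_weight_ge_1 weight_sum
  proof eventually_elim
    case (elim \<omega>)
    have small: "\<forall>\<^sub>F N in sequentially.
        c / \<delta> * C\<^sup>2 * real N powr (- c) \<le> 1"
      using c \<delta> by real_asymp
    from elim(1,3) small show ?case using eventually_ge_at_top[of 3]
    proof eventually_elim
      case (elim N)
      interpret wt: weighted_torus \<alpha> \<theta> "\<lambda>x. W x \<omega>" N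
        by (rule weighted_torusI) fact
      note eqs = intensity_eq[OF \<open>\<forall>x\<ge>1. W x \<omega> \<ge> 1\<close>]
      have N: "real N \<ge> 3" using elim(4) by simp
      have lnN: "ln (real N) > 0" using N by simp
      have ap: "a N > 0" using c \<delta> N lnN by (simp add: a_def)
      define L where "L = S N \<inter> open_pairs N \<omega>"
      have fS: "finite (S N)" by (rule finite_subset[OF _ finite_random_pairs[of N]]) (auto simp: S_def)
      have R: "short_range N > 0" using N by (simp add: short_range_def)
      let ?M = "a N * real N powr c * short_range N powr (1 - \<beta>)"
      have "a N * (\<Sum>e\<in>L. len e) = (\<Sum>e\<in>S N. if e \<in> open_pairs N \<omega> then ln (1 + A N e) else 0)"
        unfolding L_def using sum.inter_restrict[OF fS, of "\<lambda>e. ln (1 + A N e)" "open_pairs N \<omega>"]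
        by (simp add: A_def sum_distrib_left)
      also have "\<dots> < (\<Sum>e\<in>S N. A N e * wt.edge_prob e) + 4 * ln (real N)"
        using elim(1) by (simp add: eqs)
      also have "(\<Sum>e\<in>S N. A N e * wt.edge_prob e) \<le> ?M * wt.total_weight\<^sup>2"
      proof (rule wt.sum_weighted_edge_prob_le)
        fix x y assume e: "(x, y) \<in> S N"
        define l where "l = real y - real x"
        have l: "short_range N < l" "l \<le> \<delta> * real N" using e by (auto simp: S_def len_def l_def)
        have "\<delta> * real N \<le> real N / 2" using \<delta> mult_right_mono[of \<delta> "1 / 2" "real N"] by simp
        then have d: "torus_dist N x y = l"
          using torus_dist_random_pair(1)[of x y N] e l by (simp add: S_def l_def min_def)
        have "A N (x, y) \<le> a N * l * exp (a N * l)"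
        proof -
          have "exp u - 1 \<le> u * exp u" for u :: real
          proof -
            have "exp u * (1 - u) \<le> exp u * exp (- u)"
              using exp_ge_add_one_self[of "- u"] by (intro mult_left_mono) auto
            also have "\<dots> = 1" by (simp add: mult_exp_exp)
            finally show ?thesis by (simp add: algebra_simps)
          qed
          from this[of "a N * l"] show ?thesis by (simp add: A_def len_def l_def)
        qed
        also have "exp (a N * l) \<le> real N powr c"
        proof -
          have "a N * l \<le> a N * (\<delta> * real N)" using l ap by (intro mult_left_mono) auto
          also have "\<dots> = c * ln (real N)" using \<delta> N by (simp add: a_def)
          finally show ?thesis using N by (simp add: powr_def)
        qed
        finally have "A N (x, y) \<le> a N * l * real N powr c"
          using ap l R by (simp add: mult_left_mono)
        then have "A N (x, y) * l powr (- \<beta>) \<le> a N * l * real N powr c * l powr (- \<beta>)"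
          by (intro mult_right_mono) auto
        also have "\<dots> = a N * real N powr c * l powr (1 - \<beta>)"
          using l R by (simp add: powr_diff powr_minus divide_inverse)
        also have "\<dots> \<le> ?M"
          using l R exponent ap by (intro mult_left_mono powr_mono2') auto
        finally show "A N (x, y) * torus_dist N x y powr (- (2 * (\<beta> / 2))) \<le> ?M"
          by (simp add: d)
      qed (use a_nonneg len_nonneg in \<open>auto simp: S_def A_def\<close>)
      also have "?M * wt.total_weight\<^sup>2 \<le> ?M * (C * real N)\<^sup>2"
        using elim(2)[unfolded eqs(3)] wt.total_weight_nonneg a_nonneg
        by (intro mult_left_mono power_mono) auto
      also have "\<dots> = ln (real N) * (c / \<delta> * C\<^sup>2 * real N powr (- c))"
      proof -
        have "short_range N powr (1 - \<beta>) = real N powr (- (\<beta> / 2))"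
        proof -
          have cancel: "u / d * d = u" if "d \<noteq> 0" for u d :: real using that by simp
          have "\<beta> / 2 / (\<beta> - 1) * (1 - \<beta>) = - (\<beta> / 2 / (\<beta> - 1) * (\<beta> - 1))"
            by (simp only: minus_diff_eq[symmetric, of 1] mult_minus_right)
          also have "\<beta> / 2 / (\<beta> - 1) * (\<beta> - 1) = \<beta> / 2"
            by (rule cancel) (use exponent in linarith)
          finally show ?thesis by (simp only: short_range_def powr_powr)
        qed
        then have "?M * (C * real N)\<^sup>2
            = ln (real N) * (c / \<delta> * C\<^sup>2 * (real N powr c * real N powr (- (\<beta> / 2)) * real N powr 2 / real N))"
          using N \<delta> by (simp add: a_def power_mult_distrib field_simps)
        also have "real N powr c * real N powr (- (\<beta> / 2)) * real N powr 2 / real N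
            = real N powr (c + (- (\<beta> / 2)) + 2 - 1)"
          using N by (simp only: powr_add powr_diff) simp
        also have "c + (- (\<beta> / 2)) + 2 - 1 = - c" by (simp add: c_def field_simps)
        finally show ?thesis .
      qed
      also have "\<dots> \<le> ln (real N) * 1" using elim(3) lnN by (intro mult_left_mono) auto
      finally have "a N * (\<Sum>e\<in>L. len e) \<le> 5 * ln (real N)" by simp
      then have "(\<Sum>e\<in>L. len e) \<le> 5 * ln (real N) / a N" using ap by (simp add: field_simps)
      also have "\<dots> = 20 * \<delta> / (\<beta> - 2) * real N"
        using lnN exponent \<delta> by (simp add: a_def c_def field_simps)
      finally have "(\<Sum>e\<in>L. len e) \<le> 20 * \<delta> / (\<beta> - 2) * real N" .
      moreover have "(\<Sum>(x, y) | (x, y) \<in> random_pairs N \<inter> open_pairs N \<omega> \<and> short_range N < real y - real x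
        \<and> real y - real x \<le> \<delta> * real N. real y - real x) = (\<Sum>e\<in>L. len e)"
        by (rule sum.cong) (auto simp: L_def S_def len_def)
      ultimately show ?case by simp
    qed
  qed
qed

text \<open>For at least half of the points of a block the sum of the rates of all pairs crossing the point is bounded, so each of
  them is uncrossed with conditional probability bounded below. No pair of length at most \<open>short_range N\<close>
  crosses two points that are congruent modulo a number \<open>r\<close> above this length, so the points of a residue class
  modulo \<open>r\<close> can be treated as independent. Summing the deviations over all \<open>r\<close> classes costs
  \<open>4 r ln N\<close>, which is of smaller order than \<open>N\<close>.\<close>

lemma AE_short_uncrossed_ge:
  assumes k: "k \<ge> 1"
  shows "\<exists>\<eta>>0. AE \<omega> in M. \<forall>\<^sub>F N in sequentially. \<forall>j<2 * k.
    \<eta> * real N \<le> card {z \<in> block N k j. crossing N (short_range N) z \<inter> open_pairs N \<omega> = {}}"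
proof -
  \<comment> \<open>load level exceeded by at most \<open>N / (16 k)\<close> points, while a block has at least \<open>N / (8 k)\<close>\<close>
  define K where "K = max 1 (32 * \<zeta> * C * real k)"
  have K: "K \<ge> 1" "32 * \<zeta> * C * real k \<le> K" by (auto simp: K_def)
  define q where "q = exp (- ((K\<^sup>2) powr (1 / \<theta>)))"
  have q: "q > 0" by (simp add: q_def)
  define r where "r N = nat \<lceil>short_range N\<rceil> + 1" for N
  have r_pos: "r N > 0" for N by (simp add: r_def)
  have short0: "short_range N \<ge> 0" for N by (simp add: short_range_def)
  have r_bounds: "short_range N \<le> real (r N)" "real (r N) \<le> short_range N + 2" for N
    using short0[of N] unfolding r_def by linarith+
  \<comment> \<open>pairs of a block and a residue class; the case distinction bounds their number also for small \<open>N\<close>\<close>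
  define I where "I N = (if 2 * k * r N \<le> N ^ 2 then {..<2 * k} \<times> {..<r N} else {})" for N
  define Z where "Z N ji = {z \<in> block N k (fst ji). z mod r N = snd ji}" for N and ji :: "nat \<times> nat"
  define S where "S N z = crossing N (short_range N) z" for N z
  have "AE \<omega> in M. \<forall>\<^sub>F N in sequentially. \<forall>ji\<in>I N.
    (\<Sum>z\<in>Z N ji. exp (- (\<Sum>e\<in>S N z. intensity N \<omega> e))) / 2 - 4 * ln (real N)
      < ln 2 * (\<Sum>z\<in>Z N ji. if \<forall>e\<in>S N z. e \<notin> open_pairs N \<omega> then 1 else 0)"
  proof (rule AE_eventually_closed_families_ge)
    show "finite (Z N i)" for N i by (simp add: Z_def block_def)
    show "S N z \<subseteq> random_pairs N" for N z by (auto simp: S_def crossing_def)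
    show "finite (I N)" "card (I N) \<le> N ^ 2" for N by (auto simp: I_def)
    have disj: "S N z \<inter> S N z' = {}" if "z mod r N = z' mod r N" "z < z'" for N z z'
    proof -
      have "r N dvd z' - z" using that mod_eq_dvd_iff_nat[of z z' "r N"] by simp
      then have "r N \<le> z' - z" using that by (intro dvd_imp_le) auto
      then have "real (r N) \<le> real z' - real z" using that by linarith
      then have far: "short_range N \<le> real z' - real z" using r_bounds(1)[of N] by linarith
      show ?thesis
      proof (rule ccontr)
        assume "S N z \<inter> S N z' \<noteq> {}"
        then obtain x y where "(x, y) \<in> S N z" "(x, y) \<in> S N z'" by auto
        then have "x \<le> z" "z' < y" "real y - real x \<le> short_range N" by (auto simp: S_def crossing_def)
        moreover have "real x \<le> real z" "real z' < real y" using calculation by simp_all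
        ultimately show False using far by linarith
      qed
    qed
    show "S N z \<inter> S N z' = {}" if "z \<in> Z N i" "z' \<in> Z N i" "z \<noteq> z'" for N i z z'
    proof (cases "z < z'")
      case True
      then show ?thesis using that by (intro disj) (auto simp: Z_def)
    next
      case False
      then have "S N z' \<inter> S N z = {}" using that by (intro disj) (auto simp: Z_def)
      then show ?thesis by blast
    qed
  qed
  moreover have "AE \<omega> in M. \<omega> \<in> space M" by simp
  ultimately have "AE \<omega> in M. \<forall>\<^sub>F N in sequentially. \<forall>j<2 * k. q / (64 * real k) * real N
      \<le> card {z \<in> block N k j. crossing N (short_range N) z \<inter> open_pairs N \<omega> = {}}"
    using AE_weight_ge_1 weight_sum
  proof eventually_elim
    case (elim \<omega>)
    define \<rho> where "\<rho> = \<beta> / 2 / (\<beta> - 1)"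
    have \<rho>: "0 < \<rho>" "\<rho> < 1" using exponent by (auto simp: \<rho>_def field_simps)
    have qk: "q / (64 * real k) > 0" using q k by simp
    have k0: "real k > 0" using k by simp
    have "\<forall>\<^sub>F N in sequentially. 2 * real k * (real N powr \<rho> + 2) \<le> real N ^ 2"
      "\<forall>\<^sub>F N in sequentially. real N powr \<rho> \<le> real N / 2"
      "\<forall>\<^sub>F N in sequentially. 4 * (real N powr \<rho> + 2) * ln (real N) \<le> q / (64 * real k) * real N"
      using \<rho> qk k0 by real_asymp+
    from elim(1,4) this eventually_ge_at_top[of "8 * k"]
    show ?case
    proof eventually_elim
      case (elim N)
      interpret wt: weighted_torus \<alpha> \<theta> "\<lambda>x. W x \<omega>" N
        by (rule weighted_torusI) fact
      note eqs = intensity_eq[OF \<open>\<forall>x\<ge>1. W x \<omega> \<ge> 1\<close>]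
      have sr: "short_range N = real N powr \<rho>" by (simp add: short_range_def \<rho>_def)
      have N: "real N \<ge> 8 * real k" "real N > 0" using elim(6) k by linarith+
      have I: "I N = {..<2 * k} \<times> {..<r N}"
      proof -
        have "2 * real k * real (r N) \<le> 2 * real k * (real N powr \<rho> + 2)"
          using r_bounds(2)[of N] by (intro mult_left_mono) (auto simp: sr)
        then have "real (2 * k * r N) \<le> real (N ^ 2)" using elim(3) by simp
        then have "2 * k * r N \<le> N ^ 2" by (simp only: of_nat_le_iff)
        then show ?thesis by (simp add: I_def)
      qed
      show ?case
      proof (intro allI impI)
        fix j assume j: "j < 2 * k"
        define B where "B = block N k j"
        define g where "g z = exp (- (\<Sum>e\<in>crossing N (short_range N) z. wt.rate e))" for z
        define u where "u z = (if \<forall>e\<in>S N z. e \<notin> open_pairs N \<omega> then 1 else 0 :: real)" for z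
        have fB: "finite B" by (simp add: B_def block_def)
        have classes: "(\<Sum>i\<in>{..<r N}. \<Sum>z\<in>Z N (j, i). h z) = (\<Sum>z\<in>B. h z)" for h :: "nat \<Rightarrow> real"
          unfolding Z_def B_def fst_conv snd_conv
          by (rule sum.group) (use r_pos[of N] in \<open>auto simp: block_def\<close>)
        have "(\<Sum>i\<in>{..<r N}. (\<Sum>z\<in>Z N (j, i). g z) / 2 - 4 * ln (real N))
            \<le> (\<Sum>i\<in>{..<r N}. ln 2 * (\<Sum>z\<in>Z N (j, i). u z))"
        proof (rule sum_mono)
          fix i assume "i \<in> {..<r N}"
          then have "(j, i) \<in> I N" using I j by simp
          then show "(\<Sum>z\<in>Z N (j, i). g z) / 2 - 4 * ln (real N) \<le> ln 2 * (\<Sum>z\<in>Z N (j, i). u z)"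
            using elim(1) by (intro less_imp_le) (auto simp: g_def u_def S_def eqs)
        qed
        then have "(\<Sum>z\<in>B. g z) / 2 - 4 * real (r N) * ln (real N) \<le> ln 2 * (\<Sum>z\<in>B. u z)"
          by (simp add: sum_subtractf sum_distrib_left[symmetric] sum_divide_distrib[symmetric] classes mult_ac)
        also have "\<dots> \<le> 1 * (\<Sum>z\<in>B. u z)"
          using ln_2_less_1 by (intro mult_right_mono sum_nonneg) (auto simp: u_def)
        also have "(\<Sum>z\<in>B. u z) = card {z \<in> B. crossing N (short_range N) z \<inter> open_pairs N \<omega> = {}}"
        proof -
          have "(\<Sum>z\<in>B. u z) = (\<Sum>z\<in>{z\<in>B. \<forall>e\<in>S N z. e \<notin> open_pairs N \<omega>}. 1)"
            unfolding u_def by (rule sum.inter_filter[symmetric]) (rule fB)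
          also have "{z\<in>B. \<forall>e\<in>S N z. e \<notin> open_pairs N \<omega>}
              = {z \<in> B. crossing N (short_range N) z \<inter> open_pairs N \<omega> = {}}"
            unfolding S_def by blast
          finally show ?thesis by simp
        qed
        finally have 1: "(\<Sum>z\<in>B. g z) / 2 - 4 * real (r N) * ln (real N)
            \<le> card {z \<in> B. crossing N (short_range N) z \<inter> open_pairs N \<omega> = {}}" by simp
        have cB: "real (card B) \<ge> real N / (8 * real k)"
        proof -
          have "N < (N div (4 * k) + 1) * (4 * k)" using k dividend_less_div_times[of "4 * k" N] by simp
          then have "real N < real ((N div (4 * k) + 1) * (4 * k))" by (simp only: of_nat_less_iff)
          then have "real N < (real (N div (4 * k)) + 1) * (4 * real k)"
            by (simp only: of_nat_mult of_nat_add of_nat_1 of_nat_numeral)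
          then have "real N / (4 * real k) \<le> real (N div (4 * k)) + 1" using k by (simp add: field_simps)
          moreover have "real N / (4 * real k) = real N / (8 * real k) + real N / (8 * real k)"
            using k by (simp add: field_simps)
          moreover have "1 \<le> real N / (8 * real k)" using N k by simp
          ultimately have "real N / (8 * real k) \<le> real (N div (4 * k))" by linarith
          then show ?thesis by (simp only: B_def card_block)
        qed
        have tw: "2 * \<zeta> * wt.total_weight / K \<le> real N / (16 * real k)"
        proof -
          have "2 * \<zeta> * wt.total_weight \<le> 2 * \<zeta> * (C * real N)"
            using elim(2)[unfolded eqs(3)] zeta_nonneg by (intro mult_left_mono) auto
          also have "\<dots> = (32 * \<zeta> * C * real k) * (real N / (16 * real k))" using k by simp
          also have "\<dots> \<le> K * (real N / (16 * real k))" using K by (intro mult_right_mono) auto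
          finally show ?thesis using K by (simp add: field_simps)
        qed
        have "q * (real N / (16 * real k)) \<le> q * (real (card B) - 2 * \<zeta> * wt.total_weight / K)"
        proof (rule mult_left_mono)
          have "real N / (8 * real k) = real N / (16 * real k) + real N / (16 * real k)"
            using k by (simp add: field_simps)
          then show "real N / (16 * real k) \<le> real (card B) - 2 * \<zeta> * wt.total_weight / K"
            using cB tw by linarith
        qed (use q in simp)
        also have "\<dots> \<le> (\<Sum>z\<in>B. g z)"
          unfolding g_def q_def
        proof (rule wt.sum_exp_crossing_ge)
          show "short_range N \<le> real N / 2" using elim(4) by (simp add: sr)
          show "B \<subseteq> {1..N}"
          proof -
            have "4 \<le> N" using elim(6) k by linarith
            then show ?thesis
              using block_start_bounds[of j k N] block_start_bounds[of "Suc j" k N] j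
              by (auto simp: B_def block_def)
          qed
        qed (rule K)
        finally have 2: "q * (real N / (16 * real k)) \<le> (\<Sum>z\<in>B. g z)" .
        have "4 * real (r N) * ln (real N) \<le> 4 * (real N powr \<rho> + 2) * ln (real N)"
          using r_bounds(2)[of N] N k by (intro mult_right_mono) (auto simp: sr)
        then have 3: "4 * real (r N) * ln (real N) \<le> q / (64 * real k) * real N" using elim(5) by linarith
        have "q * (real N / (16 * real k)) / 2 = q / (64 * real k) * real N + q / (64 * real k) * real N"
          using k by (simp add: field_simps)
        then show "q / (64 * real k) * real N
            \<le> card {z \<in> block N k j. crossing N (short_range N) z \<inter> open_pairs N \<omega> = {}}"
          using 1 2 3 unfolding B_def by linarith
      qed
    qed
  qed
  then show ?thesis using q k by (intro exI[of _ "q / (64 * real k)"]) auto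
qed

lemma torus_graphI:
  assumes "\<omega> \<in> space M" "N \<ge> 2"
  shows "torus_graph N (G N \<omega>)"
proof
  show "G N \<omega> \<subseteq> torus_edges N"
    using measurable_space[OF graph_measurable[of N] assms(1)] by simp
qed (use assms consecutive_edges in auto)

lemma open_random_pairs_eq:
  assumes "\<omega> \<in> space M" "N \<ge> 2"
  shows "torus_graph.open_random_pairs N (G N \<omega>) = random_pairs N \<inter> open_pairs N \<omega>"
  by (auto simp: torus_graph.open_random_pairs_def[OF torus_graphI[OF assms]] open_pairs_def)

theorem AE_mixing_time_le:
  "AE \<omega> in M. \<forall>\<^sub>F N in sequentially.
    real (mixing_time (torus N) (G N \<omega>)) \<le> real N ^ 2 * ln (real N) powr 2"
  using AE_card_open_pairs_le AE_space
proof eventually_elim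
  case (elim \<omega>)
  define C' where "C' = 2 * (2 * (2 * \<zeta> * C + 4)) + 2"
  have "\<zeta> * C \<ge> 0" using zeta_nonneg C_pos by simp
  then have C': "C' > 0" by (simp add: C'_def)
  have "\<forall>\<^sub>F N in sequentially. 4 * (C' * real N) * real N * ln (4 * (C' * real N)) + 1
      \<le> real N ^ 2 * ln (real N) powr 2"
    using C' by real_asymp
  with elim(1) show ?case using eventually_ge_at_top[of 2]
  proof eventually_elim
    case (elim N)
    interpret torus_graph N "G N \<omega>" by (rule torus_graphI) fact+
    have "total_degree \<le> C' * real N"
      using total_degree_le elim(1) open_random_pairs_eq[OF \<open>\<omega> \<in> space M\<close> elim(3)]
      by (simp add: C'_def algebra_simps)
    then have "4 * total_degree * real N * ln (4 * total_degree)
        \<le> 4 * (C' * real N) * real N * ln (4 * (C' * real N))"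
      using total_degree_ge_1 by (intro mult_mono ln_mono) auto
    then show ?case using mixing_time_le elim(2) by linarith
  qed
qed

theorem AE_mixing_time_ge:
  "\<exists>c>0. AE \<omega> in M. \<forall>\<^sub>F N in sequentially. c * real N ^ 2 \<le> real (mixing_time (torus N) (G N \<omega>))"
proof -
  define k where "k = nat \<lceil>5 / (\<beta> - 2)\<rceil>"
  have "5 / (\<beta> - 2) \<le> real k" unfolding k_def by linarith
  then have k: "real k * (\<beta> - 2) \<ge> 5" using exponent by (simp add: field_simps)
  then have k1: "k \<ge> 1" by (cases k) auto
  obtain \<eta> where \<eta>: "\<eta> > 0" and short: "AE \<omega> in M. \<forall>\<^sub>F N in sequentially. \<forall>j<2 * k.
    \<eta> * real N \<le> card {z \<in> block N k j. crossing N (short_range N) z \<inter> open_pairs N \<omega> = {}}"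
    using AE_short_uncrossed_ge[OF k1] by blast
  \<comment> \<open>edges of medium length cover at most half of the uncrossed points of a block\<close>
  define \<delta> where "\<delta> = min (1 / 16) (\<eta> * (\<beta> - 2) / 40)"
  have \<delta>: "0 < \<delta>" "\<delta> \<le> 1 / 16" "\<delta> \<le> \<eta> * (\<beta> - 2) / 40" "\<delta> \<le> 1 / 2"
    using \<eta> exponent by (auto simp: \<delta>_def)
  have medium_half: "20 * \<delta> / (\<beta> - 2) \<le> \<eta> / 2" using \<delta>(3) exponent by (simp add: field_simps)
  show ?thesis
  proof (intro exI conjI)
    show "(\<eta> / 2) ^ 3 / 256 > 0" using \<eta> by simp
    show "AE \<omega> in M. \<forall>\<^sub>F N in sequentially.
        (\<eta> / 2) ^ 3 / 256 * real N ^ 2 \<le> real (mixing_time (torus N) (G N \<omega>))"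
      using short AE_long_edges_lt[OF \<delta>(1) k] AE_medium_edges_le[OF \<delta>(1,4)] AE_space
    proof eventually_elim
      case (elim \<omega>)
      have "\<forall>\<^sub>F N in sequentially. \<eta> / 2 * real N \<ge> 4" using \<eta> by real_asymp
      with elim(1,2) elim(3) show ?case using eventually_ge_at_top[of 16]
      proof eventually_elim
        case (elim N)
        have N2: "N \<ge> 2" using elim(5) by simp
        interpret torus_graph N "G N \<omega>" by (rule torus_graphI) fact+
        note eq = open_random_pairs_eq[OF \<open>\<omega> \<in> space M\<close> N2]
        have "(\<eta> / 2 * real N) ^ 3 / (256 * real N) \<le> real (mixing_time (torus N) (G N \<omega>))"
        proof (rule mixing_time_ge_blocks[OF k1 _ \<delta>(2)])
          show "card {(x, y) \<in> open_random_pairs. torus_dist N x y > \<delta> * N} < k"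
            using elim(2) by (simp add: eq)
          fix j assume j: "j < 2 * k"
          have "(\<Sum>(x, y) | (x, y) \<in> random_pairs N \<inter> open_pairs N \<omega> \<and> short_range N < real y - real x
              \<and> real y - real x \<le> \<delta> * real N. real y - real x) \<le> \<eta> / 2 * real N"
            using elim(3) mult_right_mono[OF medium_half, of "real N"] by linarith
          moreover have "card {z \<in> block N k j. crossing N (short_range N) z \<inter> (random_pairs N \<inter> open_pairs N \<omega>) = {}}
              = card {z \<in> block N k j. crossing N (short_range N) z \<inter> open_pairs N \<omega> = {}}"
            by (rule arg_cong[of _ _ card]) (auto simp: crossing_def)
          ultimately show "\<eta> / 2 * real N + (\<Sum>(x, y) | (x, y) \<in> open_random_pairs \<and> short_range N < real y - real x
              \<and> real y - real x \<le> \<delta> * N. real y - real x)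
              \<le> card {z \<in> block N k j. crossing N (short_range N) z \<inter> open_random_pairs = {}}"
            using elim(1) j unfolding eq by fastforce
        qed (use elim in auto)
        moreover have "(\<eta> / 2 * real N) ^ 3 / (256 * real N) = (\<eta> / 2) ^ 3 / 256 * real N ^ 2"
          using N2 by (simp add: power_mult_distrib power2_eq_square power3_eq_cube field_simps)
        ultimately show ?case by simp
      qed
    qed
  qed
qed

end

theorem theorem2p5:
  fixes \<alpha> \<tau> :: real
    and M :: "'a measure"
    and W :: "nat \<Rightarrow> 'a \<Rightarrow> real"
    and G :: "nat \<Rightarrow> 'a \<Rightarrow> nat set set"
  assumes "\<alpha> > 2" and "\<tau> > 1" and "\<alpha> * (\<tau> - 1) > 2"
    and "scale_free_percolation M \<alpha> \<tau> W G"
  shows "\<exists>c\<^sub>1 c\<^sub>2 :: real. c\<^sub>1 > 0 \<and> c\<^sub>2 > 0 \<and>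
    (AE \<omega> in M. \<forall>\<^sub>F N in sequentially.
       c\<^sub>1 * real N ^ 2 \<le> real (mixing_time (torus N) (G N \<omega>)) \<and>
       real (mixing_time (torus N) (G N \<omega>)) \<le> real N ^ 2 * (ln (real N)) powr c\<^sub>2)"
proof -
  interpret scale_free_percolation M \<alpha> \<tau> W G by fact
  have "2 / \<alpha> < min 1 (\<tau> - 1)" using assms by (simp add: field_simps)
  then obtain \<theta> where \<theta>: "2 / \<alpha> < \<theta>" "\<theta> < min 1 (\<tau> - 1)" using dense by blast
  have "0 < 2 / \<alpha>" using assms by simp
  then have \<theta>0: "0 < \<theta>" using \<theta> by linarith
  obtain C where "C > 0" and C: "AE \<omega> in M. \<forall>\<^sub>F N in sequentially.
      (\<Sum>x\<in>{1..N}. weight_power \<theta> x \<omega>) \<le> C * real N"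
    using AE_eventually_weight_power_sum_le[of \<theta>] \<theta> \<theta>0 by auto
  interpret percolation_regime M \<alpha> \<tau> W G \<theta> C
  proof
    show "\<alpha> * \<theta> > 2" using \<theta>(1) assms by (simp add: field_simps)
  qed (use \<theta> \<theta>0 \<open>C > 0\<close> C in auto)
  obtain c where c: "c > 0" and lower: "AE \<omega> in M. \<forall>\<^sub>F N in sequentially.
      c * real N ^ 2 \<le> real (mixing_time (torus N) (G N \<omega>))"
    using AE_mixing_time_ge by blast
  have "AE \<omega> in M. \<forall>\<^sub>F N in sequentially. c * real N ^ 2 \<le> real (mixing_time (torus N) (G N \<omega>)) \<and>
       real (mixing_time (torus N) (G N \<omega>)) \<le> real N ^ 2 * (ln (real N)) powr 2"
    using lower AE_mixing_time_le by eventually_elim (rule eventually_conj)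
  \<comment> \<open>any exponent above \<open>1\<close> would do, since the upper bound is \<open>O(N\<^sup>2 log N)\<close>\<close>
  then show ?thesis using c by (intro exI[of _ c] exI[of _ 2]) simp
qed

end
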